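(* Let $T>0$ and $c\in\mathbb{R}$. Let $g\colon[0,+\infty)\to[0,+\infty)$ be a continuous function such that $g(0)=0$ and $g(s)>0$ for all $s>0$, and such that $g$ is continuously differentiable on a right neighborhood $[0,\varepsilon_{0})$ of $s=0$ and on a neighborhood $(N,+\infty)$ of infinity (for some $\varepsilon_{0}>0$ and $N>0$). Suppose also that $$\lim_{s\to0^{+}}\frac{g(s)}{s}=0\qquad\text{and}\qquad g'(\infty):=\lim_{s\to+\infty}g'(s)=0.$$ Let $a\colon\mathbb{R}\to\mathbb{R}$ be a locally integrable $T$-periodic function satisfying $\int_{0}^{T}a(t)\,dt<0$. Furthermore, suppose that there exists an interval $I\subseteq[0,T]$ such that $a(t)\geq0$ for a.e. $t\in I$ and $\int_{I}a(t)\,dt>0$. Then there exists $\lambda^{*}>0$ such that for each $\lambda>\lambda^{*}$ the equation $$u''+cu'+\lambda a(t)g(u)=0$$ has at least two positive $T$-periodic solutions.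
   Context: Solutions are meant in the Carathéodory sense: $u$ is continuously differentiable with $u'$ locally absolutely continuous, and the equation holds for almost every $t$. A positive $T$-periodic solution is a solution $u\colon\mathbb{R}\to\mathbb{R}$ with $u(t+T)=u(t)>0$ for all $t\in\mathbb{R}$. *)

theory Defs
  imports "HOL-Analysis.Analysis"
begin

text \<open>
  Classical \<open>\<epsilon>\<close>-\<open>\<delta>\<close> absolute continuity on a set of reals (intended for intervals), quantifying over
  all finite families of pairwise disjoint open intervals with endpoints in the set.
\<close>
definition abs_continuous_on :: "real set \<Rightarrow> (real \<Rightarrow> real) \<Rightarrow> bool" where
  "abs_continuous_on S f \<longleftrightarrow>
     (\<forall>\<epsilon>>0. \<exists>\<delta>>0. \<forall>(n::nat) x y.
        (\<forall>i<n. x i \<in> S \<and> y i \<in> S \<and> x i \<le> y i) \<longrightarrow>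
        disjoint_family_on (\<lambda>i. {x i<..<y i}) {..<n} \<longrightarrow>
        (\<Sum>i<n. y i - x i) < \<delta> \<longrightarrow>
        (\<Sum>i<n. \<bar>f (y i) - f (x i)\<bar>) < \<epsilon>)"

definition locally_abs_continuous :: "(real \<Rightarrow> real) \<Rightarrow> bool" where
  "locally_abs_continuous f \<longleftrightarrow> (\<forall>x y. abs_continuous_on {x..y} f)"

definition locally_integrable :: "(real \<Rightarrow> real) \<Rightarrow> bool" where
  "locally_integrable f \<longleftrightarrow> (\<forall>x y. f absolutely_integrable_on {x..y})"

text \<open>
  The derivative is taken within \<open>S\<close>, hence one-sided at an endpoint belonging to \<open>S\<close>.  The library
  predicate \<^const>\<open>C1_differentiable_on\<close> uses two-sided derivatives throughout, which would constrain
  a function on \<open>[0, \<epsilon>)\<close> by its values to the left of \<open>0\<close>.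
\<close>
definition cont_differentiable_within :: "(real \<Rightarrow> real) \<Rightarrow> real set \<Rightarrow> bool" where
  "cont_differentiable_within f S \<longleftrightarrow>
     (\<exists>f'. (\<forall>x\<in>S. (f has_real_derivative f' x) (at x within S)) \<and> continuous_on S f')"

text \<open>
  Caratheodory solutions on the real line of \<open>u'' + c u' + \<mu> a(t) g(u) = 0\<close>.  Since \<^const>\<open>deriv\<close> is
  total, differentiability is required wherever a derivative is used.
\<close>
definition caratheodory_solution ::
    "real \<Rightarrow> real \<Rightarrow> (real \<Rightarrow> real) \<Rightarrow> (real \<Rightarrow> real) \<Rightarrow> (real \<Rightarrow> real) \<Rightarrow> bool" where
  "caratheodory_solution c \<mu> a g u \<longleftrightarrow>
     (\<forall>t. u field_differentiable at t) \<and>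
     continuous_on UNIV (deriv u) \<and>
     locally_abs_continuous (deriv u) \<and>
     (AE t in lebesgue. deriv u field_differentiable at t \<and>
        deriv (deriv u) t + c * deriv u t + \<mu> * a t * g (u t) = 0)"

definition positive_periodic_solution ::
    "real \<Rightarrow> real \<Rightarrow> real \<Rightarrow> (real \<Rightarrow> real) \<Rightarrow> (real \<Rightarrow> real) \<Rightarrow> (real \<Rightarrow> real) \<Rightarrow> bool" where
  "positive_periodic_solution T c \<mu> a g u \<longleftrightarrow>
     caratheodory_solution c \<mu> a g u \<and> (\<forall>t. u (t + T) = u t \<and> u t > 0)"

end

theory Submission
  imports Defs "HOL-Complex_Analysis.Great_Picard"
begin

text \<open>
  The proof discretizes the equation in time, finds two solutions of the discrete problem by an order
  argument and Brouwer's fixed point theorem, and lets the mesh tend to zero.  This replaces a degree argument.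

  On the grid of mesh \<open>h = T / n\<close> the periodic problem becomes a fixed point problem for the explicit Euler map
  \<open>z + \<tau> (L z + \<mu> A g(z))\<close> on \<open>n\<close>-periodic sequences, where \<open>L\<close> is the difference operator and \<open>A\<^sub>j\<close> the
  integral of \<open>a\<close> over a cell.  For small \<open>\<tau>\<close> this map is monotone as soon as \<open>g\<close> is Lipschitz, and therefore
  \<open>g\<close> is replaced by Lipschitz functions that converge to it uniformly on bounded sets.

  \<^item> Because \<open>\<integral> a < 0\<close> and \<open>g\<close> varies slowly near \<open>0\<close> and near infinity (\<open>g' \<rightarrow> 0\<close> at both ends), the functions
    \<open>s + \<mu> g(s) w\<close> are strict supersolutions for arbitrarily small and arbitrarily large \<open>s\<close>, where \<open>L w\<close> is minus the
    oscillating part of \<open>a + \<delta> \<bar>a\<bar>\<close>; the term \<open>\<delta> \<bar>a\<bar>\<close> absorbs the error \<open>\<bar>a\<bar> \<bar>g(s + \<dots>) - g(s)\<bar>\<close> pointwise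
    (\<open>grid_supersolution\<close>).
  \<^item> On the interval where \<open>a \<ge> 0\<close> a superposition \<open>\<psi>\<close> of tent functions, extended by zero, is
    bounded below where \<open>L \<psi> < 0\<close>, and satisfies \<open>L \<psi> \<ge> - C A\<close> there.  For \<open>\<mu>\<close> large all multiples \<open>\<theta> \<psi>\<close> with
    \<open>1 \<le> \<theta> \<le> 4\<close> are subsolutions (\<open>grid_subsolution\<close>).

  Let \<open>\<beta>\<^sub>1\<close> be a small and \<open>\<beta>\<^sub>2\<close> a large supersolution.  Monotone iteration from \<open>4 \<psi>\<close> gives a solution \<open>y \<ge> 4 \<psi>\<close>.
  The other solution lies on the boundary of the set \<open>U\<close> of initial points whose orbits sink below \<open>\<beta>\<^sub>1\<close>: that
  boundary is invariant and is a graph over every hyperplane transversal to the diagonal, so Brouwer's theorem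
  yields a fixed point on it.  This solution \<open>x\<close> is neither below \<open>\<beta>\<^sub>1\<close> nor above \<open>2 \<psi>\<close>
  (\<open>threshold_fixed_point\<close>, \<open>grid_two_solutions\<close>).

  Both families of grid solutions have bounded slopes, so the theorem of Arzela and Ascoli gives limits
  \<open>u\<close> and \<open>v\<close> that solve the equation in integrated form (\<open>grid_solutions_converge\<close>).  The lower bounds on
  \<open>x\<close> and \<open>y\<close> make them nonzero; uniqueness of the zero solution of the initial value problem, which follows
  from \<open>g(s) \<le> C s\<close>, makes them positive.  They differ because \<open>2 x \<le> y\<close> at some node of every grid.
  Lebesgue's differentiation theorem, a consequence of Henstock's lemma and Vitali's covering lemma, turns
  the integrated equation into the Caratheodory form.
\<close>

section \<open>Fixed points of monotone maps of a cube\<close>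

lemma bounded_coordinates_convergent_subseq:
  fixes X :: "nat \<Rightarrow> nat \<Rightarrow> real"
  assumes "\<And>k i. i < n \<Longrightarrow> \<bar>X k i\<bar> \<le> B"
  shows "\<exists>r l. strict_mono (r :: nat \<Rightarrow> nat) \<and> (\<forall>i<n. (\<lambda>k. X (r k) i) \<longlonglongrightarrow> l i)"
  using assms
proof (induction n)
  case 0
  show ?case by (rule exI[of _ id]) (auto simp: strict_mono_def)
next
  case (Suc n)
  then obtain r l where r: "strict_mono (r :: nat \<Rightarrow> nat)" and l: "\<forall>i<n. (\<lambda>k. X (r k) i) \<longlonglongrightarrow> l i"
    by (metis less_Suc_eq)
  have "\<forall>k. X (r k) n \<in> {-B..B}"
    using Suc.prems[of n] unfolding atLeastAtMost_iff abs_le_iff by (metis lessI minus_le_iff)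
  then obtain m s where s: "strict_mono (s :: nat \<Rightarrow> nat)" and m: "((\<lambda>k. X (r k) n) \<circ> s) \<longlonglongrightarrow> m"
    using compact_Icc[of "-B" B] unfolding compact_eq_seq_compact_metric seq_compact_def by metis
  have "(\<lambda>k. X ((r \<circ> s) k) i) \<longlonglongrightarrow> (l(n := m)) i" if "i < Suc n" for i
  proof (cases "i = n")
    case True
    then show ?thesis using m by (simp add: o_def)
  next
    case False
    then have "(\<lambda>k. X (r k) i) \<longlonglongrightarrow> l i" using l that by simp
    from LIMSEQ_subseq_LIMSEQ[OF this s] show ?thesis using False by (simp add: o_def)
  qed
  then show ?case using strict_mono_o[OF r s] by metis
qed

text \<open>
  Brouwer's theorem for the cube \<open>[0, b]\<^sup>n\<close> with \<open>n\<close> a natural number rather than a type, as the dimension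
  grows with the number of grid points.  Points are sequences of which only the first \<open>n\<close> entries
  matter; continuity is sequential continuity of these entries.  Kuhn's lemma on the grid of mesh
  \<open>b / (k + 1)\<close> provides, for every coordinate, two nearby points at which \<open>F - id\<close> has opposite signs.
\<close>
theorem brouwer_cube:
  fixes F :: "(nat \<Rightarrow> real) \<Rightarrow> nat \<Rightarrow> real"
  assumes "b > 0"
    and cont: "\<And>X x i. (\<And>j. j < n \<Longrightarrow> (\<lambda>k. X k j) \<longlonglongrightarrow> x j) \<Longrightarrow> i < n \<Longrightarrow> (\<lambda>k. F (X k) i) \<longlonglongrightarrow> F x i"
    and box: "\<And>x i. i < n \<Longrightarrow> 0 \<le> F x i \<and> F x i \<le> b"
  shows "\<exists>x. \<forall>i<n. F x i = x i"
proof -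
  define \<xi> :: "nat \<Rightarrow> (nat \<Rightarrow> nat) \<Rightarrow> nat \<Rightarrow> real" where "\<xi> k x i = b * real (x i) / real (Suc k)" for k x i
  \<comment> \<open>label \<open>0\<close>: \<open>F\<close> does not decrease the coordinate; label \<open>1\<close>: \<open>F\<close> does not increase it\<close>
  define label :: "nat \<Rightarrow> (nat \<Rightarrow> nat) \<Rightarrow> nat \<Rightarrow> nat" where
    "label k x i = (if x i = Suc k then 1 else if \<xi> k x i \<le> F (\<xi> k x) i then 0 else 1)" for k x i
  have "\<forall>k. \<exists>q r s. (\<forall>i<n. q i \<le> Suc k) \<and>
      (\<forall>i<n. (\<forall>j<n. q j \<le> r i j \<and> r i j \<le> q j + 1) \<and> (\<forall>j<n. q j \<le> s i j \<and> s i j \<le> q j + 1) \<and>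
         \<xi> k (r i) i \<le> F (\<xi> k (r i)) i \<and> F (\<xi> k (s i)) i \<le> \<xi> k (s i) i)"
  proof
    fix k
    have lab0: "\<xi> k x i \<le> F (\<xi> k x) i" if "label k x i = 0" for x i
      using that by (auto simp: label_def split: if_splits)
    have lab1: "F (\<xi> k x) i \<le> \<xi> k x i" if "label k x i = 1" "i < n" for x i
    proof (cases "x i = Suc k")
      case True
      then have "\<xi> k x i = b" by (simp add: \<xi>_def)
      then show ?thesis using box[OF \<open>i < n\<close>] by simp
    qed (use that in \<open>auto simp: label_def split: if_splits\<close>)
    obtain q where q: "\<forall>i<n. q i < Suc k"
      "\<forall>i<n. \<exists>r s. (\<forall>j<n. q j \<le> r j \<and> r j \<le> q j + 1) \<and> (\<forall>j<n. q j \<le> s j \<and> s j \<le> q j + 1) \<and> label k r i \<noteq> label k s i"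
    proof (rule kuhn_lemma[of "Suc k" n "label k"])
      show "\<forall>x. (\<forall>i<n. x i \<le> Suc k) \<longrightarrow> (\<forall>i<n. x i = 0 \<longrightarrow> label k x i = 0)"
        using box by (auto simp: label_def \<xi>_def)
    qed (auto simp: label_def)
    have "\<forall>i. \<exists>r s. i < n \<longrightarrow> (\<forall>j<n. q j \<le> r j \<and> r j \<le> q j + 1) \<and> (\<forall>j<n. q j \<le> s j \<and> s j \<le> q j + 1) \<and>
         \<xi> k r i \<le> F (\<xi> k r) i \<and> F (\<xi> k s) i \<le> \<xi> k s i"
    proof (intro allI)
      fix i
      show "\<exists>r s. i < n \<longrightarrow> (\<forall>j<n. q j \<le> r j \<and> r j \<le> q j + 1) \<and> (\<forall>j<n. q j \<le> s j \<and> s j \<le> q j + 1) \<and>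
         \<xi> k r i \<le> F (\<xi> k r) i \<and> F (\<xi> k s) i \<le> \<xi> k s i"
      proof (cases "i < n")
        case True
        then obtain r s where rs: "\<forall>j<n. q j \<le> r j \<and> r j \<le> q j + 1" "\<forall>j<n. q j \<le> s j \<and> s j \<le> q j + 1"
            "label k r i \<noteq> label k s i"
          using q(2) by blast
        have "label k x i = 0 \<or> label k x i = 1" for x
          by (simp add: label_def)
        then have "label k r i = 0 \<and> label k s i = 1 \<or> label k r i = 1 \<and> label k s i = 0"
          using rs(3) by metis
        then show ?thesis using lab0 lab1 rs True by blast
      qed auto
    qed
    then obtain r s where "\<And>i. i < n \<Longrightarrow> (\<forall>j<n. q j \<le> r i j \<and> r i j \<le> q j + 1) \<and> (\<forall>j<n. q j \<le> s i j \<and> s i j \<le> q j + 1) \<and>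
         \<xi> k (r i) i \<le> F (\<xi> k (r i)) i \<and> F (\<xi> k (s i)) i \<le> \<xi> k (s i) i"
      by metis
    then show "\<exists>q r s. (\<forall>i<n. q i \<le> Suc k) \<and>
      (\<forall>i<n. (\<forall>j<n. q j \<le> r i j \<and> r i j \<le> q j + 1) \<and> (\<forall>j<n. q j \<le> s i j \<and> s i j \<le> q j + 1) \<and>
         \<xi> k (r i) i \<le> F (\<xi> k (r i)) i \<and> F (\<xi> k (s i)) i \<le> \<xi> k (s i) i)"
      using q(1) by (intro exI[of _ q] exI[of _ r] exI[of _ s]) auto
  qed
  from choice[OF this] obtain q where "\<forall>k. \<exists>r s. (\<forall>i<n. q k i \<le> Suc k) \<and>
      (\<forall>i<n. (\<forall>j<n. q k j \<le> r i j \<and> r i j \<le> q k j + 1) \<and> (\<forall>j<n. q k j \<le> s i j \<and> s i j \<le> q k j + 1) \<and>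
         \<xi> k (r i) i \<le> F (\<xi> k (r i)) i \<and> F (\<xi> k (s i)) i \<le> \<xi> k (s i) i)" ..
  from choice[OF this] obtain r where "\<forall>k. \<exists>s. (\<forall>i<n. q k i \<le> Suc k) \<and>
      (\<forall>i<n. (\<forall>j<n. q k j \<le> r k i j \<and> r k i j \<le> q k j + 1) \<and> (\<forall>j<n. q k j \<le> s i j \<and> s i j \<le> q k j + 1) \<and>
         \<xi> k (r k i) i \<le> F (\<xi> k (r k i)) i \<and> F (\<xi> k (s i)) i \<le> \<xi> k (s i) i)" ..
  from choice[OF this] obtain s where qrs: "\<forall>k. (\<forall>i<n. q k i \<le> Suc k) \<and>
      (\<forall>i<n. (\<forall>j<n. q k j \<le> r k i j \<and> r k i j \<le> q k j + 1) \<and> (\<forall>j<n. q k j \<le> s k i j \<and> s k i j \<le> q k j + 1) \<and>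
         \<xi> k (r k i) i \<le> F (\<xi> k (r k i)) i \<and> F (\<xi> k (s k i)) i \<le> \<xi> k (s k i) i)" ..
  have q: "\<And>k i. i < n \<Longrightarrow> q k i \<le> Suc k"
    and r: "\<And>k i j. i < n \<Longrightarrow> j < n \<Longrightarrow> q k j \<le> r k i j \<and> r k i j \<le> q k j + 1"
    and s: "\<And>k i j. i < n \<Longrightarrow> j < n \<Longrightarrow> q k j \<le> s k i j \<and> s k i j \<le> q k j + 1"
    and rF: "\<And>k i. i < n \<Longrightarrow> \<xi> k (r k i) i \<le> F (\<xi> k (r k i)) i"
    and sF: "\<And>k i. i < n \<Longrightarrow> F (\<xi> k (s k i)) i \<le> \<xi> k (s k i) i"
    using qrs by blast+
  have "\<bar>\<xi> k (q k) i\<bar> \<le> b" if "i < n" for k i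
    using q[OF that, of k] \<open>b > 0\<close> by (simp add: \<xi>_def field_simps del: of_nat_Suc)
  then obtain \<phi> x where \<phi>: "strict_mono (\<phi> :: nat \<Rightarrow> nat)" and x: "\<forall>i<n. (\<lambda>k. \<xi> (\<phi> k) (q (\<phi> k)) i) \<longlonglongrightarrow> x i"
    using bounded_coordinates_convergent_subseq[of n "\<lambda>k. \<xi> k (q k)" b] by auto
  have close: "(\<lambda>k. \<xi> (\<phi> k) (y (\<phi> k)) j) \<longlonglongrightarrow> x j"
    if "j < n" and y: "\<And>k. q k j \<le> y k j \<and> y k j \<le> q k j + 1" for y j
  proof -
    have "(\<lambda>k. \<xi> (\<phi> k) (y (\<phi> k)) j - \<xi> (\<phi> k) (q (\<phi> k)) j) \<longlonglongrightarrow> 0"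
    proof (rule tendsto_0_le[where K = 1])
      have "(\<lambda>k. b / real (Suc k)) \<longlonglongrightarrow> 0"
        using LIMSEQ_Suc[OF lim_const_over_n[of b]] by simp
      from LIMSEQ_subseq_LIMSEQ[OF this \<phi>] show "(\<lambda>k. b / real (Suc (\<phi> k))) \<longlonglongrightarrow> 0" by (simp add: o_def)
      show "\<forall>\<^sub>F k in sequentially. norm (\<xi> (\<phi> k) (y (\<phi> k)) j - \<xi> (\<phi> k) (q (\<phi> k)) j) \<le> norm (b / real (Suc (\<phi> k))) * 1"
      proof (intro always_eventually allI)
        fix k
        have "\<bar>real (y (\<phi> k) j) - real (q (\<phi> k) j)\<bar> \<le> 1" using y[of "\<phi> k"] by linarith
        then have "b * \<bar>real (y (\<phi> k) j) - real (q (\<phi> k) j)\<bar> \<le> b" using \<open>b > 0\<close> by (simp add: mult_left_le)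
        moreover have "\<xi> (\<phi> k) (y (\<phi> k)) j - \<xi> (\<phi> k) (q (\<phi> k)) j = b * (real (y (\<phi> k) j) - real (q (\<phi> k) j)) / real (Suc (\<phi> k))"
          by (simp add: \<xi>_def diff_divide_distrib right_diff_distrib del: of_nat_Suc)
        ultimately show "norm (\<xi> (\<phi> k) (y (\<phi> k)) j - \<xi> (\<phi> k) (q (\<phi> k)) j) \<le> norm (b / real (Suc (\<phi> k))) * 1"
          using \<open>b > 0\<close> by (simp add: abs_mult divide_right_mono del: of_nat_Suc)
      qed
    qed
    from tendsto_add[OF this x[rule_format, OF \<open>j < n\<close>]] show ?thesis by simp
  qed
  have "F x i = x i" if i: "i < n" for i
  proof (rule antisym)
    have "(\<lambda>k. F (\<xi> (\<phi> k) (s (\<phi> k) i)) i) \<longlonglongrightarrow> F x i"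
      by (rule cont[OF _ i], rule close) (use s[OF i] in auto)
    moreover have "(\<lambda>k. \<xi> (\<phi> k) (s (\<phi> k) i) i) \<longlonglongrightarrow> x i"
      by (rule close) (use s[OF i] i in auto)
    ultimately show "F x i \<le> x i" by (rule LIMSEQ_le) (use sF[OF i] in auto)
    have "(\<lambda>k. F (\<xi> (\<phi> k) (r (\<phi> k) i)) i) \<longlonglongrightarrow> F x i"
      by (rule cont[OF _ i], rule close) (use r[OF i] in auto)
    moreover have "(\<lambda>k. \<xi> (\<phi> k) (r (\<phi> k) i) i) \<longlonglongrightarrow> x i"
      by (rule close) (use r[OF i] i in auto)
    ultimately show "x i \<le> F x i" using LIMSEQ_le rF[OF i] by blast
  qed
  then show ?thesis by blast
qed

lemma increasing_iteration_fixed_point: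
  fixes F :: "(nat \<Rightarrow> real) \<Rightarrow> nat \<Rightarrow> real"
  assumes mono: "\<And>x y i. (\<And>j. j < n \<Longrightarrow> x j \<le> y j) \<Longrightarrow> i < n \<Longrightarrow> F x i \<le> F y i"
    and cont: "\<And>X x i. (\<And>j. j < n \<Longrightarrow> (\<lambda>k. X k j) \<longlonglongrightarrow> x j) \<Longrightarrow> i < n \<Longrightarrow> (\<lambda>k. F (X k) i) \<longlonglongrightarrow> F x i"
    and bdd: "\<And>x i. i < n \<Longrightarrow> F x i \<le> b"
    and \<alpha>: "\<And>i. i < n \<Longrightarrow> \<alpha> i \<le> F \<alpha> i"
  shows "\<exists>x. \<forall>i<n. F x i = x i \<and> \<alpha> i \<le> x i"
proof -
  define X where "X k = (F ^^ k) \<alpha>" for k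
  have step: "X k i \<le> X (Suc k) i" if "i < n" for k i
    using that by (induction k arbitrary: i) (auto simp: X_def \<alpha> intro: mono)
  have inc: "incseq (\<lambda>k. X k i)" if "i < n" for i
    using step[OF that] by (rule incseq_SucI)
  have bd: "X k i \<le> max b (\<alpha> i)" if "i < n" for k i
    using bdd[OF that] by (cases k) (auto simp: X_def le_max_iff_disj)
  have "\<forall>i. \<exists>l. i < n \<longrightarrow> (\<lambda>k. X k i) \<longlonglongrightarrow> l \<and> (\<forall>k. X k i \<le> l)"
    using incseq_convergent[OF inc] bd by metis
  then obtain x where x: "\<And>i. i < n \<Longrightarrow> (\<lambda>k. X k i) \<longlonglongrightarrow> x i" and le: "\<And>i k. i < n \<Longrightarrow> X k i \<le> x i"
    by metis
  have "F x i = x i" if "i < n" for i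
  proof (rule LIMSEQ_unique)
    show "(\<lambda>k. F (X k) i) \<longlonglongrightarrow> F x i" by (rule cont[OF x that])
    show "(\<lambda>k. F (X k) i) \<longlonglongrightarrow> x i" using LIMSEQ_Suc[OF x[OF that]] by (simp add: X_def)
  qed
  moreover have "\<alpha> i \<le> x i" if "i < n" for i using le[OF that, of 0] by (simp add: X_def)
  ultimately show ?thesis by blast
qed

text \<open>
  Let \<open>U\<close> be the set of points whose orbit under the monotone map \<open>F\<close> eventually lies below the strict
  supersolution \<open>\<beta>\<close>.  It is an open lower set, so on each line \<open>y + t (1, \<dots>, 1)\<close> it is a half-line
  \<open>t < \<theta> y\<close>, and \<open>\<theta>\<close> is Lipschitz for the maximum norm.  A fixed point of \<open>y \<mapsto> F (y + \<theta> y (1, \<dots>, 1))\<close> is a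
  fixed point of \<open>F\<close> on the boundary of \<open>U\<close>, because \<open>F\<close> maps that boundary into itself.  The set
  \<open>{x. \<alpha>' \<le> x}\<close> does not meet the boundary: points slightly below it are mapped above the subsolution \<open>\<alpha>\<close>
  and can never sink below \<open>\<beta>\<close>.
\<close>
theorem threshold_fixed_point:
  fixes F :: "(nat \<Rightarrow> real) \<Rightarrow> nat \<Rightarrow> real"
  assumes mono: "\<And>x y i. (\<And>j. j < n \<Longrightarrow> x j \<le> y j) \<Longrightarrow> i < n \<Longrightarrow> F x i \<le> F y i"
    and cont: "\<And>X x i. (\<And>j. j < n \<Longrightarrow> (\<lambda>k. X k j) \<longlonglongrightarrow> x j) \<Longrightarrow> i < n \<Longrightarrow> (\<lambda>k. F (X k) i) \<longlonglongrightarrow> F x i"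
    and b: "b > 0" and box: "\<And>x i. i < n \<Longrightarrow> 0 \<le> F x i \<and> F x i \<le> b"
    and \<beta>: "\<And>i. i < n \<Longrightarrow> F \<beta> i < \<beta> i"
    and \<alpha>: "\<And>i. i < n \<Longrightarrow> \<alpha> i \<le> F \<alpha> i"
    and m: "m < n" "\<beta> m < \<alpha> m"
    and "\<epsilon> > 0" and \<alpha>': "\<And>x i. (\<And>j. j < n \<Longrightarrow> \<alpha>' j \<le> x j) \<Longrightarrow> i < n \<Longrightarrow> \<alpha> i \<le> F (\<lambda>j. x j - \<epsilon>) i"
  shows "\<exists>x. (\<forall>i<n. F x i = x i) \<and> (\<exists>i<n. \<beta> i < x i) \<and> (\<exists>i<n. x i < \<alpha>' i)"
proof -
  define U where "U = {x. \<exists>k. \<forall>i<n. (F ^^ k) x i \<le> \<beta> i}"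
  have Fpow_mono: "(F ^^ k) x i \<le> (F ^^ k) y i" if "\<And>j. j < n \<Longrightarrow> x j \<le> y j" "i < n" for k x y i
    using that(2)
  proof (induction k arbitrary: i)
    case (Suc k)
    show ?case unfolding funpow.simps o_def by (rule mono) (use Suc in auto)
  qed (use that(1) in auto)
  have Fpow_cont: "(\<lambda>k. (F ^^ l) (X k) i) \<longlonglongrightarrow> (F ^^ l) x i"
    if "\<And>j. j < n \<Longrightarrow> (\<lambda>k. X k j) \<longlonglongrightarrow> x j" "i < n" for l X x i
    using that(2)
  proof (induction l arbitrary: i)
    case (Suc l)
    show ?case unfolding funpow.simps o_def by (rule cont) (use Suc in auto)
  qed (use that(1) in auto)
  have U_lower: "x \<in> U" if y: "y \<in> U" and "\<And>j. j < n \<Longrightarrow> x j \<le> y j" for x y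
  proof -
    obtain k where k: "\<forall>i<n. (F ^^ k) y i \<le> \<beta> i" using y by (auto simp: U_def)
    have "(F ^^ k) x i \<le> \<beta> i" if "i < n" for i
      by (rule order_trans[OF Fpow_mono[of x y]]) (use k that \<open>\<And>j. j < n \<Longrightarrow> x j \<le> y j\<close> in auto)
    then show ?thesis unfolding U_def by blast
  qed
  have F_U: "F x \<in> U" if x: "x \<in> U" for x
  proof -
    obtain k where k: "\<forall>i<n. (F ^^ k) x i \<le> \<beta> i" using x by (auto simp: U_def)
    have "F ((F ^^ k) x) i \<le> \<beta> i" if "i < n" for i
      by (rule order_trans[OF mono[of _ \<beta>] less_imp_le[OF \<beta>]]) (use k that in auto)
    then have "\<forall>i<n. (F ^^ k) (F x) i \<le> \<beta> i" by (simp add: funpow_swap1)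
    then show ?thesis unfolding U_def by blast
  qed
  have U_F: "x \<in> U" if x: "F x \<in> U" for x
  proof -
    obtain k where "\<forall>i<n. (F ^^ k) (F x) i \<le> \<beta> i" using x by (auto simp: U_def)
    then have "\<forall>i<n. (F ^^ Suc k) x i \<le> \<beta> i" unfolding funpow_Suc_right o_def .
    then show ?thesis unfolding U_def by blast
  qed
  have U_open: "\<exists>\<delta>>0. (\<lambda>i. x i + \<delta>) \<in> U" if x: "x \<in> U" for x
  proof -
    obtain k where k: "\<forall>i<n. (F ^^ k) x i \<le> \<beta> i" using x by (auto simp: U_def)
    have lt: "(F ^^ Suc k) x i < \<beta> i" if "i < n" for i
      unfolding funpow.simps o_def by (rule le_less_trans[OF mono[of _ \<beta>] \<beta>]) (use k that in auto)
    have "(\<lambda>j. x i + inverse (real (Suc j))) \<longlonglongrightarrow> x i" for i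
      using tendsto_add[OF tendsto_const LIMSEQ_inverse_real_of_nat, of "x i"] by simp
    then have "\<forall>\<^sub>F j in sequentially. (F ^^ Suc k) (\<lambda>i. x i + inverse (real (Suc j))) i < \<beta> i" if "i < n" for i
      by (intro order_tendstoD(2)[OF Fpow_cont lt] that)
    then have "\<forall>\<^sub>F j in sequentially. \<forall>i\<in>{..<n}. (F ^^ Suc k) (\<lambda>i. x i + inverse (real (Suc j))) i < \<beta> i"
      by (intro eventually_ball_finite) auto
    then obtain j where "\<forall>i\<in>{..<n}. (F ^^ Suc k) (\<lambda>i. x i + inverse (real (Suc j))) i < \<beta> i"
      by (auto simp: eventually_sequentially)
    then have "(\<lambda>i. x i + inverse (real (Suc j))) \<in> U"
      unfolding U_def by (auto intro!: exI[of _ "Suc k"] less_imp_le)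
    then show ?thesis by (intro exI[of _ "inverse (real (Suc j))"]) auto
  qed
  have not_U: "x \<notin> U" if "\<And>i. i < n \<Longrightarrow> \<alpha> i \<le> x i" for x
  proof
    assume "x \<in> U"
    then obtain k where k: "\<forall>i<n. (F ^^ k) x i \<le> \<beta> i" by (auto simp: U_def)
    have "\<alpha> i \<le> (F ^^ k) x i" if "i < n" for i
      using that
    proof (induction k arbitrary: i)
      case (Suc k)
      have "F \<alpha> i \<le> F ((F ^^ k) x) i" by (rule mono) (use Suc in auto)
      then show ?case using \<alpha>[OF Suc.prems] by simp
    qed (use \<open>\<And>i. i < n \<Longrightarrow> \<alpha> i \<le> x i\<close> in auto)
    then show False using k m by fastforce
  qed
  define \<theta> where "\<theta> y = Sup {t. (\<lambda>i. y i + t) \<in> U}" for y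
  have \<theta>: "(\<lambda>i. y i + t) \<in> U \<longleftrightarrow> t < \<theta> y" for y t
  proof -
    let ?S = "{t. (\<lambda>i. y i + t) \<in> U}"
    define K where "K = (\<Sum>i<n. \<bar>y i\<bar> + \<bar>\<alpha> i\<bar> + \<bar>\<beta> i\<bar>)"
    have K: "\<bar>y i\<bar> + \<bar>\<alpha> i\<bar> + \<bar>\<beta> i\<bar> \<le> K" if "i < n" for i
      unfolding K_def using that by (intro member_le_sum[of i "{..<n}" "\<lambda>i. \<bar>y i\<bar> + \<bar>\<alpha> i\<bar> + \<bar>\<beta> i\<bar>"]) auto
    have "y i + - K \<le> \<beta> i" "\<alpha> i \<le> y i + K" if "i < n" for i using K[OF that] by linarith+
    then have "(\<lambda>i. y i + - K) \<in> U" unfolding U_def by (auto intro!: exI[of _ 0])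
    then have ne: "?S \<noteq> {}" by blast
    have "t \<le> K" if "t \<in> ?S" for t
    proof (rule ccontr)
      assume "\<not> t \<le> K"
      then have "\<alpha> i \<le> y i + t" if "i < n" for i using K[OF that] by linarith
      from not_U[OF this] show False using that by simp
    qed
    then have bdd: "bdd_above ?S" by (auto simp: bdd_above_def)
    show ?thesis
    proof
      assume "(\<lambda>i. y i + t) \<in> U"
      from U_open[OF this] obtain \<delta> where "\<delta> > 0" "(\<lambda>i. y i + t + \<delta>) \<in> U" by auto
      then have "t + \<delta> \<le> \<theta> y" unfolding \<theta>_def by (intro cSup_upper bdd) (simp add: add.assoc)
      then show "t < \<theta> y" using \<open>\<delta> > 0\<close> by linarith
    next
      assume "t < \<theta> y"
      then obtain t' where t': "t' \<in> ?S" "t < t'" unfolding \<theta>_def less_cSup_iff[OF ne bdd] ..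
      then show "(\<lambda>i. y i + t) \<in> U" by (intro U_lower[of "\<lambda>i. y i + t'" "\<lambda>i. y i + t"]) (use t' in auto)
    qed
  qed
  have \<theta>_le: "\<theta> y' \<le> \<theta> y + d" if "\<And>i. i < n \<Longrightarrow> y i \<le> y' i + d" for y y' d
  proof (rule dense_le)
    fix t assume "t < \<theta> y'"
    then have "(\<lambda>i. y' i + t) \<in> U" using \<theta> by blast
    then have "(\<lambda>i. y i + (t - d)) \<in> U" 
    proof (rule U_lower)
      fix i assume "i < n"
      from that[OF this] show "y i + (t - d) \<le> y' i + t" by linarith
    qed
    then show "t \<le> \<theta> y + d" using \<theta>[of y "t - d"] by simp
  qed
  have \<theta>_cont: "(\<lambda>k. \<theta> (X k)) \<longlonglongrightarrow> \<theta> x" if X: "\<And>j. j < n \<Longrightarrow> (\<lambda>k. X k j) \<longlonglongrightarrow> x j" for X x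
  proof -
    define d where "d k = (\<Sum>j<n. \<bar>X k j - x j\<bar>)" for k
    have "(\<lambda>k. \<Sum>j<n. \<bar>X k j - x j\<bar>) \<longlonglongrightarrow> (\<Sum>j<n. \<bar>x j - x j\<bar>)"
      by (intro tendsto_intros X) auto
    then have d0: "d \<longlonglongrightarrow> 0" by (simp add: d_def[abs_def])
    have d: "\<bar>X k j - x j\<bar> \<le> d k" if "j < n" for k j
      unfolding d_def using that by (intro member_le_sum[of j "{..<n}" "\<lambda>j. \<bar>X k j - x j\<bar>"]) auto
    have "\<bar>\<theta> (X k) - \<theta> x\<bar> \<le> d k" for k
    proof -
      have "\<theta> (X k) \<le> \<theta> x + d k" "\<theta> x \<le> \<theta> (X k) + d k"
      proof -
        have "x i \<le> X k i + d k" "X k i \<le> x i + d k" if "i < n" for i using d[OF that, of k] by linarith+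
        then show "\<theta> (X k) \<le> \<theta> x + d k" "\<theta> x \<le> \<theta> (X k) + d k" by (auto intro: \<theta>_le)
      qed
      then show ?thesis by linarith
    qed
    then have "(\<lambda>k. \<theta> (X k) - \<theta> x) \<longlonglongrightarrow> 0"
      by (intro tendsto_0_le[OF d0, where K = 1] always_eventually) (auto intro: order_trans[OF _ abs_ge_self])
    then show ?thesis by (simp add: LIM_zero_iff)
  qed
  have "\<exists>y. \<forall>i<n. F (\<lambda>i. y i + \<theta> y) i = y i"
  proof (rule brouwer_cube[OF b])
    fix X x i
    assume X: "\<And>j. j < n \<Longrightarrow> (\<lambda>k. X k j :: real) \<longlonglongrightarrow> x j" and "i < n"
    show "(\<lambda>k. F (\<lambda>i. X k i + \<theta> (X k)) i) \<longlonglongrightarrow> F (\<lambda>i. x i + \<theta> x) i"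
      by (rule cont[OF _ \<open>i < n\<close>]) (intro tendsto_add X \<theta>_cont)
  qed (use box in auto)
  then obtain y where y: "\<And>i. i < n \<Longrightarrow> F (\<lambda>i. y i + \<theta> y) i = y i" by blast
  define z where "z i = y i + \<theta> y" for i
  have Fz: "F z i = y i" if "i < n" for i using y[OF that] by (simp add: z_def[abs_def])
  have z_notin: "z \<notin> U" using \<theta>[of y "\<theta> y"] by (simp add: z_def[abs_def])
  have z_in: "(\<lambda>i. z i - e) \<in> U" if "e > 0" for e
    using \<theta>[of y "\<theta> y - e"] that by (simp add: z_def[abs_def] algebra_simps)
  have y_notin: "y \<notin> U"
  proof
    assume "y \<in> U"
    then have "F z \<in> U" by (rule U_lower) (simp add: Fz)
    then show False using U_F z_notin by blast
  qed
  have y_in: "(\<lambda>i. y i + - e) \<in> U" if "e > 0" for e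
  proof -
    have "(\<lambda>j. z i - inverse (real (Suc j))) \<longlonglongrightarrow> z i" for i
      using tendsto_diff[OF tendsto_const LIMSEQ_inverse_real_of_nat, of "z i"] by simp
    then have "\<forall>\<^sub>F j in sequentially. y i - e < F (\<lambda>i. z i - inverse (real (Suc j))) i" if "i < n" for i
      by (intro order_tendstoD(1)[OF cont] that) (use Fz[OF that] \<open>e > 0\<close> in auto)
    then have "\<forall>\<^sub>F j in sequentially. \<forall>i\<in>{..<n}. y i - e < F (\<lambda>i. z i - inverse (real (Suc j))) i"
      by (intro eventually_ball_finite) auto
    then obtain j where j: "\<forall>i\<in>{..<n}. y i - e < F (\<lambda>i. z i - inverse (real (Suc j))) i"
      by (auto simp: eventually_sequentially)
    have "F (\<lambda>i. z i - inverse (real (Suc j))) \<in> U"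
      by (intro F_U z_in) simp
    then show ?thesis by (rule U_lower) (use j in \<open>auto intro: less_imp_le\<close>)
  qed
  have "\<not> 0 < \<theta> y" using \<theta>[of y 0] y_notin by simp
  moreover have "\<not> \<theta> y < 0"
  proof
    assume "\<theta> y < 0"
    then have "(\<lambda>i. y i + - (- \<theta> y)) \<in> U" by (intro y_in) simp
    then show False using \<theta>[of y "\<theta> y"] by simp
  qed
  ultimately have "\<theta> y = 0" by simp
  then have fp: "F y i = y i" if "i < n" for i using y[OF that] by simp
  have "\<exists>i<n. \<beta> i < y i"
  proof (rule ccontr)
    assume "\<not> (\<exists>i<n. \<beta> i < y i)"
    then have "\<forall>i<n. (F ^^ 0) y i \<le> \<beta> i" by (simp add: not_less) (metis not_le)
    then have "y \<in> U" unfolding U_def by blast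
    then show False using y_notin by blast
  qed
  moreover have "\<exists>i<n. y i < \<alpha>' i"
  proof (rule ccontr)
    assume "\<not> (\<exists>i<n. y i < \<alpha>' i)"
    then have "\<And>j. j < n \<Longrightarrow> \<alpha>' j \<le> y j" by (metis not_less)
    from \<alpha>'[OF this] have "F (\<lambda>i. y i - \<epsilon>) \<notin> U" by (intro not_U) auto
    moreover have "(\<lambda>i. y i - \<epsilon>) \<in> U" using y_in[OF \<open>\<epsilon> > 0\<close>] by simp
    ultimately show False using F_U by blast
  qed
  ultimately show ?thesis using fp by blast
qed

section \<open>Lebesgue differentiation and absolute continuity of indefinite integrals\<close>

text \<open>
  By Vitali's covering lemma the bad points are covered by fivefold enlargements of disjoint intervals
  on each of which the defect of \<open>f\<close> is at least \<open>\<kappa>\<close> times the length; by Henstock's lemma the total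
  defect, hence the total length, is as small as desired.
\<close>
lemma negligible_bad_difference_quotients:
  fixes f :: "real \<Rightarrow> real"
  assumes f: "f integrable_on {a..b}" and \<kappa>: "\<kappa> > 0"
  shows "negligible {x \<in> {a..b}. \<forall>\<delta>>0. \<exists>y\<in>{a..b}. 0 < \<bar>y - x\<bar> \<and> \<bar>y - x\<bar> < \<delta> \<and>
           \<kappa> * \<bar>y - x\<bar> \<le> \<bar>integral {a..y} f - integral {a..x} f - f x * (y - x)\<bar>}" (is "negligible ?E")
  unfolding negligible_outer_le
proof (intro allI impI)
  fix \<epsilon> :: real
  assume "\<epsilon> > 0"
  define e where "e = \<kappa> * \<epsilon> / 5"
  have "e > 0" using \<open>\<epsilon> > 0\<close> \<kappa> by (simp add: e_def)
  define F where "F t = integral {a..t} f" for t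
  obtain \<gamma> where "gauge \<gamma>" and \<gamma>: "\<And>p. p tagged_partial_division_of cbox a b \<Longrightarrow> \<gamma> fine p \<Longrightarrow>
      (\<Sum>(x,k)\<in>p. norm (measure lborel k *\<^sub>R f x - integral k f)) < e"
    using Henstock_lemma[of f a b e] f \<open>e > 0\<close> by (auto simp: cbox_interval)
  define J where "J i = {min (fst i) (snd i)..max (fst i) (snd i)}" for i :: "real \<times> real"
  define m where "m i = (fst i + snd i) / 2" for i :: "real \<times> real"
  define r where "r i = \<bar>snd i - fst i\<bar> / 2" for i :: "real \<times> real"
  have J: "cball (m i) (r i) = J i" for i
  proof (cases "fst i \<le> snd i")
    case True
    then show ?thesis by (simp add: J_def m_def r_def cball_eq_atLeastAtMost field_simps)
  next
    case False
    then show ?thesis by (simp add: J_def m_def r_def cball_eq_atLeastAtMost field_simps)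
  qed
  \<comment> \<open>a pair \<open>(x, y)\<close> represents the interval between a bad point \<open>x\<close> and a witness \<open>y\<close> of its badness\<close>
  define K where "K = {i. fst i \<in> {a..b} \<and> snd i \<in> {a..b} \<and> fst i \<noteq> snd i \<and> J i \<subseteq> \<gamma> (fst i) \<and>
      \<kappa> * \<bar>snd i - fst i\<bar> \<le> \<bar>F (snd i) - F (fst i) - f (fst i) * (snd i - fst i)\<bar>}"
  have cover: "?E \<subseteq> (\<Union>i\<in>K. cball (m i) (r i))"
  proof
    fix x assume x: "x \<in> ?E"
    have "open (\<gamma> x)" "x \<in> \<gamma> x" using \<open>gauge \<gamma>\<close> by (auto simp: gauge_def)
    then obtain \<delta> where \<delta>: "\<delta> > 0" "ball x \<delta> \<subseteq> \<gamma> x" by (auto simp: open_contains_ball)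
    then obtain y where y: "y \<in> {a..b}" "0 < \<bar>y - x\<bar>" "\<bar>y - x\<bar> < \<delta>"
      "\<kappa> * \<bar>y - x\<bar> \<le> \<bar>F y - F x - f x * (y - x)\<bar>"
      using x by (auto simp: F_def)
    have "J (x, y) \<subseteq> ball x \<delta>" using y by (auto simp: J_def dist_real_def)
    then have "(x, y) \<in> K" using x y \<delta> by (auto simp: K_def)
    moreover have "x \<in> J (x, y)" by (simp add: J_def)
    ultimately show "x \<in> (\<Union>i\<in>K. cball (m i) (r i))" unfolding J by blast
  qed
  have rK: "0 < r i \<and> r i \<le> b - a" if "i \<in> K" for i
    using that by (auto simp: K_def r_def)
  obtain C where C: "countable C" "C \<subseteq> K"
     "pairwise (\<lambda>i j. disjnt (cball (m i) (r i)) (cball (m j) (r j))) C"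
     "?E \<subseteq> (\<Union>i\<in>C. cball (m i) (5 * r i))"
    by (rule Vitali_covering_lemma_cballs[OF cover rK])
  have bound: "measure lebesgue (\<Union>i\<in>D. cball (m i) (5 * r i)) \<le> \<epsilon>" if D: "D \<subseteq> C" "finite D" for D
  proof -
    have disj: "J i \<inter> J j = {}" if "i \<in> D" "j \<in> D" "i \<noteq> j" for i j
      using C(3) that D(1) unfolding J pairwise_def disjnt_def by blast
    define p where "p = (\<lambda>i. (fst i, J i)) ` D"
    have mem: "fst i \<in> J i" for i by (simp add: J_def)
    have inj: "inj_on (\<lambda>i. (fst i, J i)) D"
      using disj mem unfolding inj_on_def by (metis IntI empty_iff prod.inject)
    have p: "p tagged_partial_division_of cbox a b"
      unfolding tagged_partial_division_of_def
    proof (intro conjI allI impI)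
      show "finite p" using D by (simp add: p_def)
      fix x k assume "(x, k) \<in> p"
      then obtain i where i: "i \<in> D" "x = fst i" "k = J i" by (auto simp: p_def)
      show "x \<in> k" using i mem by simp
      have "i \<in> K" using i D C by auto
      then show "k \<subseteq> cbox a b" using i by (auto simp: K_def J_def)
      show "\<exists>a b. k = cbox a b" using i by (auto simp: J_def)
    next
      fix x k x' k' assume *: "(x, k) \<in> p \<and> (x', k') \<in> p \<and> (x, k) \<noteq> (x', k')"
      then have ne: "(x, k) \<noteq> (x', k')" by blast
      obtain i where i: "i \<in> D" "x = fst i" "k = J i" using * by (auto simp: p_def)
      obtain j where j: "j \<in> D" "x' = fst j" "k' = J j" using * by (auto simp: p_def)
      have "i \<noteq> j" using i j ne by blast
      then have "J i \<inter> J j = {}" using disj i(1) j(1) by simp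
      then show "interior k \<inter> interior k' = {}" using i j interior_subset by blast
    qed
    have fine: "\<gamma> fine p"
      using D C by (auto simp: fine_def p_def K_def)
    have "(\<Sum>i\<in>D. \<kappa> * \<bar>snd i - fst i\<bar>) \<le> (\<Sum>i\<in>D. norm (measure lborel (J i) *\<^sub>R f (fst i) - integral (J i) f))"
    proof (rule sum_mono)
      fix i assume "i \<in> D"
      then have i: "i \<in> K" using D C by auto
      have FF: "integral {u..v} f = F v - F u" if "u \<in> {a..b}" "v \<in> {a..b}" "u \<le> v" for u v
      proof -
        have "f integrable_on {a..v}" using f that by (auto intro: integrable_subinterval_real)
        from Henstock_Kurzweil_Integration.integral_combine[OF _ _ this, of u] that show ?thesis by (simp add: F_def)
      qed
      have "\<bar>F (snd i) - F (fst i) - f (fst i) * (snd i - fst i)\<bar> = norm (measure lborel (J i) *\<^sub>R f (fst i) - integral (J i) f)"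
      proof (cases "fst i \<le> snd i")
        case True
        then show ?thesis using FF[of "fst i" "snd i"] i by (simp add: J_def K_def algebra_simps)
      next
        case False
        then show ?thesis using FF[of "snd i" "fst i"] i by (simp add: J_def K_def algebra_simps)
      qed
      then show "\<kappa> * \<bar>snd i - fst i\<bar> \<le> norm (measure lborel (J i) *\<^sub>R f (fst i) - integral (J i) f)"
        using i by (auto simp: K_def)
    qed
    also have "\<dots> = (\<Sum>(x,k)\<in>p. norm (measure lborel k *\<^sub>R f x - integral k f))"
      unfolding p_def by (subst sum.reindex[OF inj]) simp
    also have "\<dots> < e" by (rule \<gamma>[OF p fine])
    finally have "\<kappa> * (\<Sum>i\<in>D. \<bar>snd i - fst i\<bar>) < e" by (simp add: sum_distrib_left)
    then have *: "(\<Sum>i\<in>D. \<bar>snd i - fst i\<bar>) < \<epsilon> / 5" using \<kappa> by (simp add: e_def mult_less_cancel_left_pos field_simps)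
    have "measure lebesgue (\<Union>i\<in>D. cball (m i) (5 * r i)) \<le> (\<Sum>i\<in>D. measure lebesgue (cball (m i) (5 * r i)))"
      by (rule measure_UNION_le) (use D in auto)
    also have "\<dots> = (\<Sum>i\<in>D. 5 * \<bar>snd i - fst i\<bar>)"
      by (rule sum.cong) (auto simp: cball_eq_atLeastAtMost r_def)
    finally show ?thesis using * by (simp add: sum_distrib_left[symmetric])
  qed
  show "\<exists>T. ?E \<subseteq> T \<and> T \<in> lmeasurable \<and> measure lebesgue T \<le> \<epsilon>"
  proof (intro exI conjI)
    show "?E \<subseteq> (\<Union>i\<in>C. cball (m i) (5 * r i))" by (rule C)
    show "(\<Union>i\<in>C. cball (m i) (5 * r i)) \<in> lmeasurable"
      by (rule fmeasurable_UN_bound[OF C(1) _ bound]) auto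
    show "measure lebesgue (\<Union>i\<in>C. cball (m i) (5 * r i)) \<le> \<epsilon>"
      by (rule measure_UN_bound[OF C(1) _ bound]) auto
  qed
qed

theorem lebesgue_differentiation:
  fixes f :: "real \<Rightarrow> real"
  assumes f: "f integrable_on {a..b}"
  shows "\<exists>N. negligible N \<and> (\<forall>x\<in>{a<..<b} - N. ((\<lambda>t. integral {a..t} f) has_real_derivative f x) (at x))"
proof -
  define E where "E \<kappa> = {x \<in> {a..b}. \<forall>\<delta>>0. \<exists>y\<in>{a..b}. 0 < \<bar>y - x\<bar> \<and> \<bar>y - x\<bar> < \<delta> \<and>
           \<kappa> * \<bar>y - x\<bar> \<le> \<bar>integral {a..y} f - integral {a..x} f - f x * (y - x)\<bar>}" for \<kappa>
  define N where "N = (\<Union>k. E (inverse (real (Suc k))))"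
  have "negligible N"
    unfolding N_def
  proof (rule negligible_countable_Union)
    fix S assume "S \<in> range (\<lambda>k. E (inverse (real (Suc k))))"
    then obtain k where "S = E (inverse (real (Suc k)))" by blast
    then show "negligible S" unfolding E_def using negligible_bad_difference_quotients[OF f, of "inverse (real (Suc k))"] by simp
  qed auto
  moreover have "((\<lambda>t. integral {a..t} f) has_real_derivative f x) (at x)" if x: "x \<in> {a<..<b} - N" for x
    unfolding has_field_derivative_def has_derivative_at_alt
  proof (intro conjI allI impI)
    show "bounded_linear ((*) (f x))" by (rule bounded_linear_mult_right)
    fix e :: real assume "e > 0"
    then obtain k where k: "inverse (real (Suc k)) < e" using reals_Archimedean by blast
    have "x \<notin> E (inverse (real (Suc k)))" using x by (auto simp: N_def)
    then obtain \<delta> where \<delta>: "\<delta> > 0" and "\<not> (\<exists>y\<in>{a..b}. 0 < \<bar>y - x\<bar> \<and> \<bar>y - x\<bar> < \<delta> \<and>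
           inverse (real (Suc k)) * \<bar>y - x\<bar> \<le> \<bar>integral {a..y} f - integral {a..x} f - f x * (y - x)\<bar>)"
      using x unfolding E_def greaterThanLessThan_iff Diff_iff mem_Collect_eq by (meson atLeastAtMost_iff less_imp_le)
    then have *: "\<bar>integral {a..y} f - integral {a..x} f - f x * (y - x)\<bar> \<le> inverse (real (Suc k)) * \<bar>y - x\<bar>"
      if "y \<in> {a..b}" "\<bar>y - x\<bar> < \<delta>" for y
      using that by (cases "y = x") (auto simp: not_le intro: less_imp_le)
    show "\<exists>d>0. \<forall>y. norm (y - x) < d \<longrightarrow>
       norm (integral {a..y} f - integral {a..x} f - f x * (y - x)) \<le> e * norm (y - x)"
    proof (intro exI conjI allI impI)
      show "min \<delta> (min (x - a) (b - x)) > 0" using \<delta> x by auto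
      fix y assume y: "norm (y - x) < min \<delta> (min (x - a) (b - x))"
      then have "\<bar>integral {a..y} f - integral {a..x} f - f x * (y - x)\<bar> \<le> inverse (real (Suc k)) * \<bar>y - x\<bar>"
        by (intro *) auto
      also have "\<dots> \<le> e * \<bar>y - x\<bar>" by (intro mult_right_mono) (use k in auto)
      finally show "norm (integral {a..y} f - integral {a..x} f - f x * (y - x)) \<le> e * norm (y - x)" by simp
    qed
  qed
  ultimately show ?thesis by blast
qed

text \<open>
  Split \<open>\<bar>f\<bar>\<close> into the bounded part \<open>min \<bar>f\<bar> k\<close> and a remainder of small integral.
\<close>
lemma indefinite_integral_abs_continuous_on:
  fixes f :: "real \<Rightarrow> real"
  assumes f: "f absolutely_integrable_on {a..b}"
  shows "abs_continuous_on {a..b} (\<lambda>t. integral {a..t} f)"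
  unfolding abs_continuous_on_def
proof (intro allI impI)
  fix \<epsilon> :: real assume "\<epsilon> > 0"
  let ?S = "{a..b}"
  define q where "q k t = min \<bar>f t\<bar> (real k)" for k t
  have absf: "(\<lambda>t. \<bar>f t\<bar>) absolutely_integrable_on ?S"
    using absolutely_integrable_norm[OF f] by (simp add: o_def)
  have q: "q k absolutely_integrable_on ?S" for k
    unfolding q_def by (intro absolutely_integrable_min_1 absf absolutely_integrable_on_const) auto
  have "(\<lambda>k. integral ?S (q k)) \<longlonglongrightarrow> integral ?S (\<lambda>t. \<bar>f t\<bar>)"
  proof (rule dominated_convergence(2)[of q ?S "\<lambda>t. \<bar>f t\<bar>"])
    show "q k integrable_on ?S" for k using q by (rule set_lebesgue_integral_eq_integral(1))
    show "(\<lambda>t. \<bar>f t\<bar>) integrable_on ?S" using absf by (rule set_lebesgue_integral_eq_integral(1))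
    show "norm (q k t) \<le> \<bar>f t\<bar>" for k t by (auto simp: q_def)
    show "(\<lambda>k. q k t) \<longlonglongrightarrow> \<bar>f t\<bar>" for t
    proof (rule tendsto_eventually)
      obtain k0 :: nat where "\<bar>f t\<bar> \<le> real k0" using real_arch_simple by blast
      then have "q k t = \<bar>f t\<bar>" if "k \<ge> k0" for k using that by (auto simp: q_def min_def)
      then show "\<forall>\<^sub>F k in sequentially. q k t = \<bar>f t\<bar>" by (auto simp: eventually_sequentially)
    qed
  qed
  then have "\<forall>\<^sub>F k in sequentially. integral ?S (\<lambda>t. \<bar>f t\<bar>) - \<epsilon>/2 < integral ?S (q k)"
    by (rule order_tendstoD) (use \<open>\<epsilon> > 0\<close> in simp)
  then obtain k where k: "integral ?S (\<lambda>t. \<bar>f t\<bar>) - \<epsilon>/2 < integral ?S (q k)"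
    by (auto simp: eventually_sequentially)
  define p where "p t = \<bar>f t\<bar> - q k t" for t
  have p: "p absolutely_integrable_on ?S"
    unfolding p_def using absf q by (rule set_integral_diff)
  have int_p: "integral ?S p < \<epsilon>/2"
    unfolding p_def using k absf q by (subst integral_diff) (auto intro: set_lebesgue_integral_eq_integral(1))
  have p0: "p t \<ge> 0" for t by (simp add: p_def q_def)
  show "\<exists>\<delta>>0. \<forall>(n::nat) x y. (\<forall>i<n. x i \<in> ?S \<and> y i \<in> ?S \<and> x i \<le> y i) \<longrightarrow>
      disjoint_family_on (\<lambda>i. {x i<..<y i}) {..<n} \<longrightarrow> (\<Sum>i<n. y i - x i) < \<delta> \<longrightarrow>
      (\<Sum>i<n. \<bar>integral {a..y i} f - integral {a..x i} f\<bar>) < \<epsilon>"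
  proof (intro exI conjI allI impI)
    show "\<epsilon> / (2 * (real k + 1)) > 0" using \<open>\<epsilon> > 0\<close> by simp
    fix n :: nat and x y
    assume xy: "\<forall>i<n. x i \<in> ?S \<and> y i \<in> ?S \<and> x i \<le> y i"
      and disj: "disjoint_family_on (\<lambda>i. {x i<..<y i}) {..<n}"
      and len: "(\<Sum>i<n. y i - x i) < \<epsilon> / (2 * (real k + 1))"
    have sub: "h absolutely_integrable_on {x i..y i}" if "i < n" "h absolutely_integrable_on ?S" for i and h :: "real \<Rightarrow> real"
      using that(2) by (rule set_integrable_subset) (use xy that(1) in auto)
    have subI: "h integrable_on {x i..y i}" if "i < n" "h absolutely_integrable_on ?S" for i and h :: "real \<Rightarrow> real"
      using sub[OF that] by (rule set_lebesgue_integral_eq_integral(1))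
    have each: "\<bar>integral {a..y i} f - integral {a..x i} f\<bar> \<le> integral {x i<..<y i} p + real k * (y i - x i)" if i: "i < n" for i
    proof -
      have "f integrable_on {a..y i}"
        by (rule integrable_subinterval_real[OF set_lebesgue_integral_eq_integral(1)[OF f]]) (use xy i in auto)
      from Henstock_Kurzweil_Integration.integral_combine[OF _ _ this, of "x i"] xy i
      have "\<bar>integral {a..y i} f - integral {a..x i} f\<bar> = \<bar>integral {x i..y i} f\<bar>" by simp
      also have "\<dots> \<le> integral {x i..y i} (\<lambda>t. p t + real k)"
        unfolding real_norm_def[symmetric]
      proof (rule integral_norm_bound_integral)
        show "f integrable_on {x i..y i}" by (rule subI[OF i f])
        show "(\<lambda>t. p t + real k) integrable_on {x i..y i}"
          by (intro integrable_add subI[OF i p]) auto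
        show "norm (f t) \<le> p t + real k" for t by (auto simp: p_def q_def)
      qed
      also have "\<dots> = integral {x i..y i} p + real k * (y i - x i)"
        using xy i by (subst integral_add[OF subI[OF i p]]) auto
      finally show ?thesis by (simp add: integral_open_interval_real)
    qed
    have "(\<Sum>i<n. integral {x i<..<y i} p) \<le> integral ?S p"
    proof -
      have "(p has_integral (\<Sum>i<n. integral {x i<..<y i} p)) (\<Union>i<n. {x i<..<y i})"
      proof (rule has_integral_UN)
        show "(p has_integral integral {x i<..<y i} p) {x i<..<y i}" if "i \<in> {..<n}" for i
          using subI[OF _ p, of i] that by (simp add: integrable_on_open_interval_real integrable_integral)
        show "pairwise (\<lambda>i j. negligible ({x i<..<y i} \<inter> {x j<..<y j})) {..<n}"
          using disj by (auto simp: pairwise_def disjoint_family_on_def)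
      qed auto
      moreover have "(p has_integral integral ?S p) ?S"
        using set_lebesgue_integral_eq_integral(1)[OF p] by (rule integrable_integral)
      ultimately show ?thesis
        by (rule has_integral_subset_le[rotated]) (use xy p0 in force)+
    qed
    moreover have "real k * (\<Sum>i<n. y i - x i) \<le> \<epsilon>/2"
    proof -
      have "real k * (\<Sum>i<n. y i - x i) \<le> (real k + 1) * (\<epsilon> / (2 * (real k + 1)))"
        using len xy by (intro mult_mono sum_nonneg) auto
      also have "\<dots> = \<epsilon> / 2" by (simp add: field_simps)
      finally show ?thesis .
    qed
    moreover have "(\<Sum>i<n. \<bar>integral {a..y i} f - integral {a..x i} f\<bar>) \<le>
        (\<Sum>i<n. integral {x i<..<y i} p) + real k * (\<Sum>i<n. y i - x i)"
      unfolding sum_distrib_left sum.distrib[symmetric] using each by (intro sum_mono) auto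
    ultimately show "(\<Sum>i<n. \<bar>integral {a..y i} f - integral {a..x i} f\<bar>) < \<epsilon>"
      using int_p by linarith
  qed
qed

section \<open>The integrated equation\<close>

lemma locally_integrable_abs:
  assumes "locally_integrable a"
  shows "(\<lambda>t. \<bar>a t\<bar>) integrable_on {x..y}"
proof -
  have "a absolutely_integrable_on {x..y}" using assms by (simp add: locally_integrable_def)
  from set_lebesgue_integral_eq_integral(1)[OF absolutely_integrable_norm[OF this]] show ?thesis
    by (simp add: o_def)
qed

lemma periodic_of_int:
  fixes f :: "real \<Rightarrow> 'a"
  assumes "\<And>t. f (t + T) = f t"
  shows "f (t + of_int k * T) = f t"
proof (induction k rule: int_induct[where k = 0])
  case (step1 i)
  then show ?case using assms[of "t + of_int i * T"] by (simp add: algebra_simps)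
next
  case (step2 i)
  then show ?case using assms[of "t + of_int (i - 1) * T"] by (simp add: algebra_simps)
qed simp

lemma absolutely_integrable_times_continuous:
  fixes f h :: "real \<Rightarrow> real"
  assumes "f absolutely_integrable_on {x..y}" and h: "continuous_on {x..y} h"
  shows "(\<lambda>t. f t * h t) absolutely_integrable_on {x..y}"
proof -
  have "(\<lambda>t. h t * f t) absolutely_integrable_on {x..y}"
  proof (rule absolutely_integrable_bounded_measurable_product_real)
    show "h \<in> borel_measurable (lebesgue_on {x..y})"
      by (rule continuous_imp_measurable_on_sets_lebesgue[OF h]) simp
    show "bounded (h ` {x..y})"
      by (rule compact_imp_bounded[OF compact_continuous_image[OF h compact_Icc]])
  qed (use assms in auto)
  then show ?thesis by (simp add: mult.commute)
qed

text \<open>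
  Nonnegative \<open>T\<close>-periodic solutions of the equation integrated once in time: \<open>v\<close> is the derivative of \<open>u\<close>,
  and the equation for \<open>v\<close> is required in integrated form on every interval.
\<close>
definition weak_periodic_solution ::
    "real \<Rightarrow> real \<Rightarrow> real \<Rightarrow> (real \<Rightarrow> real) \<Rightarrow> (real \<Rightarrow> real) \<Rightarrow> (real \<Rightarrow> real) \<Rightarrow> (real \<Rightarrow> real) \<Rightarrow> bool" where
  "weak_periodic_solution T c \<mu> a g u v \<longleftrightarrow>
     (\<forall>t. u (t + T) = u t \<and> 0 \<le> u t) \<and>
     (\<forall>t. (u has_real_derivative v t) (at t)) \<and>
     (\<forall>x y. x \<le> y \<longrightarrow> v y - v x = - c * (u y - u x) - \<mu> * integral {x..y} (\<lambda>t. a t * g (u t)))"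

lemma weak_periodic_solution_source:
  assumes "locally_integrable a" "continuous_on {0..} g" "weak_periodic_solution T c \<mu> a g u v"
  shows "(\<lambda>t. a t * g (u t)) absolutely_integrable_on {x..y}"
proof (rule absolutely_integrable_times_continuous)
  have "continuous_on S u" for S
    using assms(3) by (auto simp: weak_periodic_solution_def intro!: DERIV_isCont continuous_at_imp_continuous_on)
  moreover have "u ` {x..y} \<subseteq> {0..}" using assms(3) by (auto simp: weak_periodic_solution_def)
  ultimately show "continuous_on {x..y} (\<lambda>t. g (u t))"
    using continuous_on_compose2[OF assms(2)] by blast
qed (use assms(1) in \<open>auto simp: locally_integrable_def\<close>)

lemma weak_periodic_solution_deriv_continuous:
  assumes "locally_integrable a" "continuous_on {0..} g" "weak_periodic_solution T c \<mu> a g u v"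
  shows "continuous_on {x..y} v"
proof -
  let ?f = "\<lambda>t. a t * g (u t)"
  have "v t = v x + (- c * (u t - u x) - \<mu> * integral {x..t} ?f)" if "t \<in> {x..y}" for t
    using assms(3) that unfolding weak_periodic_solution_def atLeastAtMost_iff by (smt (verit))
  moreover have "continuous_on {x..y} u"
    using assms(3) by (auto simp: weak_periodic_solution_def intro!: DERIV_isCont continuous_at_imp_continuous_on)
  then have "continuous_on {x..y} (\<lambda>t. v x + (- c * (u t - u x) - \<mu> * integral {x..t} ?f))"
    using indefinite_integral_continuous_1[OF set_lebesgue_integral_eq_integral(1)[OF weak_periodic_solution_source[OF assms]]]
    by (intro continuous_intros) auto
  ultimately show ?thesis using continuous_on_cong by (metis (no_types, lifting))
qed

lemma abs_continuous_on_dominated: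
  assumes p: "abs_continuous_on S p" and "K \<ge> 0" "M \<ge> 0"
    and f: "\<And>s t. s \<in> S \<Longrightarrow> t \<in> S \<Longrightarrow> s \<le> t \<Longrightarrow> \<bar>f t - f s\<bar> \<le> K * (t - s) + M * \<bar>p t - p s\<bar>"
  shows "abs_continuous_on S f"
  unfolding abs_continuous_on_def
proof (intro allI impI)
  fix \<epsilon> :: real assume \<epsilon>: "\<epsilon> > 0"
  have "\<epsilon> / (2 * (M + 1)) > 0" using \<epsilon> \<open>M \<ge> 0\<close> by simp
  with p obtain \<delta> where "\<delta> > 0" and \<delta>: "\<And>(n::nat) x y. (\<forall>i<n. x i \<in> S \<and> y i \<in> S \<and> x i \<le> y i) \<Longrightarrow>
        disjoint_family_on (\<lambda>i. {x i<..<y i}) {..<n} \<Longrightarrow> (\<Sum>i<n. y i - x i) < \<delta> \<Longrightarrow>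
        (\<Sum>i<n. \<bar>p (y i) - p (x i)\<bar>) < \<epsilon> / (2 * (M + 1))"
    unfolding abs_continuous_on_def by blast
  show "\<exists>\<delta>>0. \<forall>(n::nat) x y. (\<forall>i<n. x i \<in> S \<and> y i \<in> S \<and> x i \<le> y i) \<longrightarrow>
        disjoint_family_on (\<lambda>i. {x i<..<y i}) {..<n} \<longrightarrow> (\<Sum>i<n. y i - x i) < \<delta> \<longrightarrow>
        (\<Sum>i<n. \<bar>f (y i) - f (x i)\<bar>) < \<epsilon>"
  proof (intro exI conjI allI impI)
    show "min \<delta> (\<epsilon> / (2 * (K + 1))) > 0" using \<epsilon> \<open>\<delta> > 0\<close> \<open>K \<ge> 0\<close> by simp
    fix n :: nat and x y
    assume xy: "\<forall>i<n. x i \<in> S \<and> y i \<in> S \<and> x i \<le> y i" "disjoint_family_on (\<lambda>i. {x i<..<y i}) {..<n}"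
      and len: "(\<Sum>i<n. y i - x i) < min \<delta> (\<epsilon> / (2 * (K + 1)))"
    have "(\<Sum>i<n. \<bar>f (y i) - f (x i)\<bar>) \<le> K * (\<Sum>i<n. y i - x i) + M * (\<Sum>i<n. \<bar>p (y i) - p (x i)\<bar>)"
      unfolding sum_distrib_left sum.distrib[symmetric] using xy f by (intro sum_mono) auto
    moreover have "K * (\<Sum>i<n. y i - x i) \<le> (K + 1) * (\<Sum>i<n. y i - x i)"
      using xy by (intro mult_right_mono sum_nonneg) auto
    moreover have "(K + 1) * (\<Sum>i<n. y i - x i) < (K + 1) * (\<epsilon> / (2 * (K + 1)))"
      using len \<open>K \<ge> 0\<close> by (intro mult_strict_left_mono) auto
    moreover have "(K + 1) * (\<epsilon> / (2 * (K + 1))) = \<epsilon> / 2" using \<open>K \<ge> 0\<close> by (simp add: field_simps)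
    moreover have "M * (\<Sum>i<n. \<bar>p (y i) - p (x i)\<bar>) \<le> (M + 1) * (\<epsilon> / (2 * (M + 1)))"
      using \<delta>[OF xy] len \<open>M \<ge> 0\<close> by (intro mult_mono sum_nonneg) auto
    moreover have "(M + 1) * (\<epsilon> / (2 * (M + 1))) = \<epsilon> / 2" using \<open>M \<ge> 0\<close> by (simp add: field_simps)
    ultimately show "(\<Sum>i<n. \<bar>f (y i) - f (x i)\<bar>) < \<epsilon>" by linarith
  qed
qed

lemma weak_periodic_solution_imp_caratheodory:
  assumes a: "locally_integrable a" and g: "continuous_on {0..} g" and sol: "weak_periodic_solution T c \<mu> a g u v"
  shows "caratheodory_solution c \<mu> a g u"
proof -
  let ?f = "\<lambda>t. a t * g (u t)"
  have du: "(u has_real_derivative v t) (at t)" for t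
    using sol by (simp add: weak_periodic_solution_def)
  have v: "v y - v x = - c * (u y - u x) - \<mu> * integral {x..y} ?f" if "x \<le> y" for x y
    using sol that by (simp add: weak_periodic_solution_def)
  have f: "?f absolutely_integrable_on {x..y}" for x y
    by (rule weak_periodic_solution_source[OF assms])
  have fi: "?f integrable_on {x..y}" for x y
    using f by (rule set_lebesgue_integral_eq_integral(1))
  have cont_v: "continuous_on {x..y} v" for x y
    by (rule weak_periodic_solution_deriv_continuous[OF assms])
  have deriv_u: "deriv u = v" using du by (auto simp: fun_eq_iff DERIV_imp_deriv)
  have "continuous_on UNIV v"
    unfolding continuous_on_eq_continuous_at[OF open_UNIV]
  proof
    fix t :: real
    have "continuous_on {t-1<..<t+1} v" by (rule continuous_on_subset[OF cont_v[of "t-1" "t+1"]]) auto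
    then show "isCont v t" by (rule continuous_on_interior) auto
  qed
  moreover have "abs_continuous_on {x..y} v" for x y
  proof -
    have "bounded (v ` {x..y})"
      by (rule compact_imp_bounded[OF compact_continuous_image[OF cont_v compact_Icc]])
    then obtain B where B: "\<And>t. t \<in> {x..y} \<Longrightarrow> \<bar>v t\<bar> \<le> B"
      unfolding bounded_iff real_norm_def by (meson imageI)
    have "\<bar>v t - v s\<bar> \<le> (\<bar>c\<bar> * \<bar>B\<bar>) * (t - s) + \<bar>\<mu>\<bar> * \<bar>integral {x..t} ?f - integral {x..s} ?f\<bar>"
      if st: "s \<in> {x..y}" "t \<in> {x..y}" "s \<le> t" for s t
    proof -
      have "\<bar>u t - u s\<bar> \<le> \<bar>B\<bar> * (t - s)"
      proof (cases "s = t")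
        case False
        then obtain z where z: "s < z" "z < t" "u t - u s = (t - s) * v z"
          using MVT2[of s t u v] du st by auto
        then have "\<bar>u t - u s\<bar> = (t - s) * \<bar>v z\<bar>" by (simp add: abs_mult)
        also have "\<dots> \<le> (t - s) * \<bar>B\<bar>" using B[of z] z st by (intro mult_left_mono) auto
        finally show ?thesis by (simp add: mult.commute)
      qed simp
      then have "\<bar>c\<bar> * \<bar>u t - u s\<bar> \<le> \<bar>c\<bar> * (\<bar>B\<bar> * (t - s))" by (intro mult_left_mono) auto
      moreover have "integral {x..t} ?f - integral {x..s} ?f = integral {s..t} ?f"
        using Henstock_Kurzweil_Integration.integral_combine[OF _ _ fi[of x t], of s] st by simp
      then have "v t - v s = - c * (u t - u s) - \<mu> * (integral {x..t} ?f - integral {x..s} ?f)"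
        using v[OF st(3)] by simp
      then have "\<bar>v t - v s\<bar> \<le> \<bar>c\<bar> * \<bar>u t - u s\<bar> + \<bar>\<mu>\<bar> * \<bar>integral {x..t} ?f - integral {x..s} ?f\<bar>"
        by (simp add: abs_mult[symmetric])
      ultimately show ?thesis by (simp add: mult.assoc)
    qed
    then show ?thesis
      by (intro abs_continuous_on_dominated[OF indefinite_integral_abs_continuous_on[OF f[of x y]],
            where K = "\<bar>c\<bar> * \<bar>B\<bar>" and M = "\<bar>\<mu>\<bar>"]) auto
  qed
  moreover have "AE t in lebesgue. v field_differentiable at t \<and> deriv v t + c * v t + \<mu> * a t * g (u t) = 0"
  proof -
    have "\<forall>k::nat. \<exists>N. negligible N \<and> (\<forall>t\<in>{- real k<..<real k} - N. ((\<lambda>s. integral {- real k..s} ?f) has_real_derivative ?f t) (at t))"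
      using lebesgue_differentiation[OF fi] by blast
    then obtain N where N: "\<And>k. negligible (N k)"
      and dN: "\<And>k t. t \<in> {- real k<..<real k} - N k \<Longrightarrow> ((\<lambda>s. integral {- real k..s} ?f) has_real_derivative ?f t) (at t)"
      by metis
    have "negligible (\<Union>k. N k)" by (rule negligible_countable_Union) (auto simp: N)
    then have "(\<Union>k. N k) \<in> null_sets lebesgue" by (simp add: negligible_iff_null_sets)
    then show ?thesis
    proof (rule AE_I', intro subsetI)
      fix t assume t: "t \<in> {t \<in> space lebesgue. \<not> (v field_differentiable at t \<and> deriv v t + c * v t + \<mu> * a t * g (u t) = 0)}"
      show "t \<in> (\<Union>k. N k)"
      proof (rule ccontr)
        assume nt: "t \<notin> (\<Union>k. N k)"
        obtain k where k: "\<bar>t\<bar> < real k" using reals_Archimedean2 by blast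
        let ?x = "- real k"
        have tk: "t \<in> {?x<..<real k}" using k by auto
        have "((\<lambda>s. v ?x + (- c * (u s - u ?x) - \<mu> * integral {?x..s} ?f)) has_real_derivative - c * v t - \<mu> * ?f t) (at t)"
          using dN[of t k] tk nt du[of t] by (auto intro!: derivative_eq_intros)
        moreover have "\<forall>\<^sub>F s in nhds t. v s = v ?x + (- c * (u s - u ?x) - \<mu> * integral {?x..s} ?f)"
          using eventually_nhds_in_open[of "{?x<..<real k}" t] tk
          by (auto elim!: eventually_mono) (use v[of ?x] in \<open>force simp: algebra_simps\<close>)
        ultimately have "(v has_real_derivative - c * v t - \<mu> * ?f t) (at t)"
          by (subst DERIV_cong_ev[OF refl _ refl]) auto
        then show False using t by (auto simp: DERIV_imp_deriv field_differentiable_def)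
      qed
    qed
  qed
  ultimately show ?thesis
    using du unfolding caratheodory_solution_def deriv_u locally_abs_continuous_def
    by (auto simp: field_differentiable_def)
qed

text \<open>
  A zero of \<open>u \<ge> 0\<close> is a minimum, so \<open>u' = 0\<close> there as well.  Since \<open>g(u) \<le> C u\<close>, a contraction estimate for
  \<open>\<bar>u\<bar> + \<bar>u'\<bar>\<close> on an interval to the right of the zero shows that \<open>u\<close> vanishes on that interval, whose length is bounded
  below over one period.  Hence \<open>u\<close> vanishes identically.
\<close>
lemma weak_periodic_solution_positive:
  assumes "T > 0" and a: "locally_integrable a" and g: "continuous_on {0..} g"
    and sol: "weak_periodic_solution T c \<mu> a g u v"
    and "C \<ge> 0" and lin: "\<And>t. \<bar>g (u t)\<bar> \<le> C * u t"
    and nz: "u \<tau> \<noteq> 0"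
  shows "u t > 0"
proof (rule ccontr)
  assume "\<not> 0 < u t"
  let ?f = "\<lambda>t. a t * g (u t)"
  have u0: "0 \<le> u s" and per: "u (s + T) = u s" and du: "(u has_real_derivative v s) (at s)" for s
    using sol by (simp_all add: weak_periodic_solution_def)
  have v: "v y - v x = - c * (u y - u x) - \<mu> * integral {x..y} ?f" if "x \<le> y" for x y
    using sol that by (simp add: weak_periodic_solution_def)
  have f: "?f absolutely_integrable_on {x..y}" for x y
    by (rule weak_periodic_solution_source[OF a g sol])
  note ai = locally_integrable_abs[OF a]
  have cont_v: "continuous_on {x..y} v" for x y
    by (rule weak_periodic_solution_deriv_continuous[OF a g sol])
  have cont_u: "continuous_on S u" for S
    using du by (auto intro!: DERIV_isCont continuous_at_imp_continuous_on)
  have v0: "v s = 0" if "u s = 0" for s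
    using DERIV_local_min[OF du[of s], of 1] u0 that by simp
  have ut: "u t = 0" using \<open>\<not> 0 < u t\<close> u0[of t] by simp
  define A where "A s = integral {t..s} (\<lambda>s. \<bar>a s\<bar>)" for s
  \<comment> \<open>\<open>e\<close> bounds the mass of \<open>\<bar>a\<bar>\<close> on the intervals of length \<open>\<delta>\<close> below; together they make the constant of the estimate at most \<open>1/2\<close>\<close>
  define e where "e = 1 / (4 * (\<bar>\<mu>\<bar> * C + 1))"
  have "\<bar>\<mu>\<bar> * C + 1 > 0" using \<open>C \<ge> 0\<close> by (simp add: add_nonneg_pos)
  then have "e > 0" by (simp add: e_def)
  have muCe: "\<bar>\<mu>\<bar> * C * e \<le> 1/4"
    using \<open>\<bar>\<mu>\<bar> * C + 1 > 0\<close> by (simp add: e_def field_simps)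
  have "uniformly_continuous_on {t..t + T} A"
    unfolding A_def by (intro compact_uniformly_continuous indefinite_integral_continuous_1 ai compact_Icc)
  then obtain \<delta>0 where "\<delta>0 > 0" and \<delta>0: "\<And>x y. x \<in> {t..t+T} \<Longrightarrow> y \<in> {t..t+T} \<Longrightarrow> \<bar>y - x\<bar> < \<delta>0 \<Longrightarrow> \<bar>A y - A x\<bar> < e"
    using \<open>e > 0\<close> unfolding uniformly_continuous_on_def dist_real_def by metis
  define \<delta> where "\<delta> = min (\<delta>0 / 2) (1 / (4 * (1 + \<bar>c\<bar>)))"
  have "\<delta> > 0" using \<open>\<delta>0 > 0\<close> by (simp add: \<delta>_def)
  have c\<delta>: "(1 + \<bar>c\<bar>) * \<delta> \<le> 1/4"
  proof -
    have "(1 + \<bar>c\<bar>) * \<delta> \<le> (1 + \<bar>c\<bar>) * (1 / (4 * (1 + \<bar>c\<bar>)))" by (intro mult_left_mono) (auto simp: \<delta>_def)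
    also have "\<dots> = 1/4" by (simp add: field_simps)
    finally show ?thesis .
  qed
  have local: "u z = 0" if x: "u x = 0" and xz: "t \<le> x" "x \<le> z" "z \<le> t + T" "z - x \<le> \<delta>" for x z
  proof -
    have "continuous_on {x..z} (\<lambda>s. \<bar>u s\<bar> + \<bar>v s\<bar>)" by (intro continuous_intros cont_u cont_v)
    then obtain y where y: "y \<in> {x..z}" and max: "\<And>s. s \<in> {x..z} \<Longrightarrow> \<bar>u s\<bar> + \<bar>v s\<bar> \<le> \<bar>u y\<bar> + \<bar>v y\<bar>"
      using continuous_attains_sup[of "{x..z}" "\<lambda>s. \<bar>u s\<bar> + \<bar>v s\<bar>"] xz by auto
    define m where "m = \<bar>u y\<bar> + \<bar>v y\<bar>"
    have m: "\<bar>u s\<bar> \<le> m" "\<bar>v s\<bar> \<le> m" if "s \<in> {x..z}" for s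
      using max[OF that] unfolding m_def by linarith+
    have "m \<ge> 0" by (simp add: m_def)
    have uy: "\<bar>u y\<bar> \<le> \<delta> * m"
    proof (cases "x = y")
      case False
      then obtain w where w: "x < w" "w < y" "u y - u x = (y - x) * v w"
        using MVT2[of x y u v] du y by auto
      then have "\<bar>u y\<bar> = (y - x) * \<bar>v w\<bar>" using x by (simp add: abs_mult)
      also have "\<dots> \<le> \<delta> * m" using w y xz m(2)[of w] \<open>m \<ge> 0\<close> by (intro mult_mono) auto
      finally show ?thesis .
    qed (use x \<open>\<delta> > 0\<close> \<open>m \<ge> 0\<close> in auto)
    have "\<bar>integral {x..y} ?f\<bar> \<le> integral {x..y} (\<lambda>s. C * m * \<bar>a s\<bar>)"
      unfolding real_norm_def[symmetric]
    proof (rule integral_norm_bound_integral)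
      show "?f integrable_on {x..y}" by (rule set_lebesgue_integral_eq_integral(1)[OF f])
      show "(\<lambda>s. C * m * norm (a s)) integrable_on {x..y}" 
        using integrable_cmul[OF ai[of x y], of "C * m"] by simp
      fix s assume "s \<in> {x..y}"
      then have "\<bar>g (u s)\<bar> \<le> C * m"
        using lin[of s] m(1)[of s] y \<open>C \<ge> 0\<close> u0[of s] by (intro order_trans[OF lin] mult_left_mono) auto
      then have "\<bar>a s\<bar> * \<bar>g (u s)\<bar> \<le> \<bar>a s\<bar> * (C * m)" by (intro mult_left_mono) auto
      then show "norm (a s * g (u s)) \<le> C * m * norm (a s)" by (simp add: abs_mult mult_ac)
    qed
    also have "\<dots> = C * m * (A y - A x)"
      using Henstock_Kurzweil_Integration.integral_combine[OF _ _ ai[of t y], of x] xz y by (simp add: A_def)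
    also have "\<dots> \<le> C * m * e"
    proof (intro mult_left_mono)
      have "\<bar>A y - A x\<bar> < e" by (rule \<delta>0) (use xz y \<open>\<delta>0 > 0\<close> in \<open>auto simp: \<delta>_def\<close>)
      then show "A y - A x \<le> e" by linarith
    qed (use \<open>C \<ge> 0\<close> \<open>m \<ge> 0\<close> in auto)
    finally have "\<bar>\<mu>\<bar> * \<bar>integral {x..y} ?f\<bar> \<le> \<bar>\<mu>\<bar> * (C * m * e)" by (intro mult_left_mono) auto
    also have "\<dots> = (\<bar>\<mu>\<bar> * C * e) * m" by simp
    also have "\<dots> \<le> 1/4 * m" using muCe \<open>m \<ge> 0\<close> by (rule mult_right_mono)
    finally have "\<bar>\<mu> * integral {x..y} ?f\<bar> \<le> 1/4 * m" by (simp add: abs_mult)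
    moreover have "v y = - c * u y - \<mu> * integral {x..y} ?f" using v[of x y] y x v0[OF x] by simp
    moreover have "\<bar>c * u y\<bar> \<le> \<bar>c\<bar> * (\<delta> * m)" unfolding abs_mult by (intro mult_left_mono uy) auto
    ultimately have "m \<le> \<delta> * m + (\<bar>c\<bar> * (\<delta> * m) + 1/4 * m)" using uy unfolding m_def by linarith
    also have "\<dots> = ((1 + \<bar>c\<bar>) * \<delta>) * m + 1/4 * m" by (simp add: algebra_simps)
    also have "\<dots> \<le> 1/4 * m + 1/4 * m" by (intro add_right_mono mult_right_mono c\<delta> \<open>m \<ge> 0\<close>)
    finally have "m = 0" using \<open>m \<ge> 0\<close> by linarith
    then show ?thesis using m(1)[of z] xz by simp
  qed
  have step: "u z = 0" if "t \<le> z" "z \<le> t + T" "z \<le> t + real k * \<delta>" for k :: nat and z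
    using that
  proof (induction k arbitrary: z)
    case 0
    then show ?case using ut by simp
  next
    case (Suc k)
    define x where "x = max t (z - \<delta>)"
    have "u x = 0" by (rule Suc.IH) (use Suc.prems \<open>\<delta> > 0\<close> in \<open>auto simp: x_def algebra_simps\<close>)
    then show ?case by (rule local) (use Suc.prems \<open>\<delta> > 0\<close> in \<open>auto simp: x_def\<close>)
  qed
  have zero: "u z = 0" if "t \<le> z" "z \<le> t + T" for z
  proof -
    obtain k :: nat where "(z - t) / \<delta> < real k" using reals_Archimedean2 by blast
    then show ?thesis using that \<open>\<delta> > 0\<close> by (intro step[of z k]) (auto simp: field_simps)
  qed
  note shift = periodic_of_int[of u T, OF per]
  define k where "k = \<lfloor>(\<tau> - t) / T\<rfloor>"
  have "of_int k \<le> (\<tau> - t) / T" "(\<tau> - t) / T \<le> of_int k + 1" unfolding k_def by linarith+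
  then have "t \<le> \<tau> - of_int k * T" "\<tau> - of_int k * T \<le> t + T"
    using \<open>T > 0\<close> by (auto simp: field_simps)
  then have "u (\<tau> - of_int k * T) = 0" by (rule zero)
  then show False using shift[of "\<tau> - of_int k * T" k] nz by simp
qed

section \<open>The finite difference equation\<close>

lemma periodic_mod:
  fixes x :: "nat \<Rightarrow> 'a"
  assumes "\<And>j. x (j + n) = x j"
  shows "x (j mod n) = x j"
proof -
  have "x (i + k * n) = x i" for i k
  proof (induction k)
    case (Suc k)
    then show ?case using assms[of "i + k * n"] by (simp add: algebra_simps)
  qed simp
  from this[of "j mod n" "j div n"] show ?thesis by simp
qed

text \<open>
  The integral of \<open>a\<close> over the cell \<open>[(j - 1) h, j h]\<close> to the left of the \<open>j\<close>-th node.
\<close>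
definition cell_integral :: "(real \<Rightarrow> real) \<Rightarrow> real \<Rightarrow> nat \<Rightarrow> real" where
  "cell_integral a h j = integral {(real j - 1) * h..real j * h} a"

text \<open>
  The finite difference analogue of \<open>h (x'' + c x')\<close> at the node \<open>j + 1\<close>.  The first order term uses the
  backward difference, so that the coefficients \<open>1 / h\<close> and \<open>1 / h - c\<close> of both neighbours are
  nonnegative for small \<open>h\<close>.
\<close>
definition grid_operator :: "real \<Rightarrow> real \<Rightarrow> (nat \<Rightarrow> real) \<Rightarrow> nat \<Rightarrow> real" where
  "grid_operator h c x j = (x (Suc (Suc j)) - 2 * x (Suc j) + x j) / h + c * (x (Suc j) - x j)"

text \<open>
  Grid functions are \<open>n\<close>-periodic sequences, the node \<open>j\<close> standing for the time \<open>j T / n\<close>.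
\<close>
definition grid_solution ::
    "real \<Rightarrow> real \<Rightarrow> real \<Rightarrow> (real \<Rightarrow> real) \<Rightarrow> (real \<Rightarrow> real) \<Rightarrow> nat \<Rightarrow> (nat \<Rightarrow> real) \<Rightarrow> bool" where
  "grid_solution T c \<mu> a g n x \<longleftrightarrow>
     (\<forall>j. x (j + n) = x j) \<and>
     (\<forall>j. grid_operator (T / real n) c x j + \<mu> * cell_integral a (T / real n) (Suc j) * g (x (Suc j)) = 0)"

text \<open>
  The discrete counterpart of \<open>x' + c x\<close>, whose increments involve only the nonlinear term.
\<close>
definition grid_flux :: "real \<Rightarrow> real \<Rightarrow> (nat \<Rightarrow> real) \<Rightarrow> nat \<Rightarrow> real" where
  "grid_flux h c x j = (x (Suc j) - x j) / h + c * x j"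

lemma sum_cells:
  assumes f: "\<And>x y. f integrable_on {x..y::real}" and h: "h > 0"
  shows "(\<Sum>i<j. cell_integral f h (Suc i)) = integral {0..real j * h} f"
proof (induction j)
  case (Suc j)
  have "integral {0..real j * h} f + integral {real j * h..real (Suc j) * h} f = integral {0..real (Suc j) * h} f"
    using h by (intro Henstock_Kurzweil_Integration.integral_combine f) (auto simp: mult_right_mono)
  then show ?case using Suc by (simp add: cell_integral_def)
qed simp

lemma abs_cell_integral_le:
  assumes "locally_integrable a"
  shows "\<bar>cell_integral a h j\<bar> \<le> cell_integral (\<lambda>t. \<bar>a t\<bar>) h j"
  unfolding cell_integral_def real_norm_def[symmetric]
proof (rule integral_norm_bound_integral)
  have a: "a absolutely_integrable_on {x..y}" for x y
    using assms by (simp add: locally_integrable_def)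
  show "a integrable_on {(real j - 1) * h..real j * h}"
    using a by (rule set_lebesgue_integral_eq_integral(1))
  show "(\<lambda>t. norm (a t)) integrable_on {(real j - 1) * h..real j * h}"
    using set_lebesgue_integral_eq_integral(1)[OF absolutely_integrable_norm[OF a]] by (simp add: o_def)
qed auto

lemma sum_abs_cell_integral_le:
  assumes "locally_integrable a" "h > 0"
  shows "(\<Sum>i<j. \<bar>cell_integral a h (Suc i)\<bar>) \<le> integral {0..real j * h} (\<lambda>t. \<bar>a t\<bar>)"
  unfolding sum_cells[OF locally_integrable_abs[OF assms(1)] assms(2), symmetric]
  by (intro sum_mono abs_cell_integral_le[OF assms(1)])

lemma grid_solution_flux:
  assumes "grid_solution T c \<mu> a g n x"
  shows "grid_flux (T / real n) c x j =
     grid_flux (T / real n) c x 0 - \<mu> * (\<Sum>i<j. cell_integral a (T / real n) (Suc i) * g (x (Suc i)))"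
proof (induction j)
  case (Suc j)
  have "(x (Suc (Suc j)) - 2 * x (Suc j) + x j) / (T / real n) + c * (x (Suc j) - x j)
            + \<mu> * cell_integral a (T / real n) (Suc j) * g (x (Suc j)) = 0"
    using assms by (simp add: grid_solution_def grid_operator_def)
  moreover have "(x (Suc (Suc j)) - 2 * x (Suc j) + x j) / (T / real n) =
      (x (Suc (Suc j)) - x (Suc j)) / (T / real n) - (x (Suc j) - x j) / (T / real n)"
    unfolding diff_divide_distrib[symmetric] by simp
  ultimately have "grid_flux (T / real n) c x (Suc j) =
      grid_flux (T / real n) c x j - \<mu> * (cell_integral a (T / real n) (Suc j) * g (x (Suc j)))"
    by (simp add: grid_flux_def algebra_simps)
  then show ?case using Suc by (simp add: algebra_simps)
qed simp

text \<open>
  The flux has bounded variation over a period and mean \<open>c\<close> times that of \<open>x\<close>, because the slopes sum to zero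
  over a period.  The bounds do not depend on \<open>n\<close>.
\<close>
lemma grid_solution_slope_bound:
  assumes "T > 0" "n > 0" and a: "locally_integrable a" and sol: "grid_solution T c \<mu> a g n x"
    and x: "\<And>j. 0 \<le> x j \<and> x j \<le> R" and G: "\<And>s. 0 \<le> s \<Longrightarrow> s \<le> R \<Longrightarrow> \<bar>g s\<bar> \<le> G"
  shows "\<bar>grid_flux (T / real n) c x j\<bar> \<le> \<bar>c\<bar> * R + \<bar>\<mu>\<bar> * G * integral {0..T} (\<lambda>t. \<bar>a t\<bar>)" (is "_ \<le> _ + ?V")
    and "\<bar>(x (Suc j) - x j) / (T / real n)\<bar> \<le> 2 * \<bar>c\<bar> * R + \<bar>\<mu>\<bar> * G * integral {0..T} (\<lambda>t. \<bar>a t\<bar>)"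
proof -
  define h where "h = T / real n"
  have "h > 0" "real n * h = T" using \<open>T > 0\<close> \<open>n > 0\<close> by (auto simp: h_def)
  define J where "J = grid_flux h c x"
  have "R \<ge> 0" using x[of 0] by linarith
  have "G \<ge> 0" using G[of 0] \<open>R \<ge> 0\<close> by linarith
  define b where "b i = \<mu> * (cell_integral a h (Suc i) * g (x (Suc i)))" for i
  have J: "J j = J 0 - (\<Sum>i<j. b i)" for j
    using grid_solution_flux[OF sol, of j] by (simp add: J_def h_def b_def sum_distrib_left)
  have xper: "x (j + n) = x j" for j using sol by (simp add: grid_solution_def)
  have Jper: "J (j + n) = J j" for j
    using xper[of j] xper[of "Suc j"] by (simp add: J_def grid_flux_def)
  have bsum: "(\<Sum>i<n. \<bar>b i\<bar>) \<le> ?V"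
  proof -
    have "(\<Sum>i<n. \<bar>b i\<bar>) \<le> (\<Sum>i<n. \<bar>\<mu>\<bar> * G * \<bar>cell_integral a h (Suc i)\<bar>)"
    proof (rule sum_mono)
      fix i
      have "\<bar>cell_integral a h (Suc i)\<bar> * \<bar>g (x (Suc i))\<bar> \<le> \<bar>cell_integral a h (Suc i)\<bar> * G"
        using x by (intro mult_left_mono G) auto
      then have "\<bar>\<mu>\<bar> * (\<bar>cell_integral a h (Suc i)\<bar> * \<bar>g (x (Suc i))\<bar>) \<le> \<bar>\<mu>\<bar> * (\<bar>cell_integral a h (Suc i)\<bar> * G)"
        by (rule mult_left_mono) auto
      then show "\<bar>b i\<bar> \<le> \<bar>\<mu>\<bar> * G * \<bar>cell_integral a h (Suc i)\<bar>"
        unfolding b_def abs_mult by (simp only: mult_ac)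
    qed
    also have "\<dots> = \<bar>\<mu>\<bar> * G * (\<Sum>i<n. \<bar>cell_integral a h (Suc i)\<bar>)" by (simp add: sum_distrib_left)
    also have "\<dots> \<le> ?V"
      using sum_abs_cell_integral_le[OF a \<open>h > 0\<close>, of n] \<open>real n * h = T\<close> \<open>G \<ge> 0\<close>
      by (intro mult_left_mono) auto
    finally show ?thesis .
  qed
  have dJ: "\<bar>J i - J j\<bar> \<le> ?V" if ij: "i \<le> j" "j \<le> n" for i j
  proof -
    have "(\<Sum>k<i. b k) + (\<Sum>k=i..<j. b k) = (\<Sum>k<j. b k)"
      unfolding lessThan_atLeast0 by (rule sum.atLeastLessThan_concat) (use ij in auto)
    then have "J i - J j = (\<Sum>k=i..<j. b k)" using J[of i] J[of j] by linarith
    then have "\<bar>J i - J j\<bar> \<le> (\<Sum>k=i..<j. \<bar>b k\<bar>)" by simp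
    also have "\<dots> \<le> (\<Sum>k<n. \<bar>b k\<bar>)" by (rule sum_mono2) (use ij in auto)
    finally show ?thesis using bsum by linarith
  qed
  have "(\<Sum>i<n. h * J i) = c * h * (\<Sum>i<n. x i)"
  proof -
    have "h * J i = (x (Suc i) - x i) + c * h * x i" for i
      using \<open>h > 0\<close> by (simp add: J_def grid_flux_def distrib_left)
    then have "(\<Sum>i<n. h * J i) = (\<Sum>i<n. x (Suc i) - x i) + c * h * (\<Sum>i<n. x i)"
      by (simp only: sum.distrib sum_distrib_left)
    also have "(\<Sum>i<n. x (Suc i) - x i) = x n - x 0" by (rule sum_lessThan_telescope)
    finally show ?thesis using xper[of 0] by simp
  qed
  then have sumJ: "(\<Sum>i<n. J i) = c * (\<Sum>i<n. x i)"
    using \<open>h > 0\<close> by (simp add: sum_distrib_left[symmetric])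
  have small: "\<bar>J j\<bar> \<le> \<bar>c\<bar> * R + ?V" if "j < n" for j
  proof -
    have "real n * J j = (\<Sum>i<n. J i) + (\<Sum>i<n. J j - J i)" by (simp add: sum_subtractf)
    then have "\<bar>real n * J j\<bar> = \<bar>c * (\<Sum>i<n. x i) + (\<Sum>i<n. J j - J i)\<bar>"
      unfolding sumJ by (rule arg_cong)
    then have "real n * \<bar>J j\<bar> = \<bar>c * (\<Sum>i<n. x i) + (\<Sum>i<n. J j - J i)\<bar>"
      by (simp add: abs_mult)
    also have "\<dots> \<le> \<bar>c\<bar> * \<bar>\<Sum>i<n. x i\<bar> + \<bar>\<Sum>i<n. J j - J i\<bar>"
      using abs_triangle_ineq[of "c * (\<Sum>i<n. x i)" "\<Sum>i<n. J j - J i"] by (simp add: abs_mult)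
    also have "\<dots> \<le> \<bar>c\<bar> * (\<Sum>i<n. R) + (\<Sum>i<n. ?V)"
    proof (intro add_mono mult_left_mono)
      show "\<bar>\<Sum>i<n. x i\<bar> \<le> (\<Sum>i<n. R)" by (rule order_trans[OF sum_abs sum_mono]) (use x in auto)
      show "\<bar>\<Sum>i<n. J j - J i\<bar> \<le> (\<Sum>i<n. ?V)"
      proof (rule order_trans[OF sum_abs sum_mono])
        fix i assume "i \<in> {..<n}"
        then show "\<bar>J j - J i\<bar> \<le> ?V"
          using dJ[of i j] dJ[of j i] that by (cases "i \<le> j") (auto simp: abs_minus_commute)
      qed
    qed auto
    also have "\<dots> = real n * (\<bar>c\<bar> * R + ?V)" by (simp add: distrib_left)
    finally have "real n * \<bar>J j\<bar> \<le> real n * (\<bar>c\<bar> * R + ?V)" .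
    then show ?thesis using \<open>n > 0\<close> by simp
  qed
  have J': "\<bar>J j\<bar> \<le> \<bar>c\<bar> * R + ?V" for j
    using small[of "j mod n"] periodic_mod[of J n j, OF Jper] \<open>n > 0\<close> by simp
  then show "\<bar>grid_flux (T / real n) c x j\<bar> \<le> \<bar>c\<bar> * R + ?V" by (simp add: J_def h_def)
  have "\<bar>c * x j\<bar> \<le> \<bar>c\<bar> * R" unfolding abs_mult using x[of j] by (intro mult_left_mono) auto
  then show "\<bar>(x (Suc j) - x j) / (T / real n)\<bar> \<le> 2 * \<bar>c\<bar> * R + ?V"
    using J'[of j] unfolding J_def grid_flux_def h_def by linarith
qed

section \<open>Convergence of grid solutions\<close>

lemma integral_translate:
  fixes f :: "real \<Rightarrow> real"
  assumes "f integrable_on {x + s..y + s}"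
  shows "integral {x..y} (\<lambda>t. f (t + s)) = integral {x + s..y + s} f"
proof -
  have "(f has_integral integral {x + s..y + s} f) (cbox (x + s) (y + s))"
    using integrable_integral[OF assms] by simp
  from has_integral_affinity'[OF this, of 1 s] show ?thesis
    by (simp add: integral_unique)
qed

text \<open>
  A solution on a window of three periods extends periodically to the line.  With this window every time
  has a translate in its interior, so no one-sided derivatives have to be glued.
\<close>
lemma weak_periodic_solution_from_window:
  assumes T: "T > 0" and a: "locally_integrable a" and aper: "\<And>t. a (t + T) = a t"
    and g: "continuous_on {0..} g"
    and per: "\<And>t. 0 \<le> t \<Longrightarrow> t \<le> 2 * T \<Longrightarrow> u (t + T) = u t"
    and nonneg: "\<And>t. 0 \<le> t \<Longrightarrow> t \<le> 3 * T \<Longrightarrow> 0 \<le> u t"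
    and du: "\<And>t. 0 < t \<Longrightarrow> t < 3 * T \<Longrightarrow> (u has_real_derivative v t) (at t)"
    and eq: "\<And>x y. 0 \<le> x \<Longrightarrow> x \<le> y \<Longrightarrow> y \<le> 3 * T \<Longrightarrow>
       v y - v x = - c * (u y - u x) - \<mu> * integral {x..y} (\<lambda>t. a t * g (u t))"
  shows "\<exists>u' v'. weak_periodic_solution T c \<mu> a g u' v' \<and> (\<forall>t. 0 < t \<and> t < 3 * T \<longrightarrow> u' t = u t)"
proof -
  \<comment> \<open>\<open>t - \<kappa> t\<close> is the translate of \<open>t\<close> by a multiple of \<open>T\<close> that lies in \<open>[T, 2 T)\<close>\<close>
  define \<kappa> where "\<kappa> t = (of_int \<lfloor>t / T\<rfloor> - 1) * T" for t
  define u' where "u' t = u (t - \<kappa> t)" for t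
  define v' where "v' t = v (t - \<kappa> t)" for t
  have range: "T \<le> t - \<kappa> t \<and> t - \<kappa> t < 2 * T" for t
  proof -
    have "of_int \<lfloor>t / T\<rfloor> * T \<le> t" "t < (of_int \<lfloor>t / T\<rfloor> + 1) * T"
      using T floor_divide_lower[of T t] floor_divide_upper[of T t] by auto
    then show ?thesis by (simp add: \<kappa>_def algebra_simps)
  qed
  have \<kappa>_shift: "\<kappa> (t + T) = \<kappa> t + T" for t
    using T by (simp add: \<kappa>_def add_divide_distrib algebra_simps)
  have vper: "v (t + T) = v t" if t: "0 < t" "t < 2 * T" for t
  proof -
    have "((\<lambda>s. u (s + T)) has_real_derivative v (t + T)) (at t)"
      using du[of "t + T"] t T by (simp add: DERIV_at_within_shift[symmetric] DERIV_shift)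
    moreover have "\<forall>\<^sub>F s in nhds t. u (s + T) = u s"
      using eventually_nhds_in_open[of "{0<..<2 * T}" t] t by (auto elim!: eventually_mono intro!: per)
    ultimately have "(u has_real_derivative v (t + T)) (at t)"
      by (subst (asm) DERIV_cong_ev[OF refl _ refl]) auto
    then show ?thesis using du[of t] t T by (auto intro: DERIV_unique)
  qed
  have window: "u' s = u (s - of_int k * T) \<and> v' s = v (s - of_int k * T)"
    if s: "0 < s - of_int k * T" "s - of_int k * T < 3 * T" for s k
  proof -
    define m where "m = \<lfloor>s / T\<rfloor> - 1 - k"
    have \<kappa>: "\<kappa> s = of_int k * T + of_int m * T" by (simp add: m_def \<kappa>_def algebra_simps)
    have "(-2) * T < of_int m * T" "of_int m * T < 2 * T" using range[of s] s unfolding \<kappa> by linarith+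
    then have "(-2::real) < of_int m" "of_int m < (2::real)" by (simp_all only: mult_less_cancel_right_pos[OF T])
    then consider "m = -1" | "m = 0" | "m = 1" by linarith
    then show ?thesis
    proof cases
      case 1
      define w where "w = s - of_int k * T"
      have w: "0 < w" "w < T" "s - \<kappa> s = w + T" using range[of s] s 1 unfolding \<kappa> w_def by auto
      show ?thesis using per[of w] vper[of w] w T unfolding u'_def v'_def w_def[symmetric] by simp
    next
      case 2
      then show ?thesis by (simp add: u'_def v'_def \<kappa>)
    next
      case 3
      define w where "w = s - \<kappa> s"
      have w: "T \<le> w" "w < 2 * T" "s - of_int k * T = w + T" using range[of s] 3 unfolding w_def \<kappa> by auto
      show ?thesis using per[of w] vper[of w] w T unfolding u'_def v'_def w_def[symmetric] by simp
    qed
  qed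
  have du': "(u' has_real_derivative v' t) (at t)" for t
  proof -
    define k where "k = \<lfloor>t / T\<rfloor> - 1"
    have t: "T \<le> t - of_int k * T" "t - of_int k * T < 2 * T" using range[of t] by (simp_all add: \<kappa>_def k_def)
    have "((\<lambda>s. u (s + (- of_int k * T))) has_real_derivative v (t - of_int k * T)) (at t)"
      using du[of "t - of_int k * T"] t T unfolding DERIV_shift[symmetric] by simp
    moreover have "\<forall>\<^sub>F s in nhds t. u' s = u (s + (- of_int k * T))"
      using eventually_nhds_in_open[of "{of_int k * T<..<of_int k * T + 3 * T}" t] t T
      by (auto elim!: eventually_mono simp: window[where k = k])
    ultimately have "(u' has_real_derivative v (t - of_int k * T)) (at t)"
      by (subst DERIV_cong_ev[OF refl _ refl]) auto
    then show ?thesis using window[of t k] t T by simp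
  qed
  have u'_nonneg: "0 \<le> u' t" for t
    unfolding u'_def using range[of t] T by (intro nonneg) auto
  have cont_u': "continuous_on S u'" for S
    using du' by (auto intro!: DERIV_isCont continuous_at_imp_continuous_on)
  have f: "(\<lambda>t. a t * g (u' t)) integrable_on {x..y}" for x y
  proof (rule set_lebesgue_integral_eq_integral(1)[OF absolutely_integrable_times_continuous])
    show "continuous_on {x..y} (\<lambda>t. g (u' t))"
      by (rule continuous_on_compose2[OF g cont_u']) (use u'_nonneg in auto)
  qed (use a in \<open>auto simp: locally_integrable_def\<close>)
  define H where "H x y \<longleftrightarrow> v' y - v' x = - c * (u' y - u' x) - \<mu> * integral {x..y} (\<lambda>t. a t * g (u' t))" for x y
  have H_short: "H x y" if xy: "x \<le> y" "y - x \<le> T / 2" for x y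
  proof -
    define k where "k = \<lfloor>x / T\<rfloor> - 1"
    define s where "s = - of_int k * T"
    have x: "T \<le> x + s" "x + s < 2 * T" using range[of x] by (simp_all add: \<kappa>_def k_def s_def algebra_simps)
    have win: "u' t = u (t + s) \<and> v' t = v (t + s)" if "t \<in> {x..y}" for t
      using window[of t k] that x xy T by (simp add: s_def)
    have "integral {x..y} (\<lambda>t. a t * g (u' t)) = integral {x..y} (\<lambda>t. a (t + s) * g (u (t + s)))"
    proof (rule integral_cong)
      fix t assume "t \<in> {x..y}"
      moreover have "a (t + s) = a t" using periodic_of_int[of a T, OF aper, of t "- k"] by (simp add: s_def)
      ultimately show "a t * g (u' t) = a (t + s) * g (u (t + s))" using win by simp
    qed
    also have "\<dots> = integral {x + s..y + s} (\<lambda>t. a t * g (u t))"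
    proof (rule integral_translate)
      have "(\<lambda>t. a t * g (u t)) integrable_on {x + s..y + s} \<longleftrightarrow> (\<lambda>t. a t * g (u' t)) integrable_on {x + s..y + s}"
        by (rule integrable_cong) (use window[where k = 0] x xy T in auto)
      then show "(\<lambda>t. a t * g (u t)) integrable_on {x + s..y + s}" using f by simp
    qed
    finally show ?thesis
      using eq[of "x + s" "y + s"] win x xy T unfolding H_def by simp
  qed
  have H_trans: "H x z" if "x \<le> y" "y \<le> z" "H x y" "H y z" for x y z
  proof -
    note I = Henstock_Kurzweil_Integration.integral_combine[OF that(1,2) f, symmetric]
    show ?thesis using that(3,4) unfolding H_def I by (simp add: algebra_simps)
  qed
  have H_long: "H x y" if "x \<le> y" "y - x \<le> real m * (T / 2)" for m :: nat and x y
    using that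
  proof (induction m arbitrary: y)
    case 0
    then show ?case using H_short[of x y] T by simp
  next
    case (Suc m)
    define z where "z = max x (y - T / 2)"
    have "H x z" by (rule Suc.IH) (use Suc.prems T in \<open>auto simp: z_def max_def algebra_simps\<close>)
    moreover have "H z y" by (rule H_short) (use Suc.prems T in \<open>auto simp: z_def max_def algebra_simps\<close>)
    ultimately show ?case by (rule H_trans[rotated 2]) (use Suc.prems T in \<open>auto simp: z_def max_def algebra_simps\<close>)
  qed
  have H: "H x y" if "x \<le> y" for x y
  proof -
    obtain m :: nat where "(y - x) / (T / 2) < real m" using reals_Archimedean2 by blast
    then have "y - x < real m * (T / 2)" using T by (simp add: pos_divide_less_eq)
    then show ?thesis using that by (intro H_long[of x y m]) auto
  qed
  have "weak_periodic_solution T c \<mu> a g u' v'"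
    unfolding weak_periodic_solution_def using du' u'_nonneg H[unfolded H_def]
    by (auto simp: u'_def[of "t + T" for t] \<kappa>_shift u'_def[symmetric])
  moreover have "u' t = u t" if "0 < t \<and> t < 3 * T" for t
    using window[of t 0] that by simp
  ultimately show ?thesis by blast
qed

text \<open>
  McShane's extension, the lower envelope of cones with vertices at the grid values.
\<close>
lemma lipschitz_interpolation:
  fixes x :: "nat \<Rightarrow> real"
  assumes h: "h > 0" and "B \<ge> 0" and slope: "\<And>j. \<bar>x (Suc j) - x j\<bar> \<le> B * h"
  shows "\<exists>U. (\<forall>s t. \<bar>U s - U t\<bar> \<le> B * \<bar>s - t\<bar>) \<and> (\<forall>j\<le>m. U (real j * h) = x j)"
proof -
  have le: "\<bar>x (i + d) - x i\<bar> \<le> B * (real d * h)" for i d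
  proof (induction d)
    case (Suc d)
    have "\<bar>x (i + Suc d) - x i\<bar> \<le> \<bar>x (Suc (i + d)) - x (i + d)\<bar> + \<bar>x (i + d) - x i\<bar>" by simp
    also have "\<dots> \<le> B * h + B * (real d * h)" by (intro add_mono slope Suc)
    finally show ?case by (simp add: algebra_simps)
  qed simp
  have dist: "\<bar>x i - x j\<bar> \<le> B * \<bar>real i * h - real j * h\<bar>" for i j
  proof -
    have *: "\<bar>x i - x j\<bar> \<le> B * \<bar>real i * h - real j * h\<bar>" if "j \<le> i" for i j
      using le[of j "i - j"] that h by (simp add: of_nat_diff left_diff_distrib abs_mult mult_right_mono)
    show ?thesis using *[of i j] *[of j i] by (cases "j \<le> i") (auto simp: abs_minus_commute)
  qed
  define w where "w t j = x j + B * \<bar>t - real j * h\<bar>" for t j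
  define U where "U t = Min (w t ` {..m})" for t
  have U_le: "U t \<le> w t j" if "j \<le> m" for t j unfolding U_def using that by (intro Min_le) auto
  have U_ex: "\<exists>j\<le>m. U t = w t j" for t
  proof -
    have "U t \<in> w t ` {..m}" unfolding U_def by (intro Min_in) auto
    then show ?thesis by auto
  qed
  have one: "U s \<le> U t + B * \<bar>s - t\<bar>" for s t
  proof -
    obtain j where j: "j \<le> m" "U t = w t j" using U_ex by blast
    have "\<bar>s - real j * h\<bar> \<le> \<bar>t - real j * h\<bar> + \<bar>s - t\<bar>" by linarith
    then have "B * \<bar>s - real j * h\<bar> \<le> B * (\<bar>t - real j * h\<bar> + \<bar>s - t\<bar>)" using \<open>B \<ge> 0\<close> by (rule mult_left_mono)
    then show ?thesis using U_le[OF j(1), of s] j(2) by (simp add: w_def distrib_left)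
  qed
  have "\<bar>U s - U t\<bar> \<le> B * \<bar>s - t\<bar>" for s t
    using one[of s t] one[of t s] by (simp add: abs_minus_commute)
  moreover have "U (real j * h) = x j" if j: "j \<le> m" for j
  proof (rule antisym)
    show "U (real j * h) \<le> x j" using U_le[OF j, of "real j * h"] by (simp add: w_def)
    obtain i where i: "i \<le> m" "U (real j * h) = w (real j * h) i" using U_ex by blast
    show "x j \<le> U (real j * h)" using dist[of j i] unfolding i(2) w_def by linarith
  qed
  ultimately show ?thesis by blast
qed

lemma zero_if_small_at_nodes:
  fixes f :: "real \<Rightarrow> real"
  assumes f: "continuous_on {0..W} f" and h: "\<And>k. h k > 0" "h \<longlonglongrightarrow> 0"
    and small: "\<And>\<epsilon>. \<epsilon> > 0 \<Longrightarrow> \<forall>\<^sub>F k in sequentially. \<forall>j. real j * h k \<le> W \<longrightarrow> \<bar>f (real j * h k)\<bar> \<le> \<epsilon>"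
    and t: "t \<in> {0..W}"
  shows "f t = 0"
proof (rule ccontr)
  assume "f t \<noteq> 0"
  then obtain \<delta> where "\<delta> > 0" and \<delta>: "\<And>s. s \<in> {0..W} \<Longrightarrow> \<bar>s - t\<bar> < \<delta> \<Longrightarrow> \<bar>f s - f t\<bar> < \<bar>f t\<bar> / 2"
    using f t unfolding continuous_on_iff dist_real_def by (metis half_gt_zero zero_less_abs_iff)
  have "\<forall>\<^sub>F k in sequentially. h k < \<delta>" using order_tendstoD(2)[OF h(2) \<open>\<delta> > 0\<close>] .
  moreover have "\<forall>\<^sub>F k in sequentially. \<forall>j. real j * h k \<le> W \<longrightarrow> \<bar>f (real j * h k)\<bar> \<le> \<bar>f t\<bar> / 2"
    by (rule small) (use \<open>f t \<noteq> 0\<close> in simp)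
  ultimately have "\<forall>\<^sub>F k in sequentially. h k < \<delta> \<and> (\<forall>j. real j * h k \<le> W \<longrightarrow> \<bar>f (real j * h k)\<bar> \<le> \<bar>f t\<bar> / 2)"
    by (rule eventually_conj)
  then obtain k where k: "h k < \<delta>" "\<And>j. real j * h k \<le> W \<Longrightarrow> \<bar>f (real j * h k)\<bar> \<le> \<bar>f t\<bar> / 2"
    by (auto simp: eventually_sequentially)
  define j where "j = nat \<lfloor>t / h k\<rfloor>"
  have j: "real j = of_int \<lfloor>t / h k\<rfloor>" using t h(1)[of k] by (simp add: j_def)
  have "real j * h k \<le> t" "t < (real j + 1) * h k"
    unfolding j using floor_divide_lower[OF h(1)] floor_divide_upper[OF h(1)] by auto
  then have jt: "real j * h k \<le> t" "t < real j * h k + h k" by (auto simp: distrib_right)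
  have "\<bar>f (real j * h k) - f t\<bar> < \<bar>f t\<bar> / 2"
    by (rule \<delta>) (use jt t k(1) h(1)[of k] in auto)
  moreover have "\<bar>f (real j * h k)\<bar> \<le> \<bar>f t\<bar> / 2" by (rule k(2)) (use jt t in auto)
  ultimately show False by linarith
qed

text \<open>
  The slopes of the grid solutions are uniformly close to \<open>v\<close> at the nodes.  Summing them shows that the
  uniform limit \<open>u\<close> is a primitive of \<open>v\<close>.
\<close>
lemma grid_limit_equation:
  assumes T: "T > 0" and a: "locally_integrable a" and g: "continuous_on {0..} g"
    and N: "\<And>k. N k > 0" "filterlim N at_top sequentially"
    and sol: "\<And>k. grid_solution T c \<mu> a (gt k) (N k) (x k)"
    and x: "\<And>k j. 0 \<le> x k j \<and> x k j \<le> R"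
    and gt: "\<And>k s. 0 \<le> s \<Longrightarrow> s \<le> R \<Longrightarrow> \<bar>gt k s - g s\<bar> \<le> \<eta> k" "\<eta> \<longlonglongrightarrow> 0"
    and u: "continuous_on UNIV u" "\<And>t. 0 \<le> u t \<and> u t \<le> R"
    and conv: "\<And>\<epsilon>. \<epsilon> > 0 \<Longrightarrow> \<forall>\<^sub>F k in sequentially. \<forall>j. real j * (T / real (N k)) \<le> 3 * T \<longrightarrow>
        \<bar>x k j - u (real j * (T / real (N k)))\<bar> < \<epsilon>"
    and J: "(\<lambda>k. grid_flux (T / real (N k)) c (x k) 0) \<longlonglongrightarrow> J"
  defines "v \<equiv> \<lambda>t. J - c * u t - \<mu> * integral {0..t} (\<lambda>t. a t * g (u t))"
  shows "\<And>t. 0 < t \<Longrightarrow> t < 3 * T \<Longrightarrow> (u has_real_derivative v t) (at t)"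
    and "\<And>t. 0 \<le> t \<Longrightarrow> t \<le> 2 * T \<Longrightarrow> u (t + T) = u t"
proof -
  let ?W = "3 * T"
  let ?f = "\<lambda>t. a t * g (u t)"
  define h where "h k = T / real (N k)" for k
  have h: "h k > 0" for k using T N(1)[of k] by (simp add: h_def)
  have Nh: "real (N k) * h k = T" for k using N(1)[of k] by (simp add: h_def)
  have h0: "h \<longlonglongrightarrow> 0"
    unfolding h_def
    by (rule tendsto_divide_0[OF tendsto_const filterlim_at_top_imp_at_infinity])
       (rule filterlim_compose[OF filterlim_real_sequentially N(2)])
  have cont_u: "continuous_on S u" for S using u(1) continuous_on_subset by blast
  have conv: "\<forall>\<^sub>F k in sequentially. \<forall>j. real j * h k \<le> ?W \<longrightarrow> \<bar>x k j - u (real j * h k)\<bar> < \<epsilon>" if "\<epsilon> > 0" for \<epsilon>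
    using conv[OF that] by (simp add: h_def)
  have fa: "?f absolutely_integrable_on {s..t}" for s t
  proof (rule absolutely_integrable_times_continuous)
    show "continuous_on {s..t} (\<lambda>t. g (u t))"
      by (rule continuous_on_compose2[OF g cont_u]) (use u(2) in auto)
  qed (use a in \<open>auto simp: locally_integrable_def\<close>)
  have f: "?f integrable_on {s..t}" for s t
    using fa by (rule set_lebesgue_integral_eq_integral(1))
  have ai: "a integrable_on {s..t}" for s t
    using a set_lebesgue_integral_eq_integral(1) unfolding locally_integrable_def by blast
  note aabs = locally_integrable_abs[OF a]
  define A where "A = integral {0..?W} (\<lambda>t. \<bar>a t\<bar>)"
  have "A \<ge> 0" unfolding A_def by (rule integral_nonneg[OF aabs]) auto
  have cont_v: "continuous_on {0..?W} v"
    unfolding v_def by (intro continuous_intros cont_u indefinite_integral_continuous_1 f)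
  have slope: "\<forall>\<^sub>F k in sequentially. \<forall>j. real j * h k \<le> ?W \<longrightarrow> \<bar>(x k (Suc j) - x k j) / h k - v (real j * h k)\<bar> \<le> \<epsilon>"
    if "\<epsilon> > 0" for \<epsilon>
  proof -
    define D where "D = \<bar>c\<bar> + \<bar>\<mu>\<bar> * A + 1"
    have "D > 0" using \<open>A \<ge> 0\<close> unfolding D_def by (intro add_nonneg_pos add_nonneg_nonneg mult_nonneg_nonneg) auto
    define e where "e = \<epsilon> / (2 * D)"
    have "e > 0" using \<open>\<epsilon> > 0\<close> \<open>D > 0\<close> by (simp add: e_def)
    have "uniformly_continuous_on {0..R} g"
      by (rule compact_uniformly_continuous[OF continuous_on_subset[OF g]]) auto
    then obtain \<delta>1 where "\<delta>1 > 0" and \<delta>1: "\<And>s t. s \<in> {0..R} \<Longrightarrow> t \<in> {0..R} \<Longrightarrow> \<bar>t - s\<bar> < \<delta>1 \<Longrightarrow> \<bar>g t - g s\<bar> < e / 2"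
      using half_gt_zero[OF \<open>e > 0\<close>] unfolding uniformly_continuous_on_def dist_real_def by metis
    have "uniformly_continuous_on {0..?W} u" by (rule compact_uniformly_continuous[OF cont_u]) auto
    then obtain \<delta>2 where "\<delta>2 > 0" and \<delta>2: "\<And>s t. s \<in> {0..?W} \<Longrightarrow> t \<in> {0..?W} \<Longrightarrow> \<bar>t - s\<bar> < \<delta>2 \<Longrightarrow> \<bar>u t - u s\<bar> < \<delta>1 / 2"
      using half_gt_zero[OF \<open>\<delta>1 > 0\<close>] unfolding uniformly_continuous_on_def dist_real_def by metis
    have ev1: "\<forall>\<^sub>F k in sequentially. h k < \<delta>2" by (rule order_tendstoD(2)[OF h0 \<open>\<delta>2 > 0\<close>])
    have ev2: "\<forall>\<^sub>F k in sequentially. \<eta> k < e / 2" by (rule order_tendstoD(2)[OF gt(2) half_gt_zero[OF \<open>e > 0\<close>]])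
    have ev3: "\<forall>\<^sub>F k in sequentially. \<bar>grid_flux (h k) c (x k) 0 - J\<bar> < \<epsilon> / 2"
      using tendstoD[OF J, of "\<epsilon> / 2"] \<open>\<epsilon> > 0\<close> by (simp add: h_def dist_real_def)
    have ev4: "\<forall>\<^sub>F k in sequentially. \<forall>j. real j * h k \<le> ?W \<longrightarrow> \<bar>x k j - u (real j * h k)\<bar> < min (\<delta>1 / 2) e"
      by (rule conv) (use \<open>\<delta>1 > 0\<close> \<open>e > 0\<close> in simp)
    from ev1 ev2 ev3 ev4 show ?thesis
    proof eventually_elim
      fix k
      assume k1: "h k < \<delta>2" and k2: "\<eta> k < e / 2" and k3: "\<bar>grid_flux (h k) c (x k) 0 - J\<bar> < \<epsilon> / 2"
        and k4: "\<forall>j. real j * h k \<le> ?W \<longrightarrow> \<bar>x k j - u (real j * h k)\<bar> < min (\<delta>1 / 2) e"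
      have cell: "\<bar>cell_integral a (h k) (Suc i) * gt k (x k (Suc i)) - cell_integral ?f (h k) (Suc i)\<bar> \<le>
          e * cell_integral (\<lambda>t. \<bar>a t\<bar>) (h k) (Suc i)" if i: "real (Suc i) * h k \<le> ?W" for i
      proof -
        let ?C = "{(real (Suc i) - 1) * h k..real (Suc i) * h k}"
        let ?y = "x k (Suc i)"
        have int: "(\<lambda>t. a t * gt k ?y - ?f t) integrable_on ?C"
          by (intro integrable_diff f integrable_on_mult_left ai)
        have "cell_integral a (h k) (Suc i) * gt k ?y - cell_integral ?f (h k) (Suc i) = integral ?C (\<lambda>t. a t * gt k ?y - ?f t)"
          unfolding cell_integral_def by (subst integral_diff) (auto intro!: f integrable_on_mult_left ai)
        also have "\<bar>\<dots>\<bar> \<le> integral ?C (\<lambda>t. e * \<bar>a t\<bar>)"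
          unfolding real_norm_def[symmetric]
        proof (rule integral_norm_bound_integral[OF int])
          show "(\<lambda>t. e * norm (a t)) integrable_on ?C" using integrable_cmul[OF aabs[of "(real (Suc i) - 1) * h k" "real (Suc i) * h k"], of e] by simp
          fix s assume s: "s \<in> ?C"
          have s': "0 \<le> s" "s \<le> real (Suc i) * h k" "real (Suc i) * h k - s \<le> h k"
            using s h[of k] by (auto simp: algebra_simps intro: order_trans[rotated])
          have "\<bar>u (real (Suc i) * h k) - u s\<bar> < \<delta>1 / 2"
            by (rule \<delta>2) (use s' i k1 in auto)
          moreover have "\<bar>?y - u (real (Suc i) * h k)\<bar> < \<delta>1 / 2" 
            using k4[rule_format, OF i] by (simp del: of_nat_Suc)
          ultimately have "\<bar>?y - u s\<bar> < \<delta>1" by linarith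
          then have "\<bar>g ?y - g (u s)\<bar> < e / 2" by (intro \<delta>1) (use x u(2) in auto)
          moreover have "\<bar>gt k ?y - g ?y\<bar> \<le> \<eta> k" by (rule gt(1)) (use x in auto)
          ultimately have "\<bar>gt k ?y - g (u s)\<bar> \<le> e" using k2 by linarith
          then have "\<bar>a s\<bar> * \<bar>gt k ?y - g (u s)\<bar> \<le> \<bar>a s\<bar> * e" by (rule mult_left_mono) auto
          then show "norm (a s * gt k ?y - ?f s) \<le> e * norm (a s)"
            unfolding right_diff_distrib[symmetric] real_norm_def abs_mult by (simp only: mult.commute)
        qed
        also have "\<dots> = e * cell_integral (\<lambda>t. \<bar>a t\<bar>) (h k) (Suc i)" by (simp add: cell_integral_def)
        finally show ?thesis .
      qed
      show "\<forall>j. real j * h k \<le> ?W \<longrightarrow> \<bar>(x k (Suc j) - x k j) / h k - v (real j * h k)\<bar> \<le> \<epsilon>"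
      proof (intro allI impI)
        fix j assume j: "real j * h k \<le> ?W"
        let ?S = "\<Sum>i<j. cell_integral a (h k) (Suc i) * gt k (x k (Suc i))"
        have "\<bar>?S - integral {0..real j * h k} ?f\<bar> \<le> e * A"
        proof -
          have "?S - integral {0..real j * h k} ?f =
              (\<Sum>i<j. cell_integral a (h k) (Suc i) * gt k (x k (Suc i)) - cell_integral ?f (h k) (Suc i))"
            by (simp add: sum_subtractf sum_cells[OF f h])
          also have "\<bar>\<dots>\<bar> \<le> (\<Sum>i<j. e * cell_integral (\<lambda>t. \<bar>a t\<bar>) (h k) (Suc i))"
          proof (rule order_trans[OF sum_abs sum_mono], rule cell)
            fix i assume "i \<in> {..<j}"
            then have "real (Suc i) * h k \<le> real j * h k" using h[of k] by (intro mult_right_mono) auto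
            then show "real (Suc i) * h k \<le> ?W" using j by linarith
          qed
          also have "\<dots> = e * integral {0..real j * h k} (\<lambda>t. \<bar>a t\<bar>)"
            by (simp add: sum_distrib_left[symmetric] sum_cells[OF aabs h])
          also have "\<dots> \<le> e * A"
            unfolding A_def using j \<open>e > 0\<close> by (intro mult_left_mono integral_subset_le aabs) auto
          finally show ?thesis .
        qed
        then have "\<bar>\<mu>\<bar> * \<bar>?S - integral {0..real j * h k} ?f\<bar> \<le> \<bar>\<mu>\<bar> * (e * A)" by (rule mult_left_mono) auto
        then have p1: "\<bar>\<mu> * ?S - \<mu> * integral {0..real j * h k} ?f\<bar> \<le> \<bar>\<mu>\<bar> * (e * A)"
          unfolding right_diff_distrib[symmetric] abs_mult .
        have "\<bar>x k j - u (real j * h k)\<bar> \<le> e" using k4 j by (simp add: less_imp_le)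
        then have "\<bar>c\<bar> * \<bar>x k j - u (real j * h k)\<bar> \<le> \<bar>c\<bar> * e" by (rule mult_left_mono) auto
        then have p2: "\<bar>c * x k j - c * u (real j * h k)\<bar> \<le> \<bar>c\<bar> * e"
          unfolding right_diff_distrib[symmetric] abs_mult .
        have "\<bar>c\<bar> * e + \<bar>\<mu>\<bar> * (e * A) \<le> e * D" using \<open>e > 0\<close> by (simp add: D_def algebra_simps)
        also have "e * D = \<epsilon> / 2" using \<open>D > 0\<close> by (simp add: e_def)
        finally have p3: "\<bar>c\<bar> * e + \<bar>\<mu>\<bar> * (e * A) \<le> \<epsilon> / 2" .
        have "(x k (Suc j) - x k j) / h k = grid_flux (h k) c (x k) 0 - \<mu> * ?S - c * x k j"
          using grid_solution_flux[OF sol[of k], of j] unfolding h_def[symmetric] by (simp add: grid_flux_def)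
        then show "\<bar>(x k (Suc j) - x k j) / h k - v (real j * h k)\<bar> \<le> \<epsilon>"
          using p1 p2 p3 k3 unfolding v_def by linarith
      qed
    qed
  qed
  define V where "V t = u 0 + integral {0..t} v" for t
  have vint: "v integrable_on {s..t}" if "0 \<le> s" "t \<le> ?W" for s t
    by (rule integrable_continuous_interval[OF continuous_on_subset[OF cont_v]]) (use that in auto)
  have "V t - u t = 0" if "t \<in> {0..?W}" for t
  proof (rule zero_if_small_at_nodes[OF _ h h0 _ that])
    show "continuous_on {0..?W} (\<lambda>t. V t - u t)"
      unfolding V_def by (intro continuous_intros cont_u indefinite_integral_continuous_1 vint) auto
    fix \<epsilon> :: real assume "\<epsilon> > 0"
    define e where "e = \<epsilon> / (2 + 2 * ?W)"
    have "e > 0" using \<open>\<epsilon> > 0\<close> T by (simp add: e_def)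
    have "uniformly_continuous_on {0..?W} v" by (rule compact_uniformly_continuous[OF cont_v]) auto
    then obtain \<delta> where "\<delta> > 0" and \<delta>: "\<And>s t. s \<in> {0..?W} \<Longrightarrow> t \<in> {0..?W} \<Longrightarrow> \<bar>t - s\<bar> < \<delta> \<Longrightarrow> \<bar>v t - v s\<bar> < e"
      using \<open>e > 0\<close> unfolding uniformly_continuous_on_def dist_real_def by metis
    have "\<forall>\<^sub>F k in sequentially. h k < \<delta>" by (rule order_tendstoD(2)[OF h0 \<open>\<delta> > 0\<close>])
    with slope[OF \<open>e > 0\<close>] conv[OF \<open>e > 0\<close>]
    show "\<forall>\<^sub>F k in sequentially. \<forall>j. real j * h k \<le> ?W \<longrightarrow> \<bar>V (real j * h k) - u (real j * h k)\<bar> \<le> \<epsilon>"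
    proof eventually_elim
      fix k
      assume k1: "\<forall>j. real j * h k \<le> ?W \<longrightarrow> \<bar>(x k (Suc j) - x k j) / h k - v (real j * h k)\<bar> \<le> e"
        and k2: "\<forall>j. real j * h k \<le> ?W \<longrightarrow> \<bar>x k j - u (real j * h k)\<bar> < e" and k3: "h k < \<delta>"
      have ind: "\<bar>x k j - V (real j * h k)\<bar> \<le> e + 2 * e * (real j * h k)" if "real j * h k \<le> ?W" for j
        using that
      proof (induction j)
        case 0
        then show ?case using k2[rule_format, of 0] T by (simp add: V_def)
      next
        case (Suc j)
        let ?s = "real j * h k" and ?t = "real (Suc j) * h k"
        have st: "0 \<le> ?s" "?s \<le> ?t" "?t = ?s + h k" using h[of k] by (auto simp: distrib_right)
        have "?s \<le> ?W" using st Suc.prems by linarith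
        have "V ?t - V ?s = integral {?s..?t} v"
          using Henstock_Kurzweil_Integration.integral_combine[OF st(1,2) vint[of 0 ?t]] Suc.prems by (simp add: V_def)
        moreover have "\<bar>integral {?s..?t} v - h k * v ?s\<bar> \<le> e * h k"
        proof -
          have "integral {?s..?t} v - h k * v ?s = integral {?s..?t} (\<lambda>r. v r - v ?s)"
            using vint[OF st(1) Suc.prems] st by (subst integral_diff) auto
          also have "norm \<dots> \<le> e * (?t - ?s)"
          proof (rule integral_bound[OF st(2)])
            show "continuous_on {?s..?t} (\<lambda>r. v r - v ?s)"
              by (intro continuous_intros continuous_on_subset[OF cont_v]) (use st Suc.prems in auto)
            show "norm (v r - v ?s) \<le> e" if r: "r \<in> {?s..?t}" for r
            proof -
              have r': "?s \<le> r" "r \<le> ?t" using r by auto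
              then have "0 \<le> r" "r \<le> ?W" "\<bar>r - ?s\<bar> < \<delta>" using st Suc.prems k3 by linarith+
              then have "\<bar>v r - v ?s\<bar> < e" using st(1) \<open>?s \<le> ?W\<close> by (intro \<delta>) auto
              then show ?thesis by simp
            qed
          qed
          finally show ?thesis using st by simp
        qed
        moreover have "\<bar>(x k (Suc j) - x k j) - h k * v ?s\<bar> \<le> e * h k"
        proof -
          have "\<bar>(x k (Suc j) - x k j) / h k - v ?s\<bar> * h k \<le> e * h k"
            using k1 \<open>?s \<le> ?W\<close> h[of k] by (intro mult_right_mono) auto
          moreover have "((x k (Suc j) - x k j) / h k - v ?s) * h k = (x k (Suc j) - x k j) - h k * v ?s"
            using less_imp_neq[OF h[of k]] by (simp add: left_diff_distrib[of "_ / _"] mult.commute[of "h k"])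
          ultimately show ?thesis using h[of k] by (metis abs_mult abs_of_pos)
        qed
        moreover have "2 * e * ?t = 2 * e * ?s + 2 * (e * h k)" unfolding st(3) by (simp add: distrib_left)
        ultimately show ?case using Suc.IH[OF \<open>?s \<le> ?W\<close>] by linarith
      qed
      show "\<forall>j. real j * h k \<le> ?W \<longrightarrow> \<bar>V (real j * h k) - u (real j * h k)\<bar> \<le> \<epsilon>"
      proof (intro allI impI)
        fix j assume j: "real j * h k \<le> ?W"
        have "2 * e * (real j * h k) \<le> 2 * e * ?W" using j \<open>e > 0\<close> by (intro mult_left_mono) auto
        moreover have "e + 2 * e * ?W + e = \<epsilon>"
        proof -
          have "e + 2 * e * ?W + e = e * (2 + 2 * ?W)" by (simp add: algebra_simps)
          also have "\<dots> = \<epsilon>" using T by (simp add: e_def)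
          finally show ?thesis .
        qed
        ultimately show "\<bar>V (real j * h k) - u (real j * h k)\<bar> \<le> \<epsilon>"
          using ind[OF j] k2[rule_format, OF j] by linarith
      qed
    qed
  qed
  then have uV: "u t = u 0 + integral {0..t} v" if "t \<in> {0..?W}" for t using that by (simp add: V_def)
  show "(u has_real_derivative v t) (at t)" if t: "0 < t" "t < ?W" for t
  proof -
    have "((\<lambda>s. integral {0..s} v) has_real_derivative v t) (at t within {0..?W})"
      by (rule integral_has_real_derivative[OF cont_v]) (use t in auto)
    then have "((\<lambda>s. integral {0..s} v) has_real_derivative v t) (at t)"
      using t by (simp add: at_within_Icc_at)
    then have "((\<lambda>s. u 0 + integral {0..s} v) has_real_derivative v t) (at t)"
      by (auto intro!: derivative_eq_intros)
    moreover have "\<forall>\<^sub>F s in nhds t. u s = u 0 + integral {0..s} v"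
      using eventually_nhds_in_open[of "{0<..<?W}" t] t by (auto elim!: eventually_mono intro!: uV)
    ultimately show ?thesis by (subst DERIV_cong_ev[OF refl _ refl]) auto
  qed
  show "u (t + T) = u t" if t: "0 \<le> t" "t \<le> 2 * T" for t
  proof -
    have "u (t + T) - u t = 0"
    proof (rule zero_if_small_at_nodes[where f = "\<lambda>t. u (t + T) - u t" and W = "2 * T", OF _ h h0])
      show "continuous_on {0..2 * T} (\<lambda>t. u (t + T) - u t)"
        by (intro continuous_intros continuous_on_compose2[OF u(1)]) auto
      fix \<epsilon> :: real assume "\<epsilon> > 0"
      show "\<forall>\<^sub>F k in sequentially. \<forall>j. real j * h k \<le> 2 * T \<longrightarrow> \<bar>u (real j * h k + T) - u (real j * h k)\<bar> \<le> \<epsilon>"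
        using conv[OF half_gt_zero[OF \<open>\<epsilon> > 0\<close>]]
      proof eventually_elim
        fix k assume k: "\<forall>j. real j * h k \<le> ?W \<longrightarrow> \<bar>x k j - u (real j * h k)\<bar> < \<epsilon> / 2"
        show "\<forall>j. real j * h k \<le> 2 * T \<longrightarrow> \<bar>u (real j * h k + T) - u (real j * h k)\<bar> \<le> \<epsilon>"
        proof (intro allI impI)
          fix j assume j: "real j * h k \<le> 2 * T"
          have jN: "real (j + N k) * h k = real j * h k + T" using Nh[of k] by (simp add: distrib_right)
          have "x k (j + N k) = x k j" using sol[of k] by (simp add: grid_solution_def)
          then show "\<bar>u (real j * h k + T) - u (real j * h k)\<bar> \<le> \<epsilon>"
            using k[rule_format, of j] k[rule_format, of "j + N k"] j T unfolding jN by linarith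
        qed
      qed
    qed (use t in auto)
    then show ?thesis by simp
  qed
qed

text \<open>
  The node \<open>0\<close> is left out of the uniform convergence because the limit is identified in the interior of a
  window that starts there; the nodes \<open>1, \<dots>, n\<close> make up a full period.
\<close>
theorem grid_solutions_converge:
  assumes T: "T > 0" and a: "locally_integrable a" and aper: "\<And>t. a (t + T) = a t"
    and g: "continuous_on {0..} g"
    and N: "\<And>k. N k > 0" "filterlim N at_top sequentially"
    and sol: "\<And>k. grid_solution T c \<mu> a (gt k) (N k) (x k)"
    and x: "\<And>k j. 0 \<le> x k j \<and> x k j \<le> R"
    and gt: "\<And>k s. 0 \<le> s \<Longrightarrow> s \<le> R \<Longrightarrow> \<bar>gt k s - g s\<bar> \<le> \<eta> k" "\<eta> \<longlonglongrightarrow> 0"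
  shows "\<exists>r u v. strict_mono (r :: nat \<Rightarrow> nat) \<and> weak_periodic_solution T c \<mu> a g u v \<and> (\<forall>t. u t \<le> R) \<and>
     (\<forall>\<epsilon>>0. \<forall>\<^sub>F k in sequentially. \<forall>j. 0 < j \<and> j \<le> N (r k) \<longrightarrow> \<bar>x (r k) j - u (real j * (T / real (N (r k))))\<bar> < \<epsilon>)"
proof -
  let ?W = "3 * T"
  define h where "h k = T / real (N k)" for k
  have h: "h k > 0" for k using T N(1)[of k] by (simp add: h_def)
  have Nh: "real (N k) * h k = T" for k using N(1)[of k] by (simp add: h_def)
  have "R \<ge> 0" using x[of 0 0] by linarith
  have "bounded (g ` {0..R})"
    by (rule compact_imp_bounded[OF compact_continuous_image[OF continuous_on_subset[OF g]]]) auto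
  then obtain G0 where G0: "\<And>s. s \<in> {0..R} \<Longrightarrow> \<bar>g s\<bar> \<le> G0"
    unfolding bounded_iff real_norm_def by (meson imageI)
  obtain E where E: "\<And>k. \<bar>\<eta> k\<bar> \<le> E"
    using convergent_imp_Bseq[OF convergentI[OF gt(2)]] unfolding Bseq_def real_norm_def by blast
  have G: "\<bar>gt k s\<bar> \<le> G0 + E" if "0 \<le> s" "s \<le> R" for k s
    using gt(1)[OF that, of k] G0[of s] E[of k] that by auto
  define I where "I = \<bar>\<mu>\<bar> * (G0 + E) * integral {0..T} (\<lambda>t. \<bar>a t\<bar>)"
  define B where "B = 2 * \<bar>c\<bar> * R + I"
  have flux: "\<bar>grid_flux (h k) c (x k) j\<bar> \<le> \<bar>c\<bar> * R + I" for k j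
    using grid_solution_slope_bound(1)[OF T N(1)[of k] a sol[of k] x[of k] G[where k = k], of j] by (simp add: h_def I_def)
  have slope: "\<bar>(x k (Suc j) - x k j) / h k\<bar> \<le> B" for k j
    using grid_solution_slope_bound(2)[OF T N(1)[of k] a sol[of k] x[of k] G[where k = k], of j] by (simp add: h_def I_def B_def)
  have "B \<ge> 0" using slope[of 0 0] by linarith
  have "\<bar>x k (Suc j) - x k j\<bar> \<le> B * h k" for k j
    using slope[of k j] h[of k] by (simp add: pos_divide_le_eq)
  then have "\<forall>k. \<exists>U. (\<forall>s t. \<bar>U s - U t\<bar> \<le> B * \<bar>s - t\<bar>) \<and> (\<forall>j\<le>3 * N k. U (real j * h k) = x k j)"
    using lipschitz_interpolation[OF h \<open>B \<ge> 0\<close>] by blast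
  from choice[OF this] obtain U where U_all: "\<forall>k. (\<forall>s t. \<bar>U k s - U k t\<bar> \<le> B * \<bar>s - t\<bar>) \<and>
      (\<forall>j\<le>3 * N k. U k (real j * h k) = x k j)" ..
  then have U: "\<bar>U k s - U k t\<bar> \<le> B * \<bar>s - t\<bar>" for k s t by blast
  have Ux: "U k (real j * h k) = x k j" if "j \<le> 3 * N k" for k j using U_all that by blast
  have node: "j \<le> 3 * N k" if "real j * h k \<le> ?W" for j k
  proof -
    have "real j * h k \<le> real (3 * N k) * h k" using that Nh[of k] by (simp add: mult.assoc)
    then show ?thesis using h[of k] by (simp add: mult_le_cancel_right_pos del: of_nat_mult)
  qed
  have bound: "norm (U k t) \<le> R + B * ?W" if "t \<in> {0..?W}" for k t
  proof -
    have "\<bar>U k t - U k 0\<bar> \<le> B * ?W" using U[of k t 0] that mult_left_mono[of t ?W B] \<open>B \<ge> 0\<close> by auto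
    moreover have "U k 0 = x k 0" using Ux[of 0 k] by simp
    ultimately show ?thesis using x[of k 0] by auto
  qed
  have equi: "\<exists>d. 0 < d \<and> (\<forall>k y. y \<in> {0..?W} \<and> norm (t - y) < d \<longrightarrow> norm (U k t - U k y) < e)"
    if "t \<in> {0..?W}" "e > 0" for t e
  proof (intro exI conjI allI impI)
    show "e / (B + 1) > 0" using \<open>e > 0\<close> \<open>B \<ge> 0\<close> by simp
    fix k y assume "y \<in> {0..?W} \<and> norm (t - y) < e / (B + 1)"
    then have "(B + 1) * \<bar>t - y\<bar> < e" using \<open>B \<ge> 0\<close> by (simp add: pos_less_divide_eq mult.commute)
    moreover have "B * \<bar>t - y\<bar> \<le> (B + 1) * \<bar>t - y\<bar>" by (intro mult_right_mono) auto
    ultimately show "norm (U k t - U k y) < e" using U[of k t y] by simp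
  qed
  have "\<exists>w r1. continuous_on {0..?W} w \<and> strict_mono (r1 :: nat \<Rightarrow> nat) \<and>
      (\<forall>e>0. \<exists>M. \<forall>n t. n \<ge> M \<and> t \<in> {0..?W} \<longrightarrow> norm (U (r1 n) t - w t) < e)"
  proof (rule Arzela_Ascoli[of "{0..?W}" U "R + B * ?W"])
    show "norm (U k t) \<le> R + B * ?W" if "t \<in> {0..?W}" for k t by (rule bound[OF that])
    show "\<exists>d. 0 < d \<and> (\<forall>k y. y \<in> {0..?W} \<and> norm (t - y) < d \<longrightarrow> norm (U k t - U k y) < e)"
      if "t \<in> {0..?W}" "e > 0" for t e by (rule equi[OF that])
  qed (rule compact_Icc, blast)
  then obtain w r1 where w: "continuous_on {0..?W} w" and r1: "strict_mono (r1 :: nat \<Rightarrow> nat)"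
    and Uw: "\<And>e. 0 < e \<Longrightarrow> \<exists>M. \<forall>n t. n \<ge> M \<and> t \<in> {0..?W} \<longrightarrow> norm (U (r1 n) t - w t) < e"
    by blast
  obtain J r2 where r2: "strict_mono (r2 :: nat \<Rightarrow> nat)"
    and J: "(\<lambda>k. grid_flux (h (r1 (r2 k))) c (x (r1 (r2 k))) 0) \<longlonglongrightarrow> J"
    using bounded_coordinates_convergent_subseq[of 1 "\<lambda>k i. grid_flux (h (r1 k)) c (x (r1 k)) 0", OF flux] by auto
  define r where "r = r1 \<circ> r2"
  have r: "strict_mono r" unfolding r_def by (rule strict_mono_o[OF r1 r2])
  \<comment> \<open>constant continuation outside the window makes \<open>u\<close> continuous on the line\<close>
  define u where "u t = w (max 0 (min t ?W))" for t
  have u_eq: "u t = w t" if "t \<in> {0..?W}" for t using that by (simp add: u_def)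
  have Uu: "\<forall>\<^sub>F k in sequentially. \<forall>t\<in>{0..?W}. \<bar>U (r k) t - u t\<bar> < \<epsilon>" if \<epsilon>: "\<epsilon> > 0" for \<epsilon>
  proof -
    obtain M where M: "\<forall>n t. n \<ge> M \<and> t \<in> {0..?W} \<longrightarrow> norm (U (r1 n) t - w t) < \<epsilon>" using Uw[OF \<epsilon>] by blast
    have "\<forall>t\<in>{0..?W}. \<bar>U (r k) t - u t\<bar> < \<epsilon>" if "k \<ge> M" for k
      using M that seq_suble[OF r2, of k] u_eq by (auto simp: r_def)
    then show ?thesis unfolding eventually_sequentially by blast
  qed
  have conv: "\<forall>\<^sub>F k in sequentially. \<forall>j. real j * (T / real (N (r k))) \<le> ?W \<longrightarrow>
       \<bar>x (r k) j - u (real j * (T / real (N (r k))))\<bar> < \<epsilon>" if "\<epsilon> > 0" for \<epsilon>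
    using Uu[OF that]
  proof eventually_elim
    case (elim k)
    show ?case unfolding h_def[symmetric]
    proof (intro allI impI)
      fix j assume j: "real j * h (r k) \<le> ?W"
      then have "real j * h (r k) \<in> {0..?W}" using h[of "r k"] by simp
      with elim have "\<bar>U (r k) (real j * h (r k)) - u (real j * h (r k))\<bar> < \<epsilon>" ..
      then show "\<bar>x (r k) j - u (real j * h (r k))\<bar> < \<epsilon>" by (simp only: Ux[OF node[OF j]])
    qed
  qed
  have cont_u: "continuous_on UNIV u"
    unfolding u_def by (rule continuous_on_compose2[OF w]) (use T in \<open>auto intro!: continuous_intros\<close>)
  have range_w: "0 \<le> w t \<and> w t \<le> R" if t: "t \<in> {0..?W}" for t
  proof -
    \<comment> \<open>\<open>\<phi>\<close> vanishes exactly where \<open>w\<close> lies in \<open>[0, R]\<close>\<close>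
    define \<phi> where "\<phi> s = max 0 (- w s) + max 0 (w s - R)" for s
    have "\<phi> t = 0"
    proof (rule zero_if_small_at_nodes[where h = "\<lambda>k. h (r k)", OF _ h _ _ t])
      show "continuous_on {0..?W} \<phi>" unfolding \<phi>_def by (intro continuous_intros w)
      have "filterlim (\<lambda>k. real (N (r k))) at_top sequentially"
        by (rule filterlim_compose[OF filterlim_real_sequentially filterlim_compose[OF N(2) filterlim_subseq[OF r]]])
      then show "(\<lambda>k. h (r k)) \<longlonglongrightarrow> 0"
        unfolding h_def by (rule tendsto_divide_0[OF tendsto_const filterlim_at_top_imp_at_infinity])
      fix \<epsilon> :: real assume "\<epsilon> > 0"
      show "\<forall>\<^sub>F k in sequentially. \<forall>j. real j * h (r k) \<le> ?W \<longrightarrow> \<bar>\<phi> (real j * h (r k))\<bar> \<le> \<epsilon>"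
        using conv[OF \<open>\<epsilon> > 0\<close>]
      proof eventually_elim
        case (elim k)
        show ?case
        proof (intro allI impI)
          fix j assume j: "real j * h (r k) \<le> ?W"
          then have "\<bar>x (r k) j - w (real j * h (r k))\<bar> < \<epsilon>"
            using elim u_eq[of "real j * h (r k)"] h[of "r k"] unfolding h_def[symmetric] by auto
          then show "\<bar>\<phi> (real j * h (r k))\<bar> \<le> \<epsilon>"
            using x[of "r k" j] \<open>\<epsilon> > 0\<close> unfolding \<phi>_def by linarith
        qed
      qed
    qed
    then show ?thesis unfolding \<phi>_def by linarith
  qed
  have u_range: "0 \<le> u t \<and> u t \<le> R" for t unfolding u_def by (rule range_w) (use T in auto)
  have NR: "filterlim (\<lambda>k. N (r k)) at_top sequentially"
    by (rule filterlim_compose[OF N(2) filterlim_subseq[OF r]])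
  have \<eta>r: "(\<lambda>k. \<eta> (r k)) \<longlonglongrightarrow> 0" using LIMSEQ_subseq_LIMSEQ[OF gt(2) r] by (simp add: o_def)
  have Jr: "(\<lambda>k. grid_flux (T / real (N (r k))) c (x (r k)) 0) \<longlonglongrightarrow> J"
    using J by (simp add: o_def r_def h_def)
  note eqs = grid_limit_equation[OF T a g N(1) NR sol x gt(1) \<eta>r cont_u u_range conv Jr]
  define v where "v t = J - c * u t - \<mu> * integral {0..t} (\<lambda>t. a t * g (u t))" for t
  have fi: "(\<lambda>t. a t * g (u t)) integrable_on {s..t}" for s t
  proof (rule set_lebesgue_integral_eq_integral(1)[OF absolutely_integrable_times_continuous])
    show "continuous_on {s..t} (\<lambda>t. g (u t))"
      by (rule continuous_on_compose2[OF g continuous_on_subset[OF cont_u]]) (use u_range in auto)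
  qed (use a in \<open>auto simp: locally_integrable_def\<close>)
  have "\<exists>u' v'. weak_periodic_solution T c \<mu> a g u' v' \<and> (\<forall>t. 0 < t \<and> t < 3 * T \<longrightarrow> u' t = u t)"
  proof (rule weak_periodic_solution_from_window[where v = v, OF T a aper g])
    show "u (t + T) = u t" if "0 \<le> t" "t \<le> 2 * T" for t using eqs(2) that by blast
    show "(u has_real_derivative v t) (at t)" if "0 < t" "t < 3 * T" for t
      unfolding v_def using eqs(1) that by blast
    show "v y - v x = - c * (u y - u x) - \<mu> * integral {x..y} (\<lambda>t. a t * g (u t))"
      if xy: "0 \<le> x" "x \<le> y" "y \<le> 3 * T" for x y
      unfolding v_def Henstock_Kurzweil_Integration.integral_combine[OF xy(1,2) fi, symmetric]
      by (simp add: algebra_simps)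
  qed (use u_range in auto)
  then obtain u' v' where u': "weak_periodic_solution T c \<mu> a g u' v'"
    and eq: "\<And>t. 0 < t \<Longrightarrow> t < 3 * T \<Longrightarrow> u' t = u t" by blast
  have "u' t \<le> R" for t
  proof -
    have per: "u' (t + T) = u' t" for t using u' by (simp add: weak_periodic_solution_def)
    define k where "k = \<lfloor>t / T\<rfloor>"
    have "of_int k * T \<le> t" "t < (of_int k + 1) * T"
      using T floor_divide_lower[of T t] floor_divide_upper[of T t] by (auto simp: k_def)
    then have *: "0 < t + of_int (1 - k) * T" "t + of_int (1 - k) * T < 3 * T" using T by (auto simp: algebra_simps)
    have "u' t = u' (t + of_int (1 - k) * T)" by (rule periodic_of_int[of u' T, OF per, symmetric])
    also have "\<dots> = u (t + of_int (1 - k) * T)" using eq[OF *] .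
    finally show ?thesis using u_range by simp
  qed
  moreover have "\<forall>\<^sub>F k in sequentially. \<forall>j. 0 < j \<and> j \<le> N (r k) \<longrightarrow>
      \<bar>x (r k) j - u' (real j * (T / real (N (r k))))\<bar> < \<epsilon>" if "\<epsilon> > 0" for \<epsilon>
    using conv[OF that]
  proof eventually_elim
    case (elim k)
    show ?case
    proof (intro allI impI)
      fix j assume j: "0 < j \<and> j \<le> N (r k)"
      have "real j * h (r k) \<le> real (N (r k)) * h (r k)" using j h[of "r k"] by (intro mult_right_mono) auto
      then have "real j * h (r k) \<le> T" by (simp add: Nh)
      moreover have "0 < real j * h (r k)" using j h[of "r k"] by simp
      ultimately show "\<bar>x (r k) j - u' (real j * (T / real (N (r k))))\<bar> < \<epsilon>"
        using elim eq[of "real j * h (r k)"] T unfolding h_def[symmetric] by auto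
    qed
  qed
  ultimately show ?thesis using r u' by blast
qed

section \<open>Two grid solutions between barriers\<close>

text \<open>
  \<open>\<beta>\<^sub>1 \<le> \<beta>\<^sub>2\<close> are strict supersolutions, \<open>\<alpha>\<close> and \<open>4 \<alpha>\<close> are subsolutions below \<open>\<beta>\<^sub>2\<close>, and \<open>\<alpha>\<close> is not below \<open>\<beta>\<^sub>1\<close>.
  The factors separate the solutions: \<open>y \<ge> 4 \<alpha>\<close> everywhere, while \<open>x < 2 \<alpha>\<close> somewhere.
\<close>
theorem grid_two_solutions:
  fixes A :: "nat \<Rightarrow> real" and g :: "real \<Rightarrow> real"
  assumes n: "n > 0" and h: "h > 0" and ch: "c * h \<le> 1"
    and Aper: "\<And>j. A (j + n) = A j"
    and g0: "g 0 = 0" and lip: "\<And>s t. 0 \<le> s \<Longrightarrow> s \<le> t \<Longrightarrow> t \<le> R \<Longrightarrow> \<bar>g t - g s\<bar> \<le> K * (t - s)"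
    and per: "\<And>j. \<alpha> (j + n) = \<alpha> j" "\<And>j. \<beta>\<^sub>1 (j + n) = \<beta>\<^sub>1 j" "\<And>j. \<beta>\<^sub>2 (j + n) = \<beta>\<^sub>2 j"
    and \<beta>: "\<And>j. 0 < \<beta>\<^sub>1 j" "\<And>j. \<beta>\<^sub>1 j \<le> \<beta>\<^sub>2 j" "\<And>j. \<beta>\<^sub>2 j \<le> R"
    and super: "\<And>j. grid_operator h c \<beta>\<^sub>1 j + \<mu> * A (Suc j) * g (\<beta>\<^sub>1 (Suc j)) < 0"
               "\<And>j. grid_operator h c \<beta>\<^sub>2 j + \<mu> * A (Suc j) * g (\<beta>\<^sub>2 (Suc j)) < 0"
    and \<alpha>: "\<And>j. 0 \<le> \<alpha> j" "\<And>j. 4 * \<alpha> j \<le> \<beta>\<^sub>2 j" "\<beta>\<^sub>1 m < \<alpha> m"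
    and sub: "\<And>j. 0 \<le> grid_operator h c \<alpha> j + \<mu> * A (Suc j) * g (\<alpha> (Suc j))"
             "\<And>j. 0 \<le> grid_operator h c (\<lambda>j. 4 * \<alpha> j) j + \<mu> * A (Suc j) * g (4 * \<alpha> (Suc j))"
  shows "\<exists>x y. (\<forall>j. x (j + n) = x j \<and> 0 \<le> x j \<and> x j \<le> R \<and> grid_operator h c x j + \<mu> * A (Suc j) * g (x (Suc j)) = 0) \<and>
      (\<forall>j. y (j + n) = y j \<and> 0 \<le> y j \<and> y j \<le> R \<and> grid_operator h c y j + \<mu> * A (Suc j) * g (y (Suc j)) = 0) \<and>
      (\<exists>j. \<beta>\<^sub>1 j < x j) \<and> (\<exists>j. x j < 2 * \<alpha> j) \<and> (\<forall>j. 4 * \<alpha> j \<le> y j)"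
proof -
  obtain p where p: "n = Suc p" using n by (cases n) auto
  have \<beta>2_pos: "0 < \<beta>\<^sub>2 j" for j using \<beta>(1,2)[of j] by linarith
  have "R > 0" using \<beta>2_pos[of 0] \<beta>(3)[of 0] by linarith
  have "0 \<le> K * R" using lip[of 0 R] \<open>R > 0\<close> by (intro order_trans[OF abs_ge_zero]) auto
  then have "K \<ge> 0" using \<open>R > 0\<close> by (simp add: zero_le_mult_iff)
  define res where "res x j = grid_operator h c x j + \<mu> * A (Suc j) * g (x (Suc j))" for x j
  define M where "M = (\<Sum>j<n. \<bar>A j\<bar>)"
  have AM: "\<bar>A j\<bar> \<le> M" for j
  proof -
    have "A (j mod n) = A j" by (rule periodic_mod) (rule Aper)
    moreover have "\<bar>A (j mod n)\<bar> \<le> M"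
      unfolding M_def using n by (intro member_le_sum[of "j mod n" "{..<n}" "\<lambda>j. \<bar>A j\<bar>"]) auto
    ultimately show ?thesis by simp
  qed
  have "M \<ge> 0" using AM[of 0] by linarith
  \<comment> \<open>a step size for which the diagonal coefficient of the Euler map stays nonnegative\<close>
  define \<tau> where "\<tau> = 1 / (2 / h + \<bar>c\<bar> + \<bar>\<mu>\<bar> * M * K + 1)"
  have den: "2 / h + \<bar>c\<bar> + \<bar>\<mu>\<bar> * M * K + 1 > 0" using h \<open>M \<ge> 0\<close> \<open>K \<ge> 0\<close> by (intro add_nonneg_pos add_nonneg_nonneg) auto
  then have "\<tau> > 0" by (simp add: \<tau>_def)
  have \<tau>: "\<tau> * (2 / h + \<bar>c\<bar> + \<bar>\<mu>\<bar> * M * K) \<le> 1" using den by (simp add: \<tau>_def)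
  have step_mono: "z (Suc j) + \<tau> * res z j \<le> z' (Suc j) + \<tau> * res z' j"
    if zz: "\<And>j. 0 \<le> z j \<and> z j \<le> z' j \<and> z' j \<le> R" for z z' j
  proof -
    define d where "d i = z' i - z i" for i
    have d: "d i \<ge> 0" for i using zz[of i] by (simp add: d_def)
    have "res z' j - res z j = (d (Suc (Suc j)) - 2 * d (Suc j) + d j) / h + c * (d (Suc j) - d j) +
        \<mu> * A (Suc j) * (g (z' (Suc j)) - g (z (Suc j)))"
      unfolding res_def grid_operator_def d_def by (simp add: algebra_simps diff_divide_distrib add_divide_distrib)
    also have "\<dots> = d (Suc (Suc j)) / h + (1 / h - c) * d j - (2 / h - c) * d (Suc j) +
        \<mu> * A (Suc j) * (g (z' (Suc j)) - g (z (Suc j)))"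
      by (simp add: algebra_simps diff_divide_distrib add_divide_distrib)
    finally have eq: "res z' j - res z j = \<dots>" .
    have "\<bar>\<mu> * A (Suc j) * (g (z' (Suc j)) - g (z (Suc j)))\<bar> \<le> (\<bar>\<mu>\<bar> * M) * (K * d (Suc j))"
      unfolding abs_mult using zz[of "Suc j"] AM[of "Suc j"] lip[of "z (Suc j)" "z' (Suc j)"] \<open>M \<ge> 0\<close>
      by (intro mult_mono) (auto simp: d_def)
    moreover have "0 \<le> d (Suc (Suc j)) / h" using d h by simp
    moreover have "0 \<le> (1 / h - c) * d j" using d ch h by (intro mult_nonneg_nonneg) (auto simp: field_simps)
    moreover have "(2 / h - c) * d (Suc j) \<le> (2 / h + \<bar>c\<bar>) * d (Suc j)" using d by (intro mult_right_mono) auto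
    ultimately have "- ((2 / h + \<bar>c\<bar>) * d (Suc j) + (\<bar>\<mu>\<bar> * M) * (K * d (Suc j))) \<le> res z' j - res z j"
      unfolding eq by linarith
    also have "(2 / h + \<bar>c\<bar>) * d (Suc j) + (\<bar>\<mu>\<bar> * M) * (K * d (Suc j)) = (2 / h + \<bar>c\<bar> + \<bar>\<mu>\<bar> * M * K) * d (Suc j)"
      by (simp add: algebra_simps)
    finally have "\<tau> * - ((2 / h + \<bar>c\<bar> + \<bar>\<mu>\<bar> * M * K) * d (Suc j)) \<le> \<tau> * (res z' j - res z j)"
      using \<open>\<tau> > 0\<close> by (intro mult_left_mono) auto
    moreover have "(\<tau> * (2 / h + \<bar>c\<bar> + \<bar>\<mu>\<bar> * M * K)) * d (Suc j) \<le> 1 * d (Suc j)"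
      by (rule mult_right_mono[OF \<tau> d])
    moreover have "\<tau> * - ((2 / h + \<bar>c\<bar> + \<bar>\<mu>\<bar> * M * K) * d (Suc j)) = - ((\<tau> * (2 / h + \<bar>c\<bar> + \<bar>\<mu>\<bar> * M * K)) * d (Suc j))"
      by simp
    moreover have "\<tau> * (res z' j - res z j) = \<tau> * res z' j - \<tau> * res z j" by (rule right_diff_distrib)
    moreover have "z' (Suc j) = z (Suc j) + d (Suc j)" by (simp add: d_def)
    ultimately show ?thesis by linarith
  qed
  \<comment> \<open>clipping to \<open>[0, \<beta>\<^sub>2]\<close> bounds the map without breaking monotonicity or adding fixed points\<close>
  define clip where "clip x j = max 0 (min (x (j mod n)) (\<beta>\<^sub>2 j))" for x :: "nat \<Rightarrow> real" and j
  have clip_per: "clip x (j + n) = clip x j" for x j by (simp add: clip_def per)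
  have clip_range: "0 \<le> clip x j \<and> clip x j \<le> \<beta>\<^sub>2 j" for x j using \<beta>2_pos[of j] by (auto simp: clip_def)
  have clip_R: "clip x j \<le> R" for x j using clip_range[of x j] \<beta>(3)[of j] by linarith
  have clip_mono: "clip x j \<le> clip y j" if "\<And>i. i < n \<Longrightarrow> x i \<le> y i" for x y j
  proof -
    have "x (j mod n) \<le> y (j mod n)" using that n by simp
    then show ?thesis unfolding clip_def by (intro max.mono min.mono) auto
  qed
  have clip_id: "clip x j = x j" if "\<And>j. x (j + n) = x j" "\<And>j. 0 \<le> x j \<and> x j \<le> \<beta>\<^sub>2 j" for x j
    using periodic_mod[of x n j, OF that(1)] that(2)[of j] by (simp add: clip_def)
  \<comment> \<open>as \<open>n = p + 1\<close>, the node \<open>i + p + 1\<close> is \<open>i\<close> modulo \<open>n\<close>; the shift avoids the predecessor of \<open>0\<close>\<close>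
  define F where "F x i = clip x (Suc (i + p)) + \<tau> * res (clip x) (i + p)" for x i
  have F_mono: "F x i \<le> F y i" if "\<And>j. j < n \<Longrightarrow> x j \<le> y j" for x y i
    unfolding F_def using clip_mono[OF that] clip_range clip_R by (intro step_mono) auto
  have F_eq: "F x i = x i + \<tau> * res x (i + p)" if "\<And>j. x (j + n) = x j" "\<And>j. 0 \<le> x j \<and> x j \<le> \<beta>\<^sub>2 j" for x i
  proof -
    have "clip x = x" using clip_id[OF that] by auto
    then show ?thesis using that(1)[of i] by (simp add: F_def p)
  qed
  have F_cont: "(\<lambda>k. F (X k) i) \<longlonglongrightarrow> F x i"
    if X: "\<And>j. j < n \<Longrightarrow> (\<lambda>k. X k j) \<longlonglongrightarrow> x j" for X x i
  proof -
    have cl: "(\<lambda>k. clip (X k) j) \<longlonglongrightarrow> clip x j" for j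
      unfolding clip_def using n by (intro tendsto_intros X) auto
    have gl: "(\<lambda>k. g (clip (X k) j)) \<longlonglongrightarrow> g (clip x j)" for j
    proof -
      have "(\<lambda>k. g (clip (X k) j) - g (clip x j)) \<longlonglongrightarrow> 0"
      proof (rule tendsto_0_le[where K = K])
        show "(\<lambda>k. clip (X k) j - clip x j) \<longlonglongrightarrow> 0" using cl by (simp add: LIM_zero)
        show "\<forall>\<^sub>F k in sequentially. norm (g (clip (X k) j) - g (clip x j)) \<le> norm (clip (X k) j - clip x j) * K"
        proof (intro always_eventually allI)
          fix k
          show "norm (g (clip (X k) j) - g (clip x j)) \<le> norm (clip (X k) j - clip x j) * K"
          proof (cases "clip x j \<le> clip (X k) j")
            case True
            then show ?thesis using lip[of "clip x j" "clip (X k) j"] clip_range clip_R by (simp add: mult.commute)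
          next
            case False
            then show ?thesis using lip[of "clip (X k) j" "clip x j"] clip_range clip_R
              by (simp add: mult.commute abs_minus_commute)
          qed
        qed
      qed
      then show ?thesis by (simp add: LIM_zero_iff)
    qed
    show ?thesis unfolding F_def res_def grid_operator_def by (intro tendsto_intros cl gl) (use h in auto)
  qed
  have F_nonneg: "0 \<le> F x i" for x i
  proof -
    have "F (\<lambda>_. min 0 (Min (x ` {..<n}))) i \<le> F x i"
      by (rule F_mono) (auto simp: min_le_iff_disj)
    moreover have "clip (\<lambda>_. min 0 (Min (x ` {..<n}))) = (\<lambda>_. 0)" using \<beta>2_pos by (auto simp: clip_def fun_eq_iff)
    ultimately show ?thesis by (simp add: F_def res_def grid_operator_def g0)
  qed
  have F_less: "F x i < \<beta>\<^sub>2 i" for x i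
  proof -
    have "clip x j \<le> clip \<beta>\<^sub>2 j" for j
      using clip_range[of x j] clip_id[of \<beta>\<^sub>2 j] per \<beta>2_pos by (simp add: less_imp_le)
    then have "F x i \<le> F \<beta>\<^sub>2 i" unfolding F_def using clip_range clip_R by (intro step_mono) auto
    also have "\<dots> = \<beta>\<^sub>2 i + \<tau> * res \<beta>\<^sub>2 (i + p)" by (rule F_eq) (use per \<beta>2_pos in \<open>auto simp: less_imp_le\<close>)
    also have "\<dots> < \<beta>\<^sub>2 i" using super(2) \<open>\<tau> > 0\<close> by (simp add: res_def mult_pos_neg)
    finally show ?thesis .
  qed
  have F_R: "F x i \<le> R" for x i using F_less[of x i] \<beta>(3)[of i] by linarith
  have sol: "clip x (j + n) = clip x j \<and> 0 \<le> clip x j \<and> clip x j \<le> R \<and> res (clip x) j = 0"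
    if fp: "\<And>i. i < n \<Longrightarrow> F x i = x i" for x j
  proof -
    have cl: "clip x i = x i" if "i < n" for i
      using fp[OF that] F_nonneg[of x i] F_less[of x i] that by (simp add: clip_def)
    have res0: "res (clip x) (i + p) = 0" if "i < n" for i
    proof -
      have "clip x (Suc (i + p)) = x i" using clip_per[of x i] cl[OF that] by (simp add: p)
      then show ?thesis using fp[OF that] \<open>\<tau> > 0\<close> by (simp add: F_def)
    qed
    have rper: "res (clip x) (j + n) = res (clip x) j" for j
      using clip_per[of x j] clip_per[of x "Suc j"] clip_per[of x "Suc (Suc j)"] Aper[of "Suc j"]
      by (simp add: res_def grid_operator_def)
    have "(Suc j mod n + p) mod n = j mod n" unfolding p by (simp add: mod_add_left_eq) (metis add_Suc_right mod_add_self2)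
    then have "res (clip x) (Suc j mod n + p) = res (clip x) j"
      using periodic_mod[of "res (clip x)" n, OF rper] by metis
    then show ?thesis using res0[of "Suc j mod n"] n clip_per clip_range clip_R by simp
  qed
  have \<alpha>_le: "\<alpha> j \<le> \<beta>\<^sub>2 j" for j using \<alpha>(1,2)[of j] by linarith
  have F_\<alpha>: "\<alpha> i \<le> F \<alpha> i" for i
    using F_eq[of \<alpha> i] per \<alpha>(1) \<alpha>_le sub(1)[of "i + p"] \<open>\<tau> > 0\<close> by (simp add: res_def)
  have F_4\<alpha>: "4 * \<alpha> i \<le> F (\<lambda>j. 4 * \<alpha> j) i" for i
    using F_eq[of "\<lambda>j. 4 * \<alpha> j" i] per \<alpha>(1,2) sub(2)[of "i + p"] \<open>\<tau> > 0\<close> by (simp add: res_def)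
  \<comment> \<open>lowering a point above \<open>2 \<alpha>\<close> by \<open>e\<close> and clipping it at \<open>0\<close> leaves it above \<open>\<alpha>\<close>\<close>
  define e where "e = Min (insert 1 (\<alpha> ` {j \<in> {..<n}. 0 < \<alpha> j}))"
  have "e > 0" unfolding e_def by (subst Min_gr_iff) auto
  have e: "e \<le> \<alpha> j" if "j < n" "0 < \<alpha> j" for j
    unfolding e_def using that by (intro Min_le) auto
  have "\<exists>x. (\<forall>i<n. F x i = x i) \<and> (\<exists>i<n. \<beta>\<^sub>1 i < x i) \<and> (\<exists>i<n. x i < 2 * \<alpha> i)"
  proof (rule threshold_fixed_point[where m = "m mod n" and b = R and \<alpha> = \<alpha> and \<epsilon> = e])
    show "F x i \<le> F y i" if "\<And>j. j < n \<Longrightarrow> x j \<le> y j" for x y i by (rule F_mono[OF that])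
    show "(\<lambda>k. F (X k) i) \<longlonglongrightarrow> F x i" if "\<And>j. j < n \<Longrightarrow> (\<lambda>k. X k j) \<longlonglongrightarrow> x j" for X x i by (rule F_cont[OF that])
    show "0 \<le> F x i \<and> F x i \<le> R" for x i using F_nonneg F_R by blast
    show "F \<beta>\<^sub>1 i < \<beta>\<^sub>1 i" for i
      using F_eq[of \<beta>\<^sub>1 i] per \<beta>(1,2) super(1)[of "i + p"] \<open>\<tau> > 0\<close> by (simp add: res_def less_imp_le mult_pos_neg)
    show "\<beta>\<^sub>1 (m mod n) < \<alpha> (m mod n)"
      using \<alpha>(3) periodic_mod[of \<beta>\<^sub>1 n m, OF per(2)] periodic_mod[of \<alpha> n m, OF per(1)] by simp
    show "\<alpha> i \<le> F (\<lambda>j. x j - e) i" if x: "\<And>j. j < n \<Longrightarrow> 2 * \<alpha> j \<le> x j" for x i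
    proof -
      have "clip \<alpha> j \<le> clip (\<lambda>j. x j - e) j" for j
      proof -
        have "\<alpha> (j mod n) \<le> x (j mod n) - e \<or> \<alpha> (j mod n) = 0"
          using x[of "j mod n"] e[of "j mod n"] \<alpha>(1)[of "j mod n"] n by fastforce
        then show ?thesis unfolding clip_def by auto
      qed
      then have "F \<alpha> i \<le> F (\<lambda>j. x j - e) i" unfolding F_def using clip_range clip_R by (intro step_mono) auto
      then show ?thesis using F_\<alpha>[of i] by linarith
    qed
  qed (use n \<open>R > 0\<close> \<open>e > 0\<close> F_\<alpha> in auto)
  then obtain x where x: "\<And>i. i < n \<Longrightarrow> F x i = x i" and x1: "\<exists>i<n. \<beta>\<^sub>1 i < x i" and x2: "\<exists>i<n. x i < 2 * \<alpha> i" by blast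
  have "\<exists>y. \<forall>i<n. F y i = y i \<and> 4 * \<alpha> i \<le> y i"
    by (rule increasing_iteration_fixed_point[where b = R]) (use F_mono F_cont F_R F_4\<alpha> in auto)
  then obtain y where y: "\<And>i. i < n \<Longrightarrow> F y i = y i" and y1: "\<And>i. i < n \<Longrightarrow> 4 * \<alpha> i \<le> y i" by blast
  have cl: "clip w i = w i" if "\<And>i. i < n \<Longrightarrow> F w i = w i" "i < n" for w i
    using that(1)[OF that(2)] F_nonneg[of w i] F_less[of w i] that(2) by (simp add: clip_def)
  have "4 * \<alpha> j \<le> clip y j" for j
  proof -
    have "4 * \<alpha> (j mod n) \<le> clip y (j mod n)" using y1[of "j mod n"] cl[OF y, of "j mod n"] n by simp
    then show ?thesis
      using periodic_mod[of \<alpha> n j, OF per(1)] periodic_mod[of "clip y" n j, OF clip_per] by simp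
  qed
  moreover have "\<exists>j. \<beta>\<^sub>1 j < clip x j" "\<exists>j. clip x j < 2 * \<alpha> j" using x1 x2 cl[OF x] by metis+
  ultimately show ?thesis
    using sol[OF x] sol[OF y] unfolding res_def by blast
qed

section \<open>Grid barriers\<close>

lemma grid_operator_alt:
  assumes "h > 0"
  shows "grid_operator h c x j = (x (Suc (Suc j)) - x (Suc j)) / h - (1 - c * h) * ((x (Suc j) - x j) / h)"
  unfolding grid_operator_def using assms by (simp add: field_simps)

lemma growth_factor_bounds:
  assumes "h > 0" "\<bar>c\<bar> * h \<le> 1 / 2" "i \<le> n"
  shows "exp (- 2 * \<bar>c\<bar> * (real n * h)) \<le> (1 - c * h) ^ i" "(1 - c * h) ^ i \<le> exp (\<bar>c\<bar> * (real n * h))"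
proof -
  let ?y = "\<bar>c\<bar> * h"
  have y: "0 \<le> ?y" "?y \<le> 1 / 2" using assms by auto
  have ch: "c * h \<le> ?y" by (rule mult_right_mono) (use assms(1) in auto)
  have "(- c) * h \<le> ?y" by (rule mult_right_mono) (use assms(1) in auto)
  then have ch': "- (c * h) \<le> ?y" by simp
  have "exp (- 2 * ?y) \<le> 1 - ?y"
  proof -
    have "- ?y - 2 * ?y\<^sup>2 \<le> ln (1 - ?y)" by (rule ln_one_minus_pos_lower_bound[OF y])
    moreover have "2 * ?y\<^sup>2 \<le> ?y" using y mult_left_mono[of ?y "1/2" ?y] by (simp add: power2_eq_square)
    ultimately have "- 2 * ?y \<le> ln (1 - ?y)" by linarith
    then show ?thesis using y by (simp add: ln_ge_iff)
  qed
  then have low: "exp (- 2 * ?y) \<le> 1 - c * h" using ch by linarith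
  have high: "1 - c * h \<le> exp ?y" using exp_ge_add_one_self[of ?y] ch' by linarith
  have "exp (- 2 * \<bar>c\<bar> * (real n * h)) \<le> exp (- 2 * ?y) ^ i"
  proof -
    have "real i * ?y \<le> real n * ?y" using y assms(3) by (intro mult_right_mono) auto
    then have "- 2 * \<bar>c\<bar> * (real n * h) \<le> real i * (- 2 * ?y)" by (simp add: mult_ac)
    then show ?thesis unfolding exp_of_nat_mult[symmetric] exp_le_cancel_iff .
  qed
  also have "\<dots> \<le> (1 - c * h) ^ i" by (rule power_mono[OF low]) simp
  finally show "exp (- 2 * \<bar>c\<bar> * (real n * h)) \<le> (1 - c * h) ^ i" .
  have "(1 - c * h) ^ i \<le> exp ?y ^ i" by (rule power_mono[OF high]) (use ch y in linarith)
  also have "\<dots> \<le> exp (\<bar>c\<bar> * (real n * h))"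
  proof -
    have "real i * ?y \<le> real n * ?y" using y assms(3) by (intro mult_right_mono) auto
    then have "real i * ?y \<le> \<bar>c\<bar> * (real n * h)" by (simp add: mult_ac)
    then show ?thesis unfolding exp_of_nat_mult[symmetric] exp_le_cancel_iff .
  qed
  finally show "(1 - c * h) ^ i \<le> exp (\<bar>c\<bar> * (real n * h))" .
qed

text \<open>
  The flux of \<open>w\<close> is \<open>\<kappa> - S\<close> with \<open>S\<close> the partial sums of \<open>f\<close>, so \<open>w\<close> solves a first order recursion.  Start it at
  \<open>0\<close>; the constant \<open>\<kappa>\<close>, a weighted mean of \<open>S\<close>, makes it return to \<open>0\<close> after a period.  This works for every
  sign of \<open>c\<close>, and also for \<open>c = 0\<close>.
\<close>
lemma grid_linear_problem:
  fixes f :: "nat \<Rightarrow> real"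
  assumes n: "n > 0" and h: "h > 0" and ch: "\<bar>c\<bar> * h \<le> 1 / 2"
    and fper: "\<And>j. f (j + n) = f j"
    and f0: "(\<Sum>i<n. f (Suc i)) = 0" and f1: "(\<Sum>i<n. \<bar>f (Suc i)\<bar>) \<le> \<Phi>"
  shows "\<exists>w. \<forall>j. w (j + n) = w j \<and> grid_operator h c w j = - f (Suc j) \<and>
      \<bar>w j\<bar> \<le> 2 * (real n * h) * exp (\<bar>c\<bar> * (real n * h)) * \<Phi>"
proof -
  define q where "q = 1 - c * h"
  define E where "E = exp (\<bar>c\<bar> * (real n * h))"
  have qE: "0 < q ^ i \<and> q ^ i \<le> E" if "i \<le> n" for i
    using growth_factor_bounds[OF h ch that] exp_gt_zero[of "- 2 * \<bar>c\<bar> * (real n * h)"]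
    unfolding q_def E_def by linarith
  have "\<Phi> \<ge> 0" using f1 by (rule order_trans[rotated]) (simp add: sum_nonneg)
  define S where "S k = (\<Sum>i<k. f (Suc i))" for k
  have Sper: "S (k + n) = S k" for k
  proof (induction k)
    case 0
    then show ?case using f0 by (simp add: S_def)
  next
    case (Suc k)
    then show ?case using fper[of "Suc k"] by (simp add: S_def)
  qed
  have S_small: "\<bar>S k\<bar> \<le> \<Phi>" if "k \<le> n" for k
  proof -
    have "\<bar>S k\<bar> \<le> (\<Sum>i<k. \<bar>f (Suc i)\<bar>)" unfolding S_def by (rule sum_abs)
    also have "\<dots> \<le> (\<Sum>i<n. \<bar>f (Suc i)\<bar>)" by (rule sum_mono2) (use that in auto)
    finally show ?thesis using f1 by linarith
  qed
  define P where "P = (\<Sum>k<n. q ^ (n - Suc k))"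
  have "P > 0" unfolding P_def using n qE by (intro sum_pos) auto
  define \<kappa> where "\<kappa> = (\<Sum>k<n. q ^ (n - Suc k) * S k) / P"
  have "\<bar>\<kappa>\<bar> \<le> \<Phi>"
  proof -
    have "\<bar>\<Sum>k<n. q ^ (n - Suc k) * S k\<bar> \<le> (\<Sum>k<n. q ^ (n - Suc k) * \<Phi>)"
    proof (rule order_trans[OF sum_abs sum_mono])
      fix k assume "k \<in> {..<n}"
      then show "\<bar>q ^ (n - Suc k) * S k\<bar> \<le> q ^ (n - Suc k) * \<Phi>"
        using qE[of "n - Suc k"] S_small[of k] unfolding abs_mult by (intro mult_mono) auto
    qed
    also have "\<dots> = \<Phi> * P" unfolding P_def sum_distrib_left by (rule sum.cong) (auto simp: mult.commute)
    finally show ?thesis using \<open>P > 0\<close> by (simp add: \<kappa>_def abs_divide pos_divide_le_eq)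
  qed
  define w where "w j = h * (\<Sum>k<j. q ^ (j - Suc k) * (\<kappa> - S k))" for j
  have rec: "w (Suc j) = q * w j + h * (\<kappa> - S j)" for j
  proof -
    have "(\<Sum>k<j. q ^ (Suc j - Suc k) * (\<kappa> - S k)) = q * (\<Sum>k<j. q ^ (j - Suc k) * (\<kappa> - S k))"
      unfolding sum_distrib_left
    proof (rule sum.cong[OF refl])
      fix k assume "k \<in> {..<j}"
      then have "Suc j - Suc k = Suc (j - Suc k)" by auto
      then show "q ^ (Suc j - Suc k) * (\<kappa> - S k) = q * (q ^ (j - Suc k) * (\<kappa> - S k))" by (simp only: power_Suc mult.assoc)
    qed
    then show ?thesis by (simp add: w_def algebra_simps)
  qed
  have "w n = h * (\<kappa> * P - (\<Sum>k<n. q ^ (n - Suc k) * S k))"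
    unfolding w_def P_def right_diff_distrib[of _ \<kappa>] sum_subtractf sum_distrib_left[of \<kappa>] by (simp add: mult.commute)
  then have "w n = 0" using \<open>P > 0\<close> by (simp add: \<kappa>_def)
  have wper: "w (j + n) = w j" for j
  proof (induction j)
    case 0
    then show ?case using \<open>w n = 0\<close> by (simp add: w_def)
  next
    case (Suc j)
    then show ?case using rec[of j] rec[of "j + n"] Sper[of j] by simp
  qed
  have "grid_operator h c w j = - f (Suc j)" for j
  proof -
    have *: "(w (Suc i) - w i) / h + c * w i = \<kappa> - S i" for i
      using rec[of i] h unfolding q_def by (simp add: field_simps)
    have "grid_operator h c w j = ((w (Suc (Suc j)) - w (Suc j)) / h + c * w (Suc j)) - ((w (Suc j) - w j) / h + c * w j)"
      unfolding grid_operator_def using h by (simp add: field_simps)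
    then show ?thesis unfolding * by (simp add: S_def)
  qed
  moreover have "\<bar>w j\<bar> \<le> 2 * (real n * h) * E * \<Phi>" for j
  proof -
    have "\<bar>w i\<bar> \<le> 2 * (real n * h) * E * \<Phi>" if "i < n" for i
    proof -
      have "\<bar>\<Sum>k<i. q ^ (i - Suc k) * (\<kappa> - S k)\<bar> \<le> (\<Sum>k<i. E * (2 * \<Phi>))"
      proof (rule order_trans[OF sum_abs sum_mono])
        fix k assume "k \<in> {..<i}"
        moreover have "i - Suc k \<le> n" using that by simp
        ultimately show "\<bar>q ^ (i - Suc k) * (\<kappa> - S k)\<bar> \<le> E * (2 * \<Phi>)"
          using qE[of "i - Suc k"] S_small[of k] \<open>\<bar>\<kappa>\<bar> \<le> \<Phi>\<close> that unfolding abs_mult by (intro mult_mono) auto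
      qed
      also have "\<dots> = real i * (E * (2 * \<Phi>))" by simp
      also have "\<dots> \<le> real n * (E * (2 * \<Phi>))"
        using that \<open>\<Phi> \<ge> 0\<close> by (intro mult_right_mono mult_nonneg_nonneg) (auto simp: E_def)
      finally have "h * \<bar>\<Sum>k<i. q ^ (i - Suc k) * (\<kappa> - S k)\<bar> \<le> h * (real n * (E * (2 * \<Phi>)))"
        using h by (intro mult_left_mono) auto
      then show ?thesis using h by (simp add: w_def abs_mult mult_ac)
    qed
    from this[of "j mod n"] show ?thesis using n periodic_mod[of w n j, OF wper] by simp
  qed
  ultimately show ?thesis using wper unfolding E_def by blast
qed

text \<open>
  The barrier is \<open>s + \<mu> \<sigma> w\<close>, where \<open>\<sigma>\<close> stands for \<open>g(s)\<close> and \<open>L w\<close> is minus the part of mean zero of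
  \<open>A + \<delta> \<bar>A\<bar>\<close>.  Its residual is at most \<open>\<mu> \<sigma> (\<delta> \<Sum>\<bar>A\<bar> - m) / n\<close>.
\<close>
lemma grid_supersolution:
  fixes A :: "nat \<Rightarrow> real"
  assumes n: "n > 0" and h: "h > 0" and ch: "\<bar>c\<bar> * h \<le> 1 / 2"
    and Aper: "\<And>j. A (j + n) = A j"
    and A0: "(\<Sum>i<n. A (Suc i)) = - m" and A1: "(\<Sum>i<n. \<bar>A (Suc i)\<bar>) \<le> L"
    and \<delta>: "\<delta> > 0" "\<delta> * L < m" and "\<mu> > 0" "\<sigma> > 0"
  defines "W \<equiv> 2 * (real n * h) * exp (\<bar>c\<bar> * (real n * h)) * (4 * L)"
  assumes flat: "\<And>b. \<bar>b - s\<bar> \<le> \<mu> * \<sigma> * W \<Longrightarrow> \<bar>g b - \<sigma>\<bar> \<le> \<delta> * \<sigma>"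
  shows "\<exists>\<beta>. \<forall>j. \<beta> (j + n) = \<beta> j \<and> \<bar>\<beta> j - s\<bar> \<le> \<mu> * \<sigma> * W \<and>
      grid_operator h c \<beta> j + \<mu> * A (Suc j) * g (\<beta> (Suc j)) < 0"
proof -
  define L' where "L' = (\<Sum>i<n. \<bar>A (Suc i)\<bar>)"
  define f where "f j = A j + m / real n + \<delta> * \<bar>A j\<bar> - \<delta> * L' / real n" for j
  have L': "0 \<le> L'" "L' \<le> L" using A1 by (simp_all add: L'_def sum_nonneg)
  have "m \<le> L'" using sum_abs[of "\<lambda>i. A (Suc i)" "{..<n}"] A0 by (simp add: L'_def)
  have dL: "\<delta> * L' \<le> \<delta> * L" using L' \<delta> by (intro mult_left_mono) auto
  have "m > 0" using dL \<delta> L' mult_nonneg_nonneg[of \<delta> L'] by linarith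
  have tri: "\<bar>x1 + x2 + x3 - x4\<bar> \<le> \<bar>x1\<bar> + x2 + x3 + x4" if "0 \<le> x2" "0 \<le> x3" "0 \<le> x4" for x1 x2 x3 x4 :: real
    using that by linarith
  have "\<exists>w. \<forall>j. w (j + n) = w j \<and> grid_operator h c w j = - f (Suc j) \<and> \<bar>w j\<bar> \<le> W"
    unfolding W_def
  proof (rule grid_linear_problem[OF n h ch])
    show "f (j + n) = f j" for j by (simp add: f_def Aper)
    show "(\<Sum>i<n. f (Suc i)) = 0"
      using n A0 unfolding f_def by (simp add: sum.distrib sum_subtractf sum_distrib_left[symmetric] L'_def[symmetric])
    have "(\<Sum>i<n. \<bar>f (Suc i)\<bar>) \<le> (\<Sum>i<n. \<bar>A (Suc i)\<bar> + m / real n + \<delta> * \<bar>A (Suc i)\<bar> + \<delta> * L' / real n)"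
    proof (rule sum_mono)
      fix i
      have "0 \<le> m / real n" "0 \<le> \<delta> * \<bar>A (Suc i)\<bar>" "0 \<le> \<delta> * L' / real n"
        using \<open>m > 0\<close> \<delta> L' by auto
      then show "\<bar>f (Suc i)\<bar> \<le> \<bar>A (Suc i)\<bar> + m / real n + \<delta> * \<bar>A (Suc i)\<bar> + \<delta> * L' / real n"
        unfolding f_def using tri by blast
    qed
    also have "\<dots> = L' + m + \<delta> * L' + \<delta> * L'"
      using n by (simp add: sum.distrib sum_distrib_left[symmetric] L'_def[symmetric])
    also have "\<dots> \<le> 4 * L" using dL \<delta>(2) \<open>m \<le> L'\<close> L' by linarith
    finally show "(\<Sum>i<n. \<bar>f (Suc i)\<bar>) \<le> 4 * L" .
  qed
  then obtain w where wper: "\<And>j. w (j + n) = w j" and Lw: "\<And>j. grid_operator h c w j = - f (Suc j)"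
    and wW: "\<And>j. \<bar>w j\<bar> \<le> W" by blast
  define \<beta> where "\<beta> j = s + \<mu> * \<sigma> * w j" for j
  have near: "\<bar>\<beta> j - s\<bar> \<le> \<mu> * \<sigma> * W" for j
    using wW[of j] \<open>\<mu> > 0\<close> \<open>\<sigma> > 0\<close> by (simp add: \<beta>_def abs_mult)
  have "grid_operator h c \<beta> j + \<mu> * A (Suc j) * g (\<beta> (Suc j)) < 0" for j
  proof -
    let ?A = "A (Suc j)" and ?g = "g (\<beta> (Suc j))"
    have "grid_operator h c \<beta> j = (\<mu> * \<sigma>) * grid_operator h c w j"
      unfolding grid_operator_def \<beta>_def using h by (simp add: field_simps)
    also have "\<dots> = \<mu> * (\<sigma> * (- f (Suc j)))" unfolding Lw by simp
    finally have "grid_operator h c \<beta> j + \<mu> * ?A * ?g = \<mu> * (\<sigma> * (- f (Suc j)) + ?A * ?g)"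
      by (simp add: algebra_simps)
    also have "\<sigma> * (- f (Suc j)) + ?A * ?g = ?A * (?g - \<sigma>) - \<bar>?A\<bar> * (\<delta> * \<sigma>) - \<sigma> * ((m - \<delta> * L') / real n)"
      by (simp add: f_def algebra_simps diff_divide_distrib)
    also have "\<mu> * \<dots> < 0"
    proof (rule mult_pos_neg[OF \<open>\<mu> > 0\<close>])
      have "\<bar>?g - \<sigma>\<bar> \<le> \<delta> * \<sigma>" by (rule flat[OF near])
      then have "\<bar>?A\<bar> * \<bar>?g - \<sigma>\<bar> \<le> \<bar>?A\<bar> * (\<delta> * \<sigma>)" by (rule mult_left_mono) auto
      then have "?A * (?g - \<sigma>) \<le> \<bar>?A\<bar> * (\<delta> * \<sigma>)" unfolding abs_mult[symmetric] by linarith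
      moreover have "0 < \<sigma> * ((m - \<delta> * L') / real n)"
        using dL \<delta>(2) n \<open>\<sigma> > 0\<close> by (intro mult_pos_pos divide_pos_pos) auto
      ultimately show "?A * (?g - \<sigma>) - \<bar>?A\<bar> * (\<delta> * \<sigma>) - \<sigma> * ((m - \<delta> * L') / real n) < 0" by linarith
    qed
    finally show ?thesis .
  qed
  then show ?thesis using wper near by (intro exI[of _ \<beta>]) (auto simp: \<beta>_def)
qed

text \<open>
  In the scale \<open>X\<close>, whose slopes are annihilated by the difference operator, the tent with vertex \<open>s\<close> and support
  \<open>[p, r]\<close> is a Green's function: the operator sends it to a negative point mass at \<open>s\<close>, apart from nonnegative
  contributions at \<open>p\<close> and \<open>r\<close>.  \<open>\<psi>\<close> is the superposition of the tents with vertices in \<open>S\<close> and weights \<open>A\<close>.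
\<close>
lemma grid_subsolution:
  fixes A :: "nat \<Rightarrow> real"
  assumes h: "h > 0" and ch: "\<bar>c\<bar> * h \<le> 1 / 2"
    and pr: "r \<le> n" and S: "S \<subseteq> {p<..<r}"
    and Apos: "\<And>j. p < j \<Longrightarrow> j < r \<Longrightarrow> 0 \<le> A j" and Aper: "\<And>j. A (j + n) = A j"
    and gap: "\<And>s. s \<in> S \<Longrightarrow> \<gamma> \<le> h * (real s - real p) \<and> \<gamma> \<le> h * (real r - real s)" "\<gamma> > 0"
    and mass: "m\<^sub>0 \<le> (\<Sum>s\<in>S. A s)" "(\<Sum>s\<in>S. A s) \<le> L" "m\<^sub>0 > 0"
  defines "E \<equiv> exp (\<bar>c\<bar> * (real n * h))" and "e \<equiv> exp (- 2 * \<bar>c\<bar> * (real n * h))"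
  shows "\<exists>\<psi>. (\<forall>j. \<psi> (j + n) = \<psi> j \<and> 0 \<le> \<psi> j \<and> \<psi> j \<le> L * (E * (real n * h))\<^sup>2) \<and>
      (\<exists>j. m\<^sub>0 * (e * \<gamma>)\<^sup>2 \<le> \<psi> j) \<and>
      (\<forall>j. (0 \<le> grid_operator h c \<psi> j \<and> (\<psi> (Suc j) = 0 \<or> 0 \<le> A (Suc j))) \<or>
         (0 \<le> A (Suc j) \<and> m\<^sub>0 * (e * \<gamma>)\<^sup>2 \<le> \<psi> (Suc j) \<and>
            - (E * (E * (real n * h)) * A (Suc j)) \<le> grid_operator h c \<psi> j))"
proof -
  define q where "q = 1 - c * h"
  have qb: "e \<le> q ^ i" "q ^ i \<le> E" if "i \<le> n" for i
    using growth_factor_bounds[OF h ch that] unfolding q_def E_def e_def by auto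
  have "e > 0" "E > 0" by (simp_all add: e_def E_def)
  have "c * h \<le> \<bar>c\<bar> * h" by (rule mult_right_mono) (use h in auto)
  then have q0: "0 \<le> q" using ch unfolding q_def by linarith
  define X where "X j = h * (\<Sum>k<j. q ^ k)" for j
  have X_Suc: "X (Suc j) = X j + h * q ^ j" for j by (simp add: X_def algebra_simps)
  have X_diff: "X j - X i = h * (\<Sum>k=i..<j. q ^ k)" if "i \<le> j" for i j
    using sum.atLeastLessThan_concat[of 0 i j "\<lambda>k. q ^ k", symmetric] that
    unfolding X_def lessThan_atLeast0 by (simp add: distrib_left)
  have X_low: "e * (h * (real j - real i)) \<le> X j - X i" if "i \<le> j" "j \<le> n" for i j
  proof -
    have "(\<Sum>k=i..<j. e) \<le> (\<Sum>k=i..<j. q ^ k)" by (rule sum_mono) (use qb that in auto)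
    then have "h * (\<Sum>k=i..<j. e) \<le> X j - X i" unfolding X_diff[OF that(1)] using h by (intro mult_left_mono) auto
    then show ?thesis using that by (simp add: of_nat_diff mult_ac)
  qed
  have X_high: "X j - X i \<le> E * (real n * h)" if "i \<le> j" "j \<le> n" for i j
  proof -
    have "(\<Sum>k=i..<j. q ^ k) \<le> (\<Sum>k=i..<j. E)" by (rule sum_mono) (use qb that in auto)
    also have "\<dots> \<le> real n * E" using that \<open>E > 0\<close> by (auto intro!: mult_right_mono)
    finally have "h * (\<Sum>k=i..<j. q ^ k) \<le> h * (real n * E)" using h by (intro mult_left_mono) auto
    then show ?thesis unfolding X_diff[OF that(1)] by (simp add: mult_ac)
  qed
  have X_mono: "X i \<le> X j" if "i \<le> j" for i j
    using X_diff[OF that] h q0 by (smt (verit) mult_nonneg_nonneg sum_nonneg zero_le_power)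
  define tent where "tent s i = (if i \<le> s then max 0 (X i - X p) * (X r - X s) else (X s - X p) * max 0 (X r - X i))" for s i
  have sS: "p < s \<and> s < r" if "s \<in> S" for s using S that by auto
  have tent_nonneg: "0 \<le> tent s i" if "s \<in> S" for s i
    using sS[OF that] X_mono[of p s] X_mono[of s r] by (auto simp: tent_def)
  have tent_zero: "tent s i = 0" if "s \<in> S" "i \<le> p \<or> r \<le> i" for s i
    using sS[OF that(1)] that(2) X_mono[of i p] X_mono[of r i] by (auto simp: tent_def)
  have tent_high: "tent s i \<le> (E * (real n * h))\<^sup>2" if "s \<in> S" "i \<le> n" for s i
  proof (cases "p < i \<and> i < r")
    case True
    then have X: "0 \<le> X i - X p" "0 \<le> X r - X i" using X_mono[of p i] X_mono[of i r] by auto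
    have X': "0 \<le> X s - X p" "0 \<le> X r - X s" using X_mono[of p s] X_mono[of s r] sS[OF that(1)] by auto
    show ?thesis
      unfolding tent_def power2_eq_square using X X' X_high[of p i] X_high[of s r] X_high[of p s] X_high[of i r] sS[OF that(1)] True pr
      by (auto intro!: mult_mono)
  next
    case False
    then have "tent s i = 0" using tent_zero[OF that(1)] by auto
    then show ?thesis by simp
  qed
  have tent_low: "(e * \<gamma>)\<^sup>2 \<le> tent s i" if "s \<in> S" "i \<in> S" for s i
  proof -
    have *: "e * \<gamma> \<le> X s - X p" "e * \<gamma> \<le> X r - X s" if "s \<in> S" for s
    proof -
      have "e * \<gamma> \<le> e * (h * (real s - real p))" "e * \<gamma> \<le> e * (h * (real r - real s))"
        using gap(1)[OF that] \<open>e > 0\<close> by (auto intro!: mult_left_mono)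
      then show "e * \<gamma> \<le> X s - X p" "e * \<gamma> \<le> X r - X s"
        using X_low[of p s] X_low[of s r] sS[OF that] pr by auto
    qed
    have "0 < e * \<gamma>" using \<open>e > 0\<close> gap(2) by simp
    then show ?thesis
      unfolding tent_def power2_eq_square using *[OF that(1)] *[OF that(2)] by (auto intro!: mult_mono)
  qed
  have tent_op: "(tent s (Suc (Suc i)) - tent s (Suc i)) / h - q * ((tent s (Suc i) - tent s i) / h) =
      (if Suc i = s then - (q ^ Suc i * (X r - X p)) else 0)" if s: "s \<in> S" and i: "p < Suc i" "Suc i < r" for s i
  proof -
    have ps: "p < s" "s < r" using sS[OF s] by auto
    have X: "X p \<le> X i" "X p \<le> X (Suc i)" "X p \<le> X (Suc (Suc i))" "X i \<le> X r" "X (Suc i) \<le> X r" "X (Suc (Suc i)) \<le> X r"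
      by (rule X_mono; use i in simp)+
    have d1: "(X (Suc (Suc i)) - X (Suc i)) / h = q ^ Suc i" "(X (Suc i) - X i) / h = q ^ i"
      using X_Suc[of i] X_Suc[of "Suc i"] h by auto
    consider "Suc i < s" | "Suc i = s" | "s < Suc i" by linarith
    then show ?thesis
    proof cases
      case 1
      then have "tent s (Suc (Suc i)) - tent s (Suc i) = (X (Suc (Suc i)) - X (Suc i)) * (X r - X s)"
        "tent s (Suc i) - tent s i = (X (Suc i) - X i) * (X r - X s)"
        using X by (simp_all add: tent_def algebra_simps)
      then show ?thesis using 1 X_Suc[of i] X_Suc[of "Suc i"] h by simp
    next
      case 2
      then have "tent s (Suc (Suc i)) - tent s (Suc i) = - ((X (Suc (Suc i)) - X (Suc i)) * (X s - X p))"
        "tent s (Suc i) - tent s i = (X (Suc i) - X i) * (X r - X s)"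
        using X by (simp_all add: tent_def algebra_simps)
      then have e1: "(tent s (Suc (Suc i)) - tent s (Suc i)) / h = - (q ^ Suc i * (X s - X p))"
        and e2: "(tent s (Suc i) - tent s i) / h = q ^ i * (X r - X s)"
        unfolding d1[symmetric] by simp_all
      have "- (q ^ Suc i * (X s - X p)) - q * (q ^ i * (X r - X s)) = - (q ^ Suc i * (X r - X p))"
        by (simp add: algebra_simps)
      then show ?thesis unfolding e1 e2 using 2 by simp
    next
      case 3
      then have "tent s (Suc (Suc i)) - tent s (Suc i) = - ((X (Suc (Suc i)) - X (Suc i)) * (X s - X p))"
        using X by (simp add: tent_def algebra_simps)
      moreover have "tent s (Suc i) - tent s i = - ((X (Suc i) - X i) * (X s - X p))"
      proof (cases "i = s")
        case True
        then show ?thesis using X by (simp add: tent_def algebra_simps)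
      next
        case False
        then show ?thesis using 3 X by (simp add: tent_def algebra_simps)
      qed
      ultimately show ?thesis using 3 X_Suc[of i] X_Suc[of "Suc i"] h by simp
    qed
  qed
  have "finite S" using S finite_subset by blast
  have A_S: "0 \<le> A s" if "s \<in> S" for s using Apos sS[OF that] by blast
  define \<psi>0 where "\<psi>0 i = (\<Sum>s\<in>S. A s * tent s i)" for i
  have \<psi>0_nonneg: "0 \<le> \<psi>0 i" for i unfolding \<psi>0_def by (intro sum_nonneg mult_nonneg_nonneg A_S tent_nonneg)
  have \<psi>0_zero: "\<psi>0 i = 0" if "i \<le> p \<or> r \<le> i" for i unfolding \<psi>0_def using tent_zero[OF _ that] by simp
  have \<psi>0_high: "\<psi>0 i \<le> L * (E * (real n * h))\<^sup>2" if "i \<le> n" for i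
  proof -
    have "\<psi>0 i \<le> (\<Sum>s\<in>S. A s * (E * (real n * h))\<^sup>2)"
      unfolding \<psi>0_def by (intro sum_mono mult_left_mono tent_high A_S that)
    also have "\<dots> \<le> L * (E * (real n * h))\<^sup>2"
      unfolding sum_distrib_right[symmetric] using mass by (intro mult_right_mono) auto
    finally show ?thesis .
  qed
  have \<psi>0_low: "m\<^sub>0 * (e * \<gamma>)\<^sup>2 \<le> \<psi>0 i" if "i \<in> S" for i
  proof -
    have "m\<^sub>0 * (e * \<gamma>)\<^sup>2 \<le> (\<Sum>s\<in>S. A s) * (e * \<gamma>)\<^sup>2" using mass by (intro mult_right_mono) auto
    also have "\<dots> \<le> \<psi>0 i" unfolding \<psi>0_def sum_distrib_right by (intro sum_mono mult_left_mono tent_low A_S that)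
    finally show ?thesis .
  qed
  have \<psi>0_op: "grid_operator h c \<psi>0 i = (if Suc i \<in> S then - (A (Suc i) * (q ^ Suc i * (X r - X p))) else 0)"
    if "p < Suc i" "Suc i < r" for i
  proof -
    have "grid_operator h c \<psi>0 i =
        (\<Sum>s\<in>S. A s * ((tent s (Suc (Suc i)) - tent s (Suc i)) / h - q * ((tent s (Suc i) - tent s i) / h)))"
      unfolding grid_operator_alt[OF h] \<psi>0_def q_def[symmetric]
      by (simp add: sum_subtractf[symmetric] sum_divide_distrib sum_distrib_left right_diff_distrib diff_divide_distrib mult_ac)
    also have "\<dots> = (\<Sum>s\<in>S. if Suc i = s then - (A s * (q ^ Suc i * (X r - X p))) else 0)"
      by (rule sum.cong[OF refl]) (use tent_op that in auto)
    also have "\<dots> = (if Suc i \<in> S then - (A (Suc i) * (q ^ Suc i * (X r - X p))) else 0)"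
      using \<open>finite S\<close> by simp
    finally show ?thesis .
  qed
  obtain s0 where "s0 \<in> S" using mass by fastforce
  then have n: "0 < n" "p < r" using sS[of s0] pr by auto
  define \<psi> where "\<psi> j = \<psi>0 (j mod n)" for j
  have "\<exists>j. m\<^sub>0 * (e * \<gamma>)\<^sup>2 \<le> \<psi> j"
    using \<psi>0_low[OF \<open>s0 \<in> S\<close>] sS[OF \<open>s0 \<in> S\<close>] pr by (intro exI[of _ s0]) (simp add: \<psi>_def)
  moreover have "(0 \<le> grid_operator h c \<psi> j \<and> (\<psi> (Suc j) = 0 \<or> 0 \<le> A (Suc j))) \<or>
         (0 \<le> A (Suc j) \<and> m\<^sub>0 * (e * \<gamma>)\<^sup>2 \<le> \<psi> (Suc j) \<and>
            - (E * (E * (real n * h)) * A (Suc j)) \<le> grid_operator h c \<psi> j)" for j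
  proof (cases "p < Suc j mod n \<and> Suc j mod n < r")
    case False
    then have z: "\<psi> (Suc j) = 0" using \<psi>0_zero by (auto simp: \<psi>_def)
    have "0 \<le> q * (\<psi> j / h)" "0 \<le> \<psi> (Suc (Suc j)) / h" using q0 h \<psi>0_nonneg by (auto simp: \<psi>_def)
    then have "0 \<le> grid_operator h c \<psi> j" unfolding grid_operator_alt[OF h] q_def[symmetric] z by simp
    with z show ?thesis by blast
  next
    case True
    define i where "i = j mod n"
    have i: "Suc j mod n = Suc i" using True unfolding i_def by (auto simp: mod_Suc split: if_splits)
    have "i < n" "Suc i < n" using n True i pr by (auto simp: i_def)
    have "\<psi> (Suc (Suc j)) = \<psi>0 (Suc (Suc i))"
    proof (cases "Suc (Suc i) = n")
      case True
      then have "Suc (Suc j) mod n = 0" using i by (simp add: mod_Suc)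
      moreover have "\<psi>0 0 = 0" "\<psi>0 n = 0" using \<psi>0_zero pr by auto
      ultimately show ?thesis using True by (simp add: \<psi>_def)
    next
      case False
      then have "Suc (Suc j) mod n = Suc (Suc i)" using i by (simp add: mod_Suc)
      then show ?thesis by (simp add: \<psi>_def)
    qed
    moreover have "\<psi> (Suc j) = \<psi>0 (Suc i)" "\<psi> j = \<psi>0 i" using i by (simp_all add: \<psi>_def i_def)
    ultimately have op: "grid_operator h c \<psi> j = grid_operator h c \<psi>0 i" by (simp add: grid_operator_def)
    have AA: "A (Suc j) = A (Suc i)" using periodic_mod[of A n "Suc j", OF Aper] i by simp
    have pi: "p < Suc i" "Suc i < r" using True i by auto
    have A0: "0 \<le> A (Suc j)" unfolding AA by (rule Apos[OF pi])
    show ?thesis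
    proof (cases "Suc i \<in> S")
      case False
      then show ?thesis using op \<psi>0_op[OF pi] A0 by simp
    next
      case True
      have "q ^ Suc i * (X r - X p) \<le> E * (E * (real n * h))"
        using qb[of "Suc i"] \<open>Suc i < n\<close> X_high[of p r] X_mono[of p r] n pr \<open>E > 0\<close> by (intro mult_mono) auto
      then have "A (Suc i) * (q ^ Suc i * (X r - X p)) \<le> A (Suc i) * (E * (E * (real n * h)))"
        using A0 unfolding AA by (rule mult_left_mono)
      then have "- (E * (E * (real n * h)) * A (Suc j)) \<le> grid_operator h c \<psi> j"
        unfolding op \<psi>0_op[OF pi] AA using True by (simp add: mult_ac)
      moreover have "m\<^sub>0 * (e * \<gamma>)\<^sup>2 \<le> \<psi> (Suc j)" using \<psi>0_low[OF True] i by (simp add: \<psi>_def)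
      ultimately show ?thesis using A0 by blast
    qed
  qed
  moreover have "\<psi> (j + n) = \<psi> j \<and> 0 \<le> \<psi> j \<and> \<psi> j \<le> L * (E * (real n * h))\<^sup>2" for j
    using \<psi>0_nonneg \<psi>0_high[of "j mod n"] n by (simp add: \<psi>_def less_imp_le)
  ultimately show ?thesis by blast
qed

section \<open>Growth of the nonlinearity and the mass of the weight\<close>

lemma flat_of_small_derivative:
  fixes g :: "real \<Rightarrow> real"
  assumes s: "s > 0" and gs: "0 \<le> g s" and small: "\<kappa> * g s \<le> s / 2" and "\<kappa> > 0" "\<delta> > 0"
    and deriv: "\<And>b. s / 2 \<le> b \<Longrightarrow> b \<le> 2 * s \<Longrightarrow> (g has_real_derivative g' b) (at b)"
    and g': "\<And>b. s / 2 \<le> b \<Longrightarrow> b \<le> 2 * s \<Longrightarrow> \<bar>g' b\<bar> \<le> \<delta> / \<kappa>"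
    and b: "\<bar>b - s\<bar> \<le> \<kappa> * g s"
  shows "\<bar>g b - g s\<bar> \<le> \<delta> * g s"
proof -
  have bs: "s / 2 \<le> b" "b \<le> 2 * s" using b small s by auto
  have "\<bar>g b - g s\<bar> \<le> \<delta> / \<kappa> * \<bar>b - s\<bar>"
  proof (rule field_differentiable_bound[of "{s / 2..2 * s}" g g' "\<delta> / \<kappa>" b s, unfolded real_norm_def])
    fix z assume "z \<in> {s / 2..2 * s}"
    then show "(g has_field_derivative g' z) (at z within {s / 2..2 * s})" "\<bar>g' z\<bar> \<le> \<delta> / \<kappa>"
      using deriv g' by (auto intro: has_field_derivative_at_within)
  qed (use bs s in auto)
  also have "\<dots> \<le> \<delta> / \<kappa> * (\<kappa> * g s)" using b \<open>\<kappa> > 0\<close> \<open>\<delta> > 0\<close> by (intro mult_left_mono) auto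
  also have "\<dots> = \<delta> * g s" using \<open>\<kappa> > 0\<close> by simp
  finally show ?thesis .
qed

text \<open>
  Arbitrarily small \<open>s\<close> around which \<open>g\<close> is nearly constant on the scale \<open>\<kappa> g(s)\<close>.
\<close>
lemma flat_near_zero:
  fixes g :: "real \<Rightarrow> real"
  assumes g0: "g 0 = 0" and pos: "\<And>s. s > 0 \<Longrightarrow> g s > 0"
    and "\<epsilon>\<^sub>0 > 0" and C1: "cont_differentiable_within g {0..<\<epsilon>\<^sub>0}"
    and lim: "((\<lambda>s. g s / s) \<longlongrightarrow> 0) (at_right 0)"
    and "\<kappa> > 0" "\<delta> > 0" "\<rho> > 0"
  shows "\<exists>s>0. s < \<rho> \<and> \<kappa> * g s \<le> s / 2 \<and> (\<forall>b. \<bar>b - s\<bar> \<le> \<kappa> * g s \<longrightarrow> \<bar>g b - g s\<bar> \<le> \<delta> * g s)"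
proof -
  obtain g' where g': "\<And>x. x \<in> {0..<\<epsilon>\<^sub>0} \<Longrightarrow> (g has_real_derivative g' x) (at x within {0..<\<epsilon>\<^sub>0})"
    and cont: "continuous_on {0..<\<epsilon>\<^sub>0} g'"
    using C1 unfolding cont_differentiable_within_def by metis
  have der: "(g has_real_derivative g' x) (at x)" if "0 < x" "x < \<epsilon>\<^sub>0" for x
    using g'[of x] at_within_interior[of x "{0..<\<epsilon>\<^sub>0}"] that by (simp add: interior_atLeastLessThan)
  have "g' 0 = 0"
  proof -
    have "at (0::real) within {0..<\<epsilon>\<^sub>0} = at_right 0"
      using \<open>\<epsilon>\<^sub>0 > 0\<close> by (intro at_within_nhd[of 0 "{..<\<epsilon>\<^sub>0}"]) auto
    then have "((\<lambda>s. g s / s) \<longlongrightarrow> g' 0) (at_right 0)"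
      using g'[of 0] \<open>\<epsilon>\<^sub>0 > 0\<close> by (simp add: has_field_derivative_iff g0)
    from tendsto_unique[OF _ this lim] show ?thesis by simp
  qed
  have "\<delta> / \<kappa> > 0" using assms by simp
  then obtain d where "d > 0" and d: "\<And>x. x \<in> {0..<\<epsilon>\<^sub>0} \<Longrightarrow> \<bar>x\<bar> < d \<Longrightarrow> \<bar>g' x\<bar> < \<delta> / \<kappa>"
    using cont \<open>\<epsilon>\<^sub>0 > 0\<close> \<open>g' 0 = 0\<close> unfolding continuous_on_iff dist_real_def
    by (metis atLeastLessThan_iff diff_zero order_refl)
  have "\<forall>\<^sub>F s in at_right 0. g s / s < 1 / (2 * \<kappa>)"
    by (rule order_tendstoD(2)[OF lim]) (use \<open>\<kappa> > 0\<close> in simp)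
  then obtain e where "e > 0" and e: "\<And>s. 0 < s \<Longrightarrow> s < e \<Longrightarrow> g s / s < 1 / (2 * \<kappa>)"
    unfolding eventually_at_right_field by auto
  define s where "s = Min {\<rho>, e, d / 2, \<epsilon>\<^sub>0 / 2} / 2"
  have s: "s > 0" "s < \<rho>" "s < e" "2 * s < d" "2 * s < \<epsilon>\<^sub>0"
    using \<open>\<rho> > 0\<close> \<open>e > 0\<close> \<open>d > 0\<close> \<open>\<epsilon>\<^sub>0 > 0\<close> by (auto simp: s_def min_def)
  have small: "\<kappa> * g s \<le> s / 2"
    using e[OF s(1,3)] s(1) \<open>\<kappa> > 0\<close> by (simp add: field_simps)
  have "\<bar>g b - g s\<bar> \<le> \<delta> * g s" if "\<bar>b - s\<bar> \<le> \<kappa> * g s" for b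
  proof (rule flat_of_small_derivative[where g' = g' and g = g, OF s(1) _ small \<open>\<kappa> > 0\<close> \<open>\<delta> > 0\<close> _ _ that])
    show "0 \<le> g s" using pos[OF s(1)] by simp
    show "(g has_real_derivative g' b) (at b)" if "s / 2 \<le> b" "b \<le> 2 * s" for b
      using that s by (intro der) auto
    show "\<bar>g' b\<bar> \<le> \<delta> / \<kappa>" if "s / 2 \<le> b" "b \<le> 2 * s" for b
      using that s by (intro less_imp_le d) auto
  qed
  then show ?thesis using s small by blast
qed

text \<open>
  The same for arbitrarily large \<open>s\<close>; here \<open>g(s) = o(s)\<close> follows from \<open>g' \<rightarrow> 0\<close>.
\<close>
lemma flat_at_infinity:
  fixes g :: "real \<Rightarrow> real"
  assumes nonneg: "\<And>s. s \<ge> 0 \<Longrightarrow> g s \<ge> 0"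
    and "N > 0" and C1: "cont_differentiable_within g {N<..}"
    and lim: "((\<lambda>s. deriv g s) \<longlongrightarrow> 0) at_top"
    and "\<kappa> > 0" "\<delta> > 0"
  shows "\<exists>s>0. s > \<rho> \<and> \<kappa> * g s \<le> s / 2 \<and> (\<forall>b. \<bar>b - s\<bar> \<le> \<kappa> * g s \<longrightarrow> \<bar>g b - g s\<bar> \<le> \<delta> * g s)"
proof -
  have der: "(g has_real_derivative deriv g x) (at x)" if x: "x > N" for x
  proof -
    obtain g' where "(g has_real_derivative g' x) (at x within {N<..})"
      using C1 x by (auto simp: cont_differentiable_within_def)
    then have "(g has_real_derivative g' x) (at x)" using x by (simp add: at_within_open[of x "{N<..}"])
    then show ?thesis by (simp add: DERIV_imp_deriv)
  qed
  define \<eta> where "\<eta> = min (\<delta> / \<kappa>) (1 / (4 * \<kappa>))"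
  have "\<eta> > 0" using assms by (simp add: \<eta>_def)
  have "\<forall>\<^sub>F s in at_top. \<bar>deriv g s\<bar> < \<eta>"
    using tendstoD[OF lim \<open>\<eta> > 0\<close>] by (simp add: dist_real_def)
  then obtain M where M: "\<And>s. s \<ge> M \<Longrightarrow> \<bar>deriv g s\<bar> < \<eta>" by (auto simp: eventually_at_top_linorder)
  define s\<^sub>0 where "s\<^sub>0 = max M (N + 1)"
  have s0: "s\<^sub>0 \<ge> M" "s\<^sub>0 > N" "s\<^sub>0 > 0" using \<open>N > 0\<close> by (auto simp: s\<^sub>0_def)
  define s where "s = max (2 * s\<^sub>0) (max (\<rho> + 1) (4 * \<kappa> * g s\<^sub>0))"
  have s: "s \<ge> 2 * s\<^sub>0" "s > \<rho>" "4 * \<kappa> * g s\<^sub>0 \<le> s" "s > 0" using s0 by (auto simp: s_def)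
  have small: "\<kappa> * g s \<le> s / 2"
  proof -
    have "\<bar>g s - g s\<^sub>0\<bar> \<le> \<eta> * \<bar>s - s\<^sub>0\<bar>"
    proof (rule field_differentiable_bound[of "{s\<^sub>0..s}" g "deriv g" \<eta> s s\<^sub>0, unfolded real_norm_def])
      fix z assume "z \<in> {s\<^sub>0..s}"
      then show "(g has_field_derivative deriv g z) (at z within {s\<^sub>0..s})" "\<bar>deriv g z\<bar> \<le> \<eta>"
        using der[of z] M[of z] s0 by (auto intro: has_field_derivative_at_within less_imp_le)
    qed (use s s0 in auto)
    moreover have "\<eta> * \<bar>s - s\<^sub>0\<bar> \<le> 1 / (4 * \<kappa>) * s"
      using s s0 \<open>\<kappa> > 0\<close> by (intro mult_mono) (auto simp: \<eta>_def)
    ultimately have "g s \<le> g s\<^sub>0 + 1 / (4 * \<kappa>) * s" by linarith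
    then have "\<kappa> * g s \<le> \<kappa> * (g s\<^sub>0 + 1 / (4 * \<kappa>) * s)" using \<open>\<kappa> > 0\<close> by (intro mult_left_mono) auto
    also have "\<dots> = \<kappa> * g s\<^sub>0 + s / 4" using \<open>\<kappa> > 0\<close> by (simp add: field_simps)
    finally show ?thesis using s(3) by linarith
  qed
  have "\<bar>g b - g s\<bar> \<le> \<delta> * g s" if "\<bar>b - s\<bar> \<le> \<kappa> * g s" for b
  proof (rule flat_of_small_derivative[where g' = "deriv g" and g = g, OF s(4) _ small \<open>\<kappa> > 0\<close> \<open>\<delta> > 0\<close> _ _ that])
    show "0 \<le> g s" using nonneg s(4) by simp
    show "(g has_real_derivative deriv g b) (at b)" if "s / 2 \<le> b" for b
      using that s s0 by (intro der) auto
    show "\<bar>deriv g b\<bar> \<le> \<delta> / \<kappa>" if "s / 2 \<le> b" for b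
      using M[of b] that s s0 by (auto simp: \<eta>_def)
  qed
  then show ?thesis using s small by blast
qed

text \<open>
  Nonnegative functions vanishing at \<open>0\<close> that are Lipschitz on \<open>[0, R]\<close> and \<open>\<epsilon>\<close>-close to \<open>g\<close> there.  The Lipschitz
  constant is not controlled: it only enters the step size of the monotone map.
\<close>
definition lipschitz_approximant :: "(real \<Rightarrow> real) \<Rightarrow> real \<Rightarrow> real \<Rightarrow> (real \<Rightarrow> real) \<Rightarrow> bool" where
  "lipschitz_approximant g R \<epsilon> \<gamma> \<longleftrightarrow> \<gamma> 0 = 0 \<and> (\<forall>s. 0 \<le> \<gamma> s) \<and>
     (\<forall>s. 0 \<le> s \<and> s \<le> R \<longrightarrow> \<bar>\<gamma> s - g s\<bar> \<le> \<epsilon>) \<and>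
     (\<exists>K. \<forall>s t. 0 \<le> s \<and> s \<le> t \<and> t \<le> R \<longrightarrow> \<bar>\<gamma> t - \<gamma> s\<bar> \<le> K * (t - s))"

lemma lipschitz_approximant_exists:
  fixes g :: "real \<Rightarrow> real"
  assumes g: "continuous_on {0..R} g" and "R > 0" and g0: "g 0 = 0" and nonneg: "\<And>s. 0 \<le> s \<Longrightarrow> 0 \<le> g s"
    and "\<epsilon> > 0"
  shows "\<exists>\<gamma>. lipschitz_approximant g R \<epsilon> \<gamma>"
proof -
  obtain p where p: "real_polynomial_function p" and pg: "\<And>x. x \<in> {0..R} \<Longrightarrow> \<bar>g x - p x\<bar> < \<epsilon> / 2"
    using Stone_Weierstrass_real_polynomial_function[OF compact_Icc g half_gt_zero[OF \<open>\<epsilon> > 0\<close>]] by blast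
  obtain p' where p': "real_polynomial_function p'" and dp: "\<And>x. (p has_real_derivative p' x) (at x)"
    using has_real_derivative_polynomial_function[OF p] by blast
  have "continuous_on {0..R} p'" using continuous_on_polymonial_function[of p'] p' by (simp add: real_polynomial_function_eq)
  then have "bounded (p' ` {0..R})" by (intro compact_imp_bounded compact_continuous_image) auto
  then obtain K where K: "\<And>x. x \<in> {0..R} \<Longrightarrow> \<bar>p' x\<bar> \<le> K"
    unfolding bounded_iff real_norm_def by (meson imageI)
  define \<gamma> where "\<gamma> s = max 0 (p s - p 0)" for s
  have "\<bar>\<gamma> s - g s\<bar> \<le> \<epsilon>" if "0 \<le> s" "s \<le> R" for s
  proof -
    have "\<bar>g 0 - p 0\<bar> < \<epsilon> / 2" "\<bar>g s - p s\<bar> < \<epsilon> / 2" using pg that \<open>R > 0\<close> by simp_all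
    then show ?thesis using nonneg[OF that(1)] g0 unfolding \<gamma>_def by linarith
  qed
  moreover have "\<bar>\<gamma> t - \<gamma> s\<bar> \<le> K * (t - s)" if st: "0 \<le> s" "s \<le> t" "t \<le> R" for s t
  proof -
    have "\<bar>p t - p s\<bar> \<le> K * \<bar>t - s\<bar>"
      by (rule field_differentiable_bound[of "{0..R}" p p' K t s, unfolded real_norm_def])
         (use st K dp in \<open>auto intro: has_field_derivative_at_within\<close>)
    moreover have "\<bar>\<gamma> t - \<gamma> s\<bar> \<le> \<bar>p t - p s\<bar>" unfolding \<gamma>_def by linarith
    ultimately show ?thesis using st by simp
  qed
  ultimately show ?thesis unfolding lipschitz_approximant_def
    by (intro exI[of _ \<gamma>]) (auto simp: \<gamma>_def)
qed

lemma linear_bound: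
  fixes g :: "real \<Rightarrow> real"
  assumes g: "continuous_on {0..} g" and g0: "g 0 = 0" and nonneg: "\<And>s. 0 \<le> s \<Longrightarrow> 0 \<le> g s"
    and lim: "((\<lambda>s. g s / s) \<longlongrightarrow> 0) (at_right 0)"
  shows "\<exists>C\<ge>0. \<forall>s. 0 \<le> s \<and> s \<le> R \<longrightarrow> \<bar>g s\<bar> \<le> C * s"
proof -
  have "\<forall>\<^sub>F s in at_right 0. g s / s < 1" by (rule order_tendstoD(2)[OF lim]) simp
  then obtain e where "e > 0" and e: "\<And>s. 0 < s \<Longrightarrow> s < e \<Longrightarrow> g s / s < 1"
    unfolding eventually_at_right_field by auto
  have "bounded (g ` {0..R})"
    by (rule compact_imp_bounded[OF compact_continuous_image[OF continuous_on_subset[OF g]]]) auto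
  then obtain G where G: "\<And>s. s \<in> {0..R} \<Longrightarrow> \<bar>g s\<bar> \<le> G"
    unfolding bounded_iff real_norm_def by (meson imageI)
  have "\<bar>g s\<bar> \<le> (1 + \<bar>G\<bar> / e) * s" if s: "0 \<le> s" "s \<le> R" for s
  proof -
    consider "s = 0" | "0 < s" "s < e" | "e \<le> s" using s by linarith
    then show ?thesis
    proof cases
      case 1
      then show ?thesis by (simp add: g0)
    next
      case 2
      then have "g s \<le> 1 * s" using e[of s] by (simp add: field_simps)
      also have "\<dots> \<le> (1 + \<bar>G\<bar> / e) * s" using \<open>e > 0\<close> s by (intro mult_right_mono) auto
      finally show ?thesis using nonneg[OF s(1)] by simp
    next
      case 3
      have "\<bar>g s\<bar> \<le> \<bar>G\<bar> / e * e" using G[of s] s \<open>e > 0\<close> by simp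
      also have "\<dots> \<le> (1 + \<bar>G\<bar> / e) * s" using 3 \<open>e > 0\<close> s by (intro mult_mono) auto
      finally show ?thesis .
    qed
  qed
  then show ?thesis using \<open>e > 0\<close> by (intro exI[of _ "1 + \<bar>G\<bar> / e"]) auto
qed

lemma integral_nonneg_ae:
  fixes a :: "real \<Rightarrow> real"
  assumes "a integrable_on S" "negligible N" "\<And>t. t \<in> S - N \<Longrightarrow> 0 \<le> a t"
  shows "0 \<le> integral S a"
proof -
  have "integral S a = integral S (\<lambda>t. if t \<in> N then 0 else a t)"
    by (rule integral_spike[OF assms(2)]) auto
  also have "\<dots> \<ge> 0"
  proof (rule integral_nonneg)
    show "(\<lambda>t. if t \<in> N then 0 else a t) integrable_on S"
      by (rule integrable_spike[OF assms(1,2)]) auto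
  qed (use assms(3) in auto)
  finally show ?thesis .
qed

text \<open>
  Reduces the interval \<open>I\<close> to its end points \<open>l, r\<close>, and leaves a margin \<open>2 \<gamma>\<close> at both ends without losing all the mass.
\<close>
lemma positive_mass_core:
  fixes a :: "real \<Rightarrow> real"
  assumes "T > 0" and a: "locally_integrable a" and I: "is_interval I" "I \<subseteq> {0..T}"
    and ae: "AE t\<in>I in lebesgue. a t \<ge> 0" and mass: "(LINT t:I|lebesgue. a t) > 0"
  shows "\<exists>l r \<gamma>. 0 \<le> l \<and> r \<le> T \<and> \<gamma> > 0 \<and> l + 2 * \<gamma> < r - 2 * \<gamma> \<and>
     0 < integral {l + 2 * \<gamma>..r - 2 * \<gamma>} a \<and> (\<forall>x y. l \<le> x \<and> y \<le> r \<longrightarrow> 0 \<le> integral {x..y} a)"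
proof -
  have aa: "a absolutely_integrable_on {x..y}" for x y using a by (simp add: locally_integrable_def)
  have ai: "a integrable_on {x..y}" for x y using aa by (rule set_lebesgue_integral_eq_integral(1))
  have "I \<noteq> {}" using mass by (auto simp: set_lebesgue_integral_def)
  define l where "l = Inf I"
  define r where "r = Sup I"
  have bdd: "bdd_below I" "bdd_above I" using I(2) by (auto intro: bdd_below_mono bdd_above_mono)
  have lr: "0 \<le> l" "r \<le> T" unfolding l_def r_def using I(2) \<open>I \<noteq> {}\<close>
    by (auto intro!: cInf_greatest cSup_least)
  have I_sub: "I \<subseteq> {l..r}" unfolding l_def r_def using bdd by (auto intro: cInf_lower cSup_upper)
  have sub_I: "{l<..<r} \<subseteq> I"
  proof
    fix x assume "x \<in> {l<..<r}"
    then obtain y z where "y \<in> I" "y < x" "z \<in> I" "x < z"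
      unfolding l_def r_def using cInf_less_iff[OF \<open>I \<noteq> {}\<close> bdd(1)] less_cSup_iff[OF \<open>I \<noteq> {}\<close> bdd(2)] by auto
    then show "x \<in> I" using I(1) unfolding is_interval_1 by (meson less_imp_le)
  qed
  have Ieq: "I = {l<..<r} \<union> (I \<inter> {l, r})" using I_sub sub_I by (auto simp: less_le)
  have "{l<..<r} \<union> (I \<inter> {l, r}) \<in> sets lebesgue"
    by (intro sets.Un) (auto intro!: negligible_imp_sets negligible_finite)
  then have "I \<in> sets lebesgue" using Ieq by metis
  then have "a absolutely_integrable_on I" using set_integrable_subset[OF aa _ I_sub] by blast
  then have "0 < integral I a" using mass set_lebesgue_integral_eq_integral(2)[of I a] by simp
  also have "integral I a = integral {l..r} a"
  proof (rule integral_spike_set)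
    show "negligible {x \<in> I - {l..r}. a x \<noteq> 0}" using I_sub by (auto intro!: negligible_subset[OF negligible_empty])
    show "negligible {x \<in> {l..r} - I. a x \<noteq> 0}"
      by (rule negligible_subset[of "{l, r}"]) (use sub_I in \<open>auto simp: less_le\<close>)
  qed
  finally have pos: "0 < integral {l..r} a" .
  have "l < r"
  proof (rule ccontr)
    assume "\<not> l < r"
    then have "integral {l..r} a = 0" by (cases "r < l") auto
    then show False using pos by simp
  qed
  obtain N0 where N0: "N0 \<in> null_sets lebesgue" "{t \<in> space lebesgue. \<not> (t \<in> I \<longrightarrow> 0 \<le> a t)} \<subseteq> N0"
    using ae unfolding eventually_ae_filter by auto
  have neg: "negligible (N0 \<union> {l, r})"
    using N0(1) by (intro negligible_Un) (auto simp: negligible_iff_null_sets)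
  have nonneg: "0 \<le> integral {x..y} a" if "l \<le> x" "y \<le> r" for x y
  proof (rule integral_nonneg_ae[OF ai neg])
    fix t assume "t \<in> {x..y} - (N0 \<union> {l, r})"
    then have "t \<in> {l<..<r}" "t \<notin> N0" using that by auto
    then show "0 \<le> a t" using sub_I N0(2) by auto
  qed
  have "continuous_on {l..r} (\<lambda>t. integral {l..t} a)" by (rule indefinite_integral_continuous_1[OF ai])
  then have cont: "uniformly_continuous_on {l..r} (\<lambda>t. integral {l..t} a)" by (rule compact_uniformly_continuous) auto
  then obtain d where "d > 0" and d: "\<And>x y. x \<in> {l..r} \<Longrightarrow> y \<in> {l..r} \<Longrightarrow> \<bar>y - x\<bar> < d \<Longrightarrow>
      \<bar>integral {l..y} a - integral {l..x} a\<bar> < integral {l..r} a / 2"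
    using half_gt_zero[OF pos] unfolding uniformly_continuous_on_def dist_real_def by metis
  define \<gamma> where "\<gamma> = min (d / 4) ((r - l) / 8)"
  have \<gamma>: "\<gamma> > 0" "2 * \<gamma> < d" "l + 2 * \<gamma> < r - 2 * \<gamma>"
    using \<open>d > 0\<close> \<open>l < r\<close> by (auto simp: \<gamma>_def min_def field_simps)
  have "integral {l..l + 2 * \<gamma>} a + integral {l + 2 * \<gamma>..r - 2 * \<gamma>} a = integral {l..r - 2 * \<gamma>} a"
    using \<gamma> by (intro Henstock_Kurzweil_Integration.integral_combine ai) auto
  moreover have "\<bar>integral {l..l + 2 * \<gamma>} a - integral {l..l} a\<bar> < integral {l..r} a / 2"
    by (rule d) (use \<gamma> \<open>l < r\<close> in auto)
  moreover have "\<bar>integral {l..r} a - integral {l..r - 2 * \<gamma>} a\<bar> < integral {l..r} a / 2"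
    by (rule d) (use \<gamma> \<open>l < r\<close> in auto)
  moreover have "integral {l..l} a = 0" by simp
  ultimately have "0 < integral {l + 2 * \<gamma>..r - 2 * \<gamma>} a" by linarith
  then show ?thesis using lr \<gamma> nonneg by blast
qed

section \<open>Existence of separated pairs of grid solutions\<close>

lemma cell_integral_periodic:
  assumes a: "locally_integrable a" and aper: "\<And>t. a (t + T) = a t" and nh: "real n * h = T"
  shows "cell_integral a h (j + n) = cell_integral a h j"
proof -
  have ai: "a integrable_on {x..y}" for x y
    using a set_lebesgue_integral_eq_integral(1) unfolding locally_integrable_def by blast
  have "integral {(real j - 1) * h..real j * h} (\<lambda>t. a (t + T)) = integral {(real j - 1) * h + T..real j * h + T} a"
    by (rule integral_translate[OF ai])
  moreover have "(real j - 1) * h + T = (real (j + n) - 1) * h" "real j * h + T = real (j + n) * h"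
    by (simp_all add: nh[symmetric] algebra_simps)
  ultimately show ?thesis by (simp add: cell_integral_def aper)
qed

text \<open>
  Nodes \<open>p < k\<close> inside \<open>[l, r]\<close> and a set \<open>S\<close> of nodes between them, at distance at least \<open>\<gamma>\<close> from both, whose
  cells cover the core \<open>[l + 2 \<gamma>, r - 2 \<gamma>]\<close>.
\<close>
lemma grid_core:
  assumes a: "locally_integrable a" and nh: "real n * h = T" and h: "h > 0" "2 * h \<le> \<gamma>"
    and lr: "0 \<le> l" "r \<le> T" "l + 2 * \<gamma> < r - 2 * \<gamma>"
    and nonneg: "\<And>x y. l \<le> x \<Longrightarrow> y \<le> r \<Longrightarrow> 0 \<le> integral {x..y} a"
  shows "\<exists>p k S. k \<le> n \<and> S \<subseteq> {p<..<k} \<and> (\<forall>j. p < j \<and> j < k \<longrightarrow> 0 \<le> cell_integral a h j) \<and>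
     (\<forall>s\<in>S. \<gamma> \<le> h * (real s - real p) \<and> \<gamma> \<le> h * (real k - real s)) \<and>
     integral {l + 2 * \<gamma>..r - 2 * \<gamma>} a \<le> (\<Sum>s\<in>S. cell_integral a h s) \<and>
     (\<Sum>s\<in>S. cell_integral a h s) \<le> integral {0..T} (\<lambda>t. \<bar>a t\<bar>)"
proof -
  have ai: "a integrable_on {x..y}" for x y
    using a set_lebesgue_integral_eq_integral(1) unfolding locally_integrable_def by blast
  have "\<gamma> > 0" using h by linarith
  define up where "up x = nat \<lceil>x / h\<rceil>" for x
  define dn where "dn x = nat \<lfloor>x / h\<rfloor>" for x
  have up: "x \<le> real (up x) * h" "real (up x) * h < x + h" if "0 \<le> x" for x
  proof -
    have "real (up x) = of_int \<lceil>x / h\<rceil>" using that h by (simp add: up_def)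
    then have "x / h \<le> real (up x)" "real (up x) < x / h + 1" by linarith+
    then show "x \<le> real (up x) * h" "real (up x) * h < x + h" using h by (simp_all add: field_simps)
  qed
  have dn: "real (dn x) * h \<le> x" "x - h < real (dn x) * h" if "0 \<le> x" for x
  proof -
    have "real (dn x) = of_int \<lfloor>x / h\<rfloor>" using that h by (simp add: dn_def)
    then have "real (dn x) \<le> x / h" "x / h - 1 < real (dn x)" by linarith+
    then show "real (dn x) * h \<le> x" "x - h < real (dn x) * h" using h by (simp_all add: field_simps)
  qed
  define p where "p = up l"
  define k where "k = dn r"
  define s1 where "s1 = up (l + \<gamma>)"
  \<comment> \<open>the extra \<open>h\<close> compensates for rounding \<open>r\<close> down to the node \<open>k\<close>\<close>
  define s2 where "s2 = dn (r - \<gamma> - h)"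
  define S where "S = {s1<..s2}"
  have p: "l \<le> real p * h" "real p * h < l + h" unfolding p_def using up lr by auto
  have k: "real k * h \<le> r" "r - h < real k * h" unfolding k_def using dn[of r] lr \<open>\<gamma> > 0\<close> by auto
  have s1: "l + \<gamma> \<le> real s1 * h" "real s1 * h < l + \<gamma> + h" unfolding s1_def using up[of "l + \<gamma>"] lr \<open>\<gamma> > 0\<close> by auto
  have s2: "real s2 * h \<le> r - \<gamma> - h" "r - \<gamma> - h - h < real s2 * h"
    unfolding s2_def using dn[of "r - \<gamma> - h"] lr \<open>\<gamma> > 0\<close> h by auto
  have mono: "real i * h \<le> real j * h" if "i \<le> j" for i j using that h by (intro mult_right_mono) auto
  have less: "i < j" if "real i * h < real j * h" for i j using that h by (simp add: mult_less_cancel_right_pos)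
  have gaps: "\<gamma> \<le> h * (real s - real p) \<and> \<gamma> \<le> h * (real k - real s)" if "s \<in> S" for s
  proof -
    have s: "Suc s1 \<le> s" "s \<le> s2" using that by (auto simp: S_def)
    have "real s1 * h + h \<le> real s * h" using mono[OF s(1)] by (simp add: distrib_right)
    moreover have "real s * h \<le> real s2 * h" by (rule mono[OF s(2)])
    moreover have "h * (real s - real p) = real s * h - real p * h" "h * (real k - real s) = real k * h - real s * h"
      by (simp_all add: algebra_simps)
    ultimately show ?thesis using s1 s2 p k by linarith
  qed
  have "S \<subseteq> {p<..<k}"
  proof
    fix s assume "s \<in> S"
    then have "0 < h * (real s - real p)" "0 < h * (real k - real s)" using gaps[of s] \<open>\<gamma> > 0\<close> by linarith+
    then show "s \<in> {p<..<k}" using h by (simp add: zero_less_mult_iff)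
  qed
  moreover have "k \<le> n"
  proof -
    have "real k * h \<le> real n * h" using k lr nh by linarith
    then show ?thesis using h by (simp add: mult_le_cancel_right_pos)
  qed
  moreover have "0 \<le> cell_integral a h j" if j: "p < j" "j < k" for j
    unfolding cell_integral_def
  proof (rule nonneg)
    have "real (Suc p) * h \<le> real j * h" using j by (intro mono) auto
    then have "real p * h + h \<le> real j * h" by (simp add: distrib_right)
    then show "l \<le> (real j - 1) * h" using p by (simp add: algebra_simps)
    show "real j * h \<le> r" using mono[of j k] j k by linarith
  qed
  moreover have sum: "(\<Sum>s\<in>S. cell_integral a h s) = integral {real s1 * h..real s2 * h} a"
  proof -
    have s12: "s1 \<le> s2"
    proof -
      have "real s1 * h < real s2 * h" using s1 s2 lr h by linarith
      then show ?thesis using less by (simp add: less_imp_le)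
    qed
    have "S = Suc ` {s1..<s2}" unfolding S_def image_Suc_atLeastLessThan by auto
    then have "(\<Sum>s\<in>S. cell_integral a h s) = (\<Sum>i=s1..<s2. cell_integral a h (Suc i))"
      by (simp only: sum.reindex[OF inj_on_subset[OF inj_Suc subset_UNIV]] o_def)
    also have "\<dots> = (\<Sum>i<s2. cell_integral a h (Suc i)) - (\<Sum>i<s1. cell_integral a h (Suc i))"
      using sum.atLeastLessThan_concat[of 0 s1 s2 "\<lambda>i. cell_integral a h (Suc i)"] s12 by (simp add: lessThan_atLeast0)
    also have "\<dots> = integral {real s1 * h..real s2 * h} a"
      unfolding sum_cells[OF ai h(1)]
      using Henstock_Kurzweil_Integration.integral_combine[OF _ mono[OF s12] ai, of 0] h by simp
    finally show ?thesis .
  qed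
  moreover have "integral {l + 2 * \<gamma>..r - 2 * \<gamma>} a \<le> integral {real s1 * h..real s2 * h} a"
  proof -
    have *: "real s1 * h \<le> l + 2 * \<gamma>" "r - 2 * \<gamma> \<le> real s2 * h" using s1 s2 h by linarith+
    have "integral {real s1 * h..l + 2 * \<gamma>} a + integral {l + 2 * \<gamma>..real s2 * h} a = integral {real s1 * h..real s2 * h} a"
      using * lr by (intro Henstock_Kurzweil_Integration.integral_combine ai) auto
    moreover have "integral {l + 2 * \<gamma>..r - 2 * \<gamma>} a + integral {r - 2 * \<gamma>..real s2 * h} a = integral {l + 2 * \<gamma>..real s2 * h} a"
      using * lr by (intro Henstock_Kurzweil_Integration.integral_combine ai) auto
    moreover have "0 \<le> integral {real s1 * h..l + 2 * \<gamma>} a" "0 \<le> integral {r - 2 * \<gamma>..real s2 * h} a"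
      using s1 s2 h lr \<open>\<gamma> > 0\<close> by (auto intro!: nonneg)
    ultimately show ?thesis by linarith
  qed
  moreover have "(\<Sum>s\<in>S. cell_integral a h s) \<le> integral {0..T} (\<lambda>t. \<bar>a t\<bar>)"
  proof -
    have "integral {real s1 * h..real s2 * h} a \<le> integral {real s1 * h..real s2 * h} (\<lambda>t. \<bar>a t\<bar>)"
      by (intro integral_le ai locally_integrable_abs[OF a]) auto
    also have "\<dots> \<le> integral {0..T} (\<lambda>t. \<bar>a t\<bar>)"
      using s2 lr h \<open>\<gamma> > 0\<close> by (intro integral_subset_le locally_integrable_abs[OF a]) (auto intro: order_trans[rotated])
    finally show ?thesis unfolding sum .
  qed
  ultimately show ?thesis using gaps by (intro exI[of _ p] exI[of _ k] exI[of _ S]) auto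
qed

lemma periodic_witness:
  fixes P :: "nat \<Rightarrow> bool"
  assumes "n > 0" "\<And>j. P (j + n) = P j" "P j"
  shows "\<exists>i. 0 < i \<and> i \<le> n \<and> P i"
proof (cases "j mod n = 0")
  case True
  have "P (j mod n) = P j" by (rule periodic_mod) (rule assms(2))
  then have "P (0 + n)" using True assms(2)[of 0] assms(3) by simp
  then show ?thesis using assms(1) by auto
next
  case False
  have "P (j mod n) = P j" by (rule periodic_mod) (rule assms(2))
  then show ?thesis using False assms by (intro exI[of _ "j mod n"]) (auto simp: less_imp_le)
qed

text \<open>
  Two grid solutions with values in \<open>[0, R]\<close>, not uniformly small, and such that the second is at least twice the first at
  some node of the period \<open>{1..n}\<close>.
\<close>
definition separated_grid_pair ::
    "real \<Rightarrow> real \<Rightarrow> real \<Rightarrow> (real \<Rightarrow> real) \<Rightarrow> (real \<Rightarrow> real) \<Rightarrow> nat \<Rightarrow> real \<Rightarrow> real \<Rightarrow>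
      (nat \<Rightarrow> real) \<Rightarrow> (nat \<Rightarrow> real) \<Rightarrow> bool" where
  "separated_grid_pair T c \<mu> a g n R \<kappa> x y \<longleftrightarrow>
     grid_solution T c \<mu> a g n x \<and> grid_solution T c \<mu> a g n y \<and>
     (\<forall>j. 0 \<le> x j \<and> x j \<le> R) \<and> (\<forall>j. 0 \<le> y j \<and> y j \<le> R) \<and>
     (\<exists>j. 0 < j \<and> j \<le> n \<and> \<kappa> \<le> x j) \<and> (\<exists>j. 0 < j \<and> j \<le> n \<and> \<kappa> \<le> y j) \<and>
     (\<exists>j. 0 < j \<and> j \<le> n \<and> 2 * x j \<le> y j)"

text \<open>
  The threshold \<open>\<mu>\<^sub>0\<close> and, for fixed \<open>\<mu>\<close>, the constants \<open>R\<close>, \<open>\<kappa>\<close> and \<open>\<epsilon>\<close> do not depend on the mesh.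
\<close>
theorem grid_solution_pair:
  fixes g a :: "real \<Rightarrow> real"
  assumes T: "T > 0" and g: "continuous_on {0..} g" and g0: "g 0 = 0"
    and gpos: "\<And>s. s > 0 \<Longrightarrow> g s > 0"
    and zero: "\<epsilon>\<^sub>0 > 0" "cont_differentiable_within g {0..<\<epsilon>\<^sub>0}" "((\<lambda>s. g s / s) \<longlongrightarrow> 0) (at_right 0)"
    and infty: "N > 0" "cont_differentiable_within g {N<..}" "((\<lambda>s. deriv g s) \<longlongrightarrow> 0) at_top"
    and a: "locally_integrable a" and aper: "\<And>t. a (t + T) = a t" and amean: "integral {0..T} a < 0"
    and I: "is_interval I" "I \<subseteq> {0..T}" "AE t\<in>I in lebesgue. a t \<ge> 0" "(LINT t:I|lebesgue. a t) > 0"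
  shows "\<exists>\<mu>\<^sub>0>0. \<forall>\<mu>>\<mu>\<^sub>0. \<exists>R \<kappa> \<epsilon> n\<^sub>0. R > 0 \<and> \<kappa> > 0 \<and> \<epsilon> > 0 \<and>
     (\<forall>n\<ge>n\<^sub>0. \<forall>f. lipschitz_approximant g R \<epsilon> f \<longrightarrow>
       (\<exists>x y. separated_grid_pair T c \<mu> a f n R \<kappa> x y))"
proof -
  have gnn: "g s \<ge> 0" if "s \<ge> 0" for s using gpos[of s] g0 that by (cases "s = 0") auto
  have ai: "a integrable_on {x..y}" for x y
    using a set_lebesgue_integral_eq_integral(1) unfolding locally_integrable_def by blast
  obtain l r \<gamma> where lr: "0 \<le> l" "r \<le> T" "l + 2 * \<gamma> < r - 2 * \<gamma>" and "\<gamma> > 0"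
    and mass: "0 < integral {l + 2 * \<gamma>..r - 2 * \<gamma>} a"
    and nonneg: "\<And>x y. l \<le> x \<Longrightarrow> y \<le> r \<Longrightarrow> 0 \<le> integral {x..y} a"
    using positive_mass_core[OF T a I] by metis
  define E where "E = exp (\<bar>c\<bar> * T)"
  define e where "e = exp (- 2 * \<bar>c\<bar> * T)"
  define L where "L = integral {0..T} (\<lambda>t. \<bar>a t\<bar>)"
  define m where "m = - integral {0..T} a"
  define m0 where "m0 = integral {l + 2 * \<gamma>..r - 2 * \<gamma>} a"
  define \<delta> where "\<delta> = m / (2 * L)"
  define W where "W = 2 * T * E * (4 * L)"
  define m1 where "m1 = m0 * (e * \<gamma>)\<^sup>2"
  define M where "M = L * (E * T)\<^sup>2"
  have "m > 0" using amean by (simp add: m_def)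
  have "m \<le> L"
    unfolding m_def L_def using integral_norm_bound_integral[OF ai locally_integrable_abs[OF a], of 0 T] by auto
  then have "L > 0" using \<open>m > 0\<close> by linarith
  have "E > 0" "e > 0" by (simp_all add: E_def e_def)
  have "\<delta> > 0" "\<delta> * L < m" using \<open>m > 0\<close> \<open>L > 0\<close> by (simp_all add: \<delta>_def)
  have "W > 0" using T \<open>E > 0\<close> \<open>L > 0\<close> by (simp add: W_def)
  have "m1 > 0" using mass \<open>e > 0\<close> \<open>\<gamma> > 0\<close> by (simp add: m1_def m0_def)
  have "M > 0" using T \<open>E > 0\<close> \<open>L > 0\<close> by (simp add: M_def)
  have "\<exists>x\<in>{m1..m1 + 4 * M}. \<forall>y\<in>{m1..m1 + 4 * M}. g x \<le> g y"
    by (rule continuous_attains_inf) (use \<open>M > 0\<close> \<open>m1 > 0\<close> in \<open>auto intro: continuous_on_subset[OF g]\<close>)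
  then obtain z where z: "z \<ge> m1" "\<And>y. y \<in> {m1..m1 + 4 * M} \<Longrightarrow> g z \<le> g y" by auto
  \<comment> \<open>\<open>2 G\<close> is a lower bound of \<open>g\<close> on the values taken by \<open>\<theta> \<psi>\<close>, for \<open>1 \<le> \<theta> \<le> 4\<close>, at the vertices of the tents\<close>
  define G where "G = g z / 2"
  have "G > 0" using gpos[of z] z(1) \<open>m1 > 0\<close> by (simp add: G_def)
  define C where "C = E * (E * T)"
  have "C > 0" using T \<open>E > 0\<close> by (simp add: C_def)
  define \<mu>\<^sub>0 where "\<mu>\<^sub>0 = 4 * C / G"
  have "\<mu>\<^sub>0 > 0" using \<open>C > 0\<close> \<open>G > 0\<close> by (simp add: \<mu>\<^sub>0_def)
  show ?thesis
  proof (rule exI[of _ \<mu>\<^sub>0], intro conjI allI impI)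
    show "\<mu>\<^sub>0 > 0" by fact
    fix \<mu> assume "\<mu> > \<mu>\<^sub>0"
    then have "\<mu> > 0" using \<open>\<mu>\<^sub>0 > 0\<close> by linarith
    have \<mu>G: "4 * C \<le> \<mu> * G" using \<open>\<mu> > \<mu>\<^sub>0\<close> \<open>G > 0\<close> by (simp add: \<mu>\<^sub>0_def field_simps)
    have "\<mu> * W > 0" using \<open>\<mu> > 0\<close> \<open>W > 0\<close> by simp
    obtain s1 where s1: "s1 > 0" "s1 < m1 / 2" "\<mu> * W * g s1 \<le> s1 / 2"
      and flat1: "\<And>b. \<bar>b - s1\<bar> \<le> \<mu> * W * g s1 \<Longrightarrow> \<bar>g b - g s1\<bar> \<le> \<delta> / 2 * g s1"
      using flat_near_zero[OF g0 gpos zero \<open>\<mu> * W > 0\<close> half_gt_zero[OF \<open>\<delta> > 0\<close>] half_gt_zero[OF \<open>m1 > 0\<close>]] by auto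
    obtain s2 where s2: "s2 > 0" "s2 > 8 * M + 3 * s1" "\<mu> * W * g s2 \<le> s2 / 2"
      and flat2: "\<And>b. \<bar>b - s2\<bar> \<le> \<mu> * W * g s2 \<Longrightarrow> \<bar>g b - g s2\<bar> \<le> \<delta> / 2 * g s2"
      using flat_at_infinity[OF gnn infty \<open>\<mu> * W > 0\<close> half_gt_zero[OF \<open>\<delta> > 0\<close>], of "8 * M + 3 * s1"] by auto
    define R where "R = 2 * s2"
    define \<epsilon> where "\<epsilon> = min G (min (\<delta> / 2 * g s1) (\<delta> / 2 * g s2))"
    have "\<epsilon> > 0" using \<open>G > 0\<close> \<open>\<delta> > 0\<close> gpos s1(1) s2(1) by (simp add: \<epsilon>_def)
    define \<kappa> where "\<kappa> = min (s1 / 2) m1"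
    \<comment> \<open>for \<open>n \<ge> n\<^sub>0\<close> the mesh satisfies \<open>2 h \<le> \<gamma>\<close> and \<open>\<bar>c\<bar> h \<le> 1/2\<close>\<close>
    obtain n\<^sub>0 :: nat where n0: "2 * T / \<gamma> + 2 * \<bar>c\<bar> * T < real n\<^sub>0" using reals_Archimedean2 by blast
    show "\<exists>R \<kappa> \<epsilon> n\<^sub>0. R > 0 \<and> \<kappa> > 0 \<and> \<epsilon> > 0 \<and>
     (\<forall>n\<ge>n\<^sub>0. \<forall>f. lipschitz_approximant g R \<epsilon> f \<longrightarrow>
       (\<exists>x y. separated_grid_pair T c \<mu> a f n R \<kappa> x y))"
    proof (rule exI[of _ R], rule exI[of _ \<kappa>], rule exI[of _ \<epsilon>], rule exI[of _ n\<^sub>0], intro conjI allI impI)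
      show "R > 0" "\<kappa> > 0" "\<epsilon> > 0" using s1 s2 \<open>m1 > 0\<close> \<open>\<epsilon> > 0\<close> by (auto simp: R_def \<kappa>_def)
      fix n :: nat and f :: "real \<Rightarrow> real"
      assume "n \<ge> n\<^sub>0" and "lipschitz_approximant g R \<epsilon> f"
      then obtain K where f: "f 0 = 0 \<and> (\<forall>s. 0 \<le> f s) \<and> (\<forall>s. 0 \<le> s \<and> s \<le> R \<longrightarrow> \<bar>f s - g s\<bar> \<le> \<epsilon>) \<and>
       (\<forall>s t. 0 \<le> s \<and> s \<le> t \<and> t \<le> R \<longrightarrow> \<bar>f t - f s\<bar> \<le> K * (t - s))"
        unfolding lipschitz_approximant_def by blast
      have n: "2 * T / \<gamma> + 2 * \<bar>c\<bar> * T < real n" using n0 \<open>n \<ge> n\<^sub>0\<close> by linarith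
      have "2 * T / \<gamma> > 0" "2 * \<bar>c\<bar> * T \<ge> 0" using T \<open>\<gamma> > 0\<close> by auto
      then have "real n > 0" "2 * T / \<gamma> < real n" "2 * \<bar>c\<bar> * T < real n" using n by linarith+
      then have "n > 0" by simp
      define h where "h = T / real n"
      have h: "h > 0" and nh: "real n * h = T" using T \<open>n > 0\<close> by (auto simp: h_def)
      have h\<gamma>: "2 * h \<le> \<gamma>" using \<open>2 * T / \<gamma> < real n\<close> \<open>\<gamma> > 0\<close> \<open>n > 0\<close> by (simp add: h_def field_simps)
      have ch: "\<bar>c\<bar> * h \<le> 1 / 2" using \<open>2 * \<bar>c\<bar> * T < real n\<close> \<open>n > 0\<close> by (simp add: h_def field_simps)
      have "c * h \<le> \<bar>c\<bar> * h" by (rule mult_right_mono) (use h in auto)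
      then have ch1: "c * h \<le> 1" using ch by linarith
      define A where "A j = cell_integral a h j" for j
      have Aper: "A (j + n) = A j" for j unfolding A_def by (rule cell_integral_periodic[OF a aper nh])
      have A0: "(\<Sum>i<n. A (Suc i)) = - m" unfolding A_def m_def by (simp add: sum_cells[OF ai h] nh)
      have A1: "(\<Sum>i<n. \<bar>A (Suc i)\<bar>) \<le> L"
        unfolding A_def L_def using sum_abs_cell_integral_le[OF a h, of n] by (simp add: nh)
      have supersol: "\<exists>\<beta>. \<forall>j. \<beta> (j + n) = \<beta> j \<and> \<bar>\<beta> j - s\<bar> \<le> s / 2 \<and>
          grid_operator h c \<beta> j + \<mu> * A (Suc j) * f (\<beta> (Suc j)) < 0"
        if s: "s > 0" "2 * s \<le> R" "\<mu> * W * g s \<le> s / 2" "\<epsilon> \<le> \<delta> / 2 * g s"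
          and flat: "\<And>b. \<bar>b - s\<bar> \<le> \<mu> * W * g s \<Longrightarrow> \<bar>g b - g s\<bar> \<le> \<delta> / 2 * g s" for s
      proof -
        have W': "2 * (real n * h) * exp (\<bar>c\<bar> * (real n * h)) * (4 * L) = W" by (simp add: nh W_def E_def)
        have flat': "\<bar>f b - g s\<bar> \<le> \<delta> * g s" if b: "\<bar>b - s\<bar> \<le> \<mu> * g s * W" for b
        proof -
          have b': "\<bar>b - s\<bar> \<le> \<mu> * W * g s" using b by (simp add: mult_ac)
          then have "0 \<le> b" "b \<le> R" using s by linarith+
          then have "\<bar>f b - g b\<bar> \<le> \<epsilon>" using f by blast
          then show ?thesis using flat[OF b'] s(4) by linarith
        qed
        obtain \<beta> where "\<forall>j. \<beta> (j + n) = \<beta> j \<and> \<bar>\<beta> j - s\<bar> \<le> \<mu> * g s * W \<and>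
            grid_operator h c \<beta> j + \<mu> * A (Suc j) * f (\<beta> (Suc j)) < 0"
          using grid_supersolution[OF \<open>n > 0\<close> h ch Aper A0 A1 \<open>\<delta> > 0\<close> \<open>\<delta> * L < m\<close> \<open>\<mu> > 0\<close> gpos[OF s(1)],
              of s f, unfolded W', OF flat'] by blast
        then show ?thesis using s(3) by (intro exI[of _ \<beta>]) (smt (verit) mult.assoc mult.commute)
      qed
      have \<epsilon>12: "\<epsilon> \<le> \<delta> / 2 * g s1" "\<epsilon> \<le> \<delta> / 2 * g s2" unfolding \<epsilon>_def by linarith+
      have R12: "2 * s1 \<le> R" "2 * s2 \<le> R" using s1(1) s2(1,2) \<open>M > 0\<close> unfolding R_def by linarith+
      obtain \<beta>1 where \<beta>1: "\<And>j. \<beta>1 (j + n) = \<beta>1 j" "\<And>j. \<bar>\<beta>1 j - s1\<bar> \<le> s1 / 2"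
        "\<And>j. grid_operator h c \<beta>1 j + \<mu> * A (Suc j) * f (\<beta>1 (Suc j)) < 0"
        using supersol[OF s1(1) R12(1) s1(3) \<epsilon>12(1) flat1] by blast
      obtain \<beta>2 where \<beta>2: "\<And>j. \<beta>2 (j + n) = \<beta>2 j" "\<And>j. \<bar>\<beta>2 j - s2\<bar> \<le> s2 / 2"
        "\<And>j. grid_operator h c \<beta>2 j + \<mu> * A (Suc j) * f (\<beta>2 (Suc j)) < 0"
        using supersol[OF s2(1) R12(2) s2(3) \<epsilon>12(2) flat2] by blast
      obtain p k S where pk: "k \<le> n" "S \<subseteq> {p<..<k}" "\<And>j. p < j \<Longrightarrow> j < k \<Longrightarrow> 0 \<le> A j"
        "\<And>s. s \<in> S \<Longrightarrow> \<gamma> \<le> h * (real s - real p) \<and> \<gamma> \<le> h * (real k - real s)"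
        "m0 \<le> (\<Sum>s\<in>S. A s)" "(\<Sum>s\<in>S. A s) \<le> L"
        using grid_core[OF a nh h h\<gamma> lr nonneg] unfolding A_def m0_def L_def by blast
      obtain \<psi> where \<psi>: "\<And>j. \<psi> (j + n) = \<psi> j" "\<And>j. 0 \<le> \<psi> j" "\<And>j. \<psi> j \<le> M" "\<exists>j. m1 \<le> \<psi> j"
        and op: "\<And>j. (0 \<le> grid_operator h c \<psi> j \<and> (\<psi> (Suc j) = 0 \<or> 0 \<le> A (Suc j))) \<or>
         (0 \<le> A (Suc j) \<and> m1 \<le> \<psi> (Suc j) \<and> - (C * A (Suc j)) \<le> grid_operator h c \<psi> j)"
        using grid_subsolution[OF h ch pk(1,2,3) Aper pk(4) \<open>\<gamma> > 0\<close> pk(5,6) mass[folded m0_def], unfolded nh,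
            folded E_def e_def, folded m1_def M_def C_def] by blast
      have sub: "0 \<le> grid_operator h c (\<lambda>j. \<theta> * \<psi> j) j + \<mu> * A (Suc j) * f (\<theta> * \<psi> (Suc j))"
        if \<theta>: "1 \<le> \<theta>" "\<theta> \<le> 4" for \<theta> j
      proof -
        have lin: "grid_operator h c (\<lambda>j. \<theta> * \<psi> j) j = \<theta> * grid_operator h c \<psi> j"
          unfolding grid_operator_def using h by (simp add: field_simps)
        from op[of j] show ?thesis
        proof
          assume o: "0 \<le> grid_operator h c \<psi> j \<and> (\<psi> (Suc j) = 0 \<or> 0 \<le> A (Suc j))"
          then have "0 \<le> \<mu> * A (Suc j) * f (\<theta> * \<psi> (Suc j))" using f \<open>\<mu> > 0\<close> by auto
          moreover have "0 \<le> \<theta> * grid_operator h c \<psi> j" using o \<theta> by simp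
          ultimately show ?thesis unfolding lin by linarith
        next
          assume o: "0 \<le> A (Suc j) \<and> m1 \<le> \<psi> (Suc j) \<and> - (C * A (Suc j)) \<le> grid_operator h c \<psi> j"
          let ?y = "\<theta> * \<psi> (Suc j)"
          have "1 * \<psi> (Suc j) \<le> ?y" using \<theta> \<psi>(2) by (intro mult_right_mono) auto
          moreover have "?y \<le> 4 * M" using \<theta> \<psi>(2,3) by (intro mult_mono) auto
          ultimately have y: "m1 \<le> ?y" "?y \<le> 4 * M" using o by auto
          then have "2 * G \<le> g ?y" using z(2)[of ?y] \<open>m1 > 0\<close> by (simp add: G_def)
          moreover have "\<bar>f ?y - g ?y\<bar> \<le> \<epsilon>" using f y \<open>m1 > 0\<close> s2 s1 by (auto simp: R_def)
          ultimately have "G \<le> f ?y" unfolding \<epsilon>_def by linarith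
          then have "\<mu> * G \<le> \<mu> * f ?y" using \<open>\<mu> > 0\<close> by (intro mult_left_mono) auto
          moreover have "\<theta> * C \<le> 4 * C" using \<theta> \<open>C > 0\<close> by (intro mult_right_mono) auto
          ultimately have "\<theta> * C \<le> \<mu> * f ?y" using \<mu>G by linarith
          then have "\<theta> * C * A (Suc j) \<le> \<mu> * f ?y * A (Suc j)" using o by (intro mult_right_mono) auto
          moreover have "\<theta> * - (C * A (Suc j)) \<le> \<theta> * grid_operator h c \<psi> j"
            using o \<theta> by (intro mult_left_mono) auto
          ultimately show ?thesis unfolding lin by (simp add: mult_ac)
        qed
      qed
      obtain j1 where j1: "m1 \<le> \<psi> j1" using \<psi>(4) by blast
      have "\<exists>x y. (\<forall>j. x (j + n) = x j \<and> 0 \<le> x j \<and> x j \<le> R \<and> grid_operator h c x j + \<mu> * A (Suc j) * f (x (Suc j)) = 0) \<and>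
          (\<forall>j. y (j + n) = y j \<and> 0 \<le> y j \<and> y j \<le> R \<and> grid_operator h c y j + \<mu> * A (Suc j) * f (y (Suc j)) = 0) \<and>
          (\<exists>j. \<beta>1 j < x j) \<and> (\<exists>j. x j < 2 * \<psi> j) \<and> (\<forall>j. 4 * \<psi> j \<le> y j)"
      proof (rule grid_two_solutions[where \<beta>\<^sub>1 = \<beta>1 and \<beta>\<^sub>2 = \<beta>2 and m = j1 and K = K and A = A and \<alpha> = \<psi> and g = f, OF \<open>n > 0\<close> h ch1 Aper])
        show "\<beta>1 j1 < \<psi> j1" using \<beta>1(2)[of j1] s1(2) j1 by linarith
        show "0 < \<beta>1 j" for j using \<beta>1(2)[of j] s1(1) by linarith
        show "\<beta>1 j \<le> \<beta>2 j" for j using \<beta>1(2)[of j] \<beta>2(2)[of j] s2(2) s1(1) \<open>M > 0\<close> by linarith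
        show "\<beta>2 j \<le> R" for j using \<beta>2(2)[of j] s2(1) unfolding R_def by linarith
        show "4 * \<psi> j \<le> \<beta>2 j" for j using \<beta>2(2)[of j] s2(2) s1(1) \<psi>(3)[of j] by linarith
        show "0 \<le> grid_operator h c \<psi> j + \<mu> * A (Suc j) * f (\<psi> (Suc j))" for j using sub[of 1 j] by simp
        show "0 \<le> grid_operator h c (\<lambda>j. 4 * \<psi> j) j + \<mu> * A (Suc j) * f (4 * \<psi> (Suc j))" for j using sub[of 4 j] by simp
      qed (use f \<psi> \<beta>1 \<beta>2 in auto)
      then obtain x y where x: "\<And>j. x (j + n) = x j" "\<And>j. 0 \<le> x j \<and> x j \<le> R"
          "\<And>j. grid_operator h c x j + \<mu> * A (Suc j) * f (x (Suc j)) = 0"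
        and y: "\<And>j. y (j + n) = y j" "\<And>j. 0 \<le> y j \<and> y j \<le> R"
          "\<And>j. grid_operator h c y j + \<mu> * A (Suc j) * f (y (Suc j)) = 0"
        and xb: "\<exists>j. \<beta>1 j < x j" and x\<psi>: "\<exists>j. x j < 2 * \<psi> j" and y\<psi>: "\<And>j. 4 * \<psi> j \<le> y j" by blast
      have "\<exists>j. 0 < j \<and> j \<le> n \<and> \<kappa> \<le> x j"
      proof -
        obtain j where "\<beta>1 j < x j" using xb by blast
        then have "\<kappa> \<le> x j" using \<beta>1(2)[of j] unfolding \<kappa>_def by linarith
        then show ?thesis using periodic_witness[of n "\<lambda>j. \<kappa> \<le> x j" j] \<open>n > 0\<close> x(1) by auto
      qed
      moreover have "\<exists>j. 0 < j \<and> j \<le> n \<and> \<kappa> \<le> y j"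
      proof -
        have "\<kappa> \<le> y j1" using j1 y\<psi>[of j1] \<psi>(2)[of j1] unfolding \<kappa>_def by linarith
        then show ?thesis using periodic_witness[of n "\<lambda>j. \<kappa> \<le> y j" j1] \<open>n > 0\<close> y(1) by auto
      qed
      moreover have "\<exists>j. 0 < j \<and> j \<le> n \<and> 2 * x j \<le> y j"
      proof -
        obtain j where "x j < 2 * \<psi> j" using x\<psi> by blast
        then have "2 * x j \<le> y j" using y\<psi>[of j] by linarith
        then show ?thesis using periodic_witness[of n "\<lambda>j. 2 * x j \<le> y j" j] \<open>n > 0\<close> x(1) y(1) by auto
      qed
      moreover have "grid_solution T c \<mu> a f n x" "grid_solution T c \<mu> a f n y"
        using x(1,3) y(1,3) unfolding grid_solution_def A_def h_def by auto
      ultimately show "\<exists>x y. separated_grid_pair T c \<mu> a f n R \<kappa> x y"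
        unfolding separated_grid_pair_def using x(2) y(2) by blast
    qed
  qed
qed

section \<open>Two positive periodic solutions\<close>

theorem theorem4p3:
  fixes T c \<epsilon>\<^sub>0 N :: real and g a :: "real \<Rightarrow> real" and I :: "real set"
  assumes "T > 0"
    and "continuous_on {0..} g"
    and "\<And>s. s \<ge> 0 \<Longrightarrow> g s \<ge> 0"
    and "g 0 = 0"
    and "\<And>s. s > 0 \<Longrightarrow> g s > 0"
    and "\<epsilon>\<^sub>0 > 0" and "cont_differentiable_within g {0..<\<epsilon>\<^sub>0}"
    and "N > 0" and "cont_differentiable_within g {N<..}"
    and "((\<lambda>s. g s / s) \<longlongrightarrow> 0) (at_right 0)"
    and "((\<lambda>s. deriv g s) \<longlongrightarrow> 0) at_top"
    and "locally_integrable a"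
    and "\<And>t. a (t + T) = a t"
    and "(LINT t:{0..T}|lebesgue. a t) < 0"
    and "is_interval I" and "I \<subseteq> {0..T}"
    and "AE t\<in>I in lebesgue. a t \<ge> 0"
    and "(LINT t:I|lebesgue. a t) > 0"
  shows "\<exists>\<mu>\<^sub>0>0. \<forall>\<mu>>\<mu>\<^sub>0. \<exists>u\<^sub>1 u\<^sub>2. u\<^sub>1 \<noteq> u\<^sub>2 \<and>
           positive_periodic_solution T c \<mu> a g u\<^sub>1 \<and>
           positive_periodic_solution T c \<mu> a g u\<^sub>2"
proof -
  note T = assms(1) and g = assms(2) and gnn = assms(3) and g0 = assms(4) and gpos = assms(5)
    and lim0 = assms(10) and a = assms(12) and aper = assms(13)
  have aa: "a absolutely_integrable_on {0..T}" using a by (simp add: locally_integrable_def)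
  have amean: "integral {0..T} a < 0"
    using assms(14) set_lebesgue_integral_eq_integral(2)[OF aa] by simp
  obtain \<mu>\<^sub>0 where "\<mu>\<^sub>0 > 0" and pair: "\<forall>\<mu>>\<mu>\<^sub>0. \<exists>R \<kappa> \<epsilon> n\<^sub>0. R > 0 \<and> \<kappa> > 0 \<and> \<epsilon> > 0 \<and>
     (\<forall>n\<ge>n\<^sub>0. \<forall>f. lipschitz_approximant g R \<epsilon> f \<longrightarrow>
       (\<exists>x y. separated_grid_pair T c \<mu> a f n R \<kappa> x y))"
    using grid_solution_pair[OF T g g0 gpos assms(6,7,10) assms(8,9,11) a aper amean assms(15-18), of c] by blast
  show ?thesis
  proof (rule exI[of _ \<mu>\<^sub>0], intro conjI allI impI)
    show "\<mu>\<^sub>0 > 0" by fact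
    fix \<mu> assume "\<mu> > \<mu>\<^sub>0"
    with pair obtain R \<kappa> \<epsilon> n\<^sub>0 where "R > 0" "\<kappa> > 0" "\<epsilon> > 0" and
      ex: "\<forall>n\<ge>n\<^sub>0. \<forall>f. lipschitz_approximant g R \<epsilon> f \<longrightarrow> (\<exists>x y. separated_grid_pair T c \<mu> a f n R \<kappa> x y)"
      by blast
    define \<eta> where "\<eta> k = \<epsilon> * inverse (real (Suc k))" for k
    have \<eta>: "0 < \<eta> k" "\<eta> k \<le> \<epsilon>" for k
    proof -
      have "inverse (real (Suc k)) \<le> 1" by (simp add: inverse_le_1_iff)
      then show "0 < \<eta> k" "\<eta> k \<le> \<epsilon>" using \<open>\<epsilon> > 0\<close> by (simp_all add: \<eta>_def mult_left_le)
    qed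
    have \<eta>0: "\<eta> \<longlonglongrightarrow> 0"
      unfolding \<eta>_def using tendsto_mult_right_zero[OF LIMSEQ_inverse_real_of_nat, of \<epsilon>] by simp
    define N' where "N' k = Suc (n\<^sub>0 + k)" for k
    have N'_top: "filterlim N' at_top sequentially"
      by (rule filterlim_at_top_mono[OF filterlim_ident]) (auto simp: N'_def)
    have N'_pos: "N' k > 0" for k by (simp add: N'_def)
    have "\<forall>k. \<exists>\<gamma> x y. lipschitz_approximant g R (\<eta> k) \<gamma> \<and> separated_grid_pair T c \<mu> a \<gamma> (N' k) R \<kappa> x y"
    proof
      fix k
      have "continuous_on {0..R} g" by (rule continuous_on_subset[OF g]) auto
      from lipschitz_approximant_exists[OF this \<open>R > 0\<close> g0 gnn \<eta>(1)[of k]]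
      obtain \<gamma> where \<gamma>: "lipschitz_approximant g R (\<eta> k) \<gamma>" by blast
      then have "lipschitz_approximant g R \<epsilon> \<gamma>"
        unfolding lipschitz_approximant_def using \<eta>(2)[of k] by (meson order_trans)
      moreover have "N' k \<ge> n\<^sub>0" by (simp add: N'_def)
      ultimately show "\<exists>\<gamma> x y. lipschitz_approximant g R (\<eta> k) \<gamma> \<and> separated_grid_pair T c \<mu> a \<gamma> (N' k) R \<kappa> x y"
        using ex \<gamma> by blast
    qed
    from choice[OF this] obtain \<gamma> where
      "\<forall>k. \<exists>x y. lipschitz_approximant g R (\<eta> k) (\<gamma> k) \<and> separated_grid_pair T c \<mu> a (\<gamma> k) (N' k) R \<kappa> x y" ..
    from choice[OF this] obtain x where
      "\<forall>k. \<exists>y. lipschitz_approximant g R (\<eta> k) (\<gamma> k) \<and> separated_grid_pair T c \<mu> a (\<gamma> k) (N' k) R \<kappa> (x k) y" ..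
    from choice[OF this] obtain y where xy:
      "\<forall>k. lipschitz_approximant g R (\<eta> k) (\<gamma> k) \<and> separated_grid_pair T c \<mu> a (\<gamma> k) (N' k) R \<kappa> (x k) (y k)" ..
    have \<gamma>: "\<bar>\<gamma> k s - g s\<bar> \<le> \<eta> k" if "0 \<le> s" "s \<le> R" for k s
      using xy that unfolding lipschitz_approximant_def by blast
    have pair_k: "separated_grid_pair T c \<mu> a (\<gamma> k) (N' k) R \<kappa> (x k) (y k)" for k using xy by blast
    note pairs = pair_k[unfolded separated_grid_pair_def]
    have sol: "grid_solution T c \<mu> a (\<gamma> k) (N' k) (x k)" "grid_solution T c \<mu> a (\<gamma> k) (N' k) (y k)" for k
      using pairs by blast+
    have range: "0 \<le> x k j \<and> x k j \<le> R" "0 \<le> y k j \<and> y k j \<le> R" for k j using pairs by blast+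
    have big: "\<exists>j. 0 < j \<and> j \<le> N' k \<and> \<kappa> \<le> x k j" "\<exists>j. 0 < j \<and> j \<le> N' k \<and> \<kappa> \<le> y k j" for k
      using pairs by blast+
    have apart: "\<exists>j. 0 < j \<and> j \<le> N' k \<and> 2 * x k j \<le> y k j" for k using pairs by blast
    obtain r u u' where r: "strict_mono r" and u: "weak_periodic_solution T c \<mu> a g u u'" "\<forall>t. u t \<le> R"
      and xu: "\<And>\<epsilon>. \<epsilon> > 0 \<Longrightarrow> \<forall>\<^sub>F k in sequentially. \<forall>j. 0 < j \<and> j \<le> N' (r k) \<longrightarrow>
          \<bar>x (r k) j - u (real j * (T / real (N' (r k))))\<bar> < \<epsilon>"
      using grid_solutions_converge[OF T a aper g N'_pos N'_top sol(1) range(1) \<gamma> \<eta>0] by blast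
    have N'r_top: "filterlim (\<lambda>k. N' (r k)) at_top sequentially"
      by (rule filterlim_compose[OF N'_top filterlim_subseq[OF r]])
    have \<eta>r0: "(\<lambda>k. \<eta> (r k)) \<longlonglongrightarrow> 0" using LIMSEQ_subseq_LIMSEQ[OF \<eta>0 r] by (simp add: o_def)
    obtain q v v' where q: "strict_mono q" and v: "weak_periodic_solution T c \<mu> a g v v'" "\<forall>t. v t \<le> R"
      and yv: "\<And>\<epsilon>. \<epsilon> > 0 \<Longrightarrow> \<forall>\<^sub>F k in sequentially. \<forall>j. 0 < j \<and> j \<le> N' (r (q k)) \<longrightarrow>
          \<bar>y (r (q k)) j - v (real j * (T / real (N' (r (q k)))))\<bar> < \<epsilon>"
      using grid_solutions_converge[OF T a aper g N'_pos N'r_top sol(2) range(2) \<gamma> \<eta>r0] by blast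
    have xuq: "\<forall>\<^sub>F k in sequentially. \<forall>j. 0 < j \<and> j \<le> N' (r (q k)) \<longrightarrow>
          \<bar>x (r (q k)) j - u (real j * (T / real (N' (r (q k)))))\<bar> < \<epsilon>" if "\<epsilon> > 0" for \<epsilon>
      using filterlim_subseq[OF q] xu[OF that] unfolding filterlim_iff by blast
    obtain C where "C \<ge> 0" and C: "\<And>s. 0 \<le> s \<Longrightarrow> s \<le> R \<Longrightarrow> \<bar>g s\<bar> \<le> C * s"
      using linear_bound[OF g g0 gnn lim0, of R] by blast
    have u_pos: "u t > 0" for t
    proof -
      have "\<forall>\<^sub>F k in sequentially. \<exists>t. u t \<noteq> 0"
        using xu[OF \<open>\<kappa> > 0\<close>]
      proof eventually_elim
        case (elim k)
        from big(1)[of "r k"] obtain j where "0 < j \<and> j \<le> N' (r k)" "\<kappa> \<le> x (r k) j" by blast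
        then have "u (real j * (T / real (N' (r k)))) \<noteq> 0" using elim[rule_format, of j] by auto
        then show ?case ..
      qed
      then obtain \<tau> where "u \<tau> \<noteq> 0" by (auto simp: eventually_sequentially)
      then show ?thesis
        using u C by (intro weak_periodic_solution_positive[OF T a g u(1) \<open>C \<ge> 0\<close>]) (auto simp: weak_periodic_solution_def)
    qed
    have v_pos: "v t > 0" for t
    proof -
      have "\<forall>\<^sub>F k in sequentially. \<exists>t. v t \<noteq> 0"
        using yv[OF \<open>\<kappa> > 0\<close>]
      proof eventually_elim
        case (elim k)
        from big(2)[of "r (q k)"] obtain j where "0 < j \<and> j \<le> N' (r (q k))" "\<kappa> \<le> y (r (q k)) j" by blast
        then have "v (real j * (T / real (N' (r (q k))))) \<noteq> 0" using elim[rule_format, of j] by auto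
        then show ?case ..
      qed
      then obtain \<tau> where "v \<tau> \<noteq> 0" by (auto simp: eventually_sequentially)
      then show ?thesis
        using v C by (intro weak_periodic_solution_positive[OF T a g v(1) \<open>C \<ge> 0\<close>]) (auto simp: weak_periodic_solution_def)
    qed
    have "u \<noteq> v"
    proof
      assume "u = v"
      have "continuous_on {0..T} u"
        using u(1) by (auto simp: weak_periodic_solution_def intro!: DERIV_isCont continuous_at_imp_continuous_on)
      moreover have "{0..T} \<noteq> {}" using T by simp
      ultimately obtain t0 where t0: "\<forall>t\<in>{0..T}. u t0 \<le> u t"
        using continuous_attains_inf[OF compact_Icc] by blast
      define e where "e = u t0 / 3"
      have "e > 0" using u_pos by (simp add: e_def)
      have "\<forall>\<^sub>F k in sequentially. False"
        using xuq[OF \<open>e > 0\<close>] yv[OF \<open>e > 0\<close>]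
      proof eventually_elim
        case (elim k)
        obtain j where j: "0 < j \<and> j \<le> N' (r (q k))" "2 * x (r (q k)) j \<le> y (r (q k)) j" using apart by blast
        let ?t = "real j * (T / real (N' (r (q k))))"
        have "real j * T \<le> real (N' (r (q k))) * T" using j(1) T by (intro mult_right_mono) auto
        then have "?t \<in> {0..T}" using T N'_pos[of "r (q k)"] by (simp add: pos_divide_le_eq mult.commute)
        then have "3 * e \<le> u ?t" using t0 by (simp add: e_def)
        moreover have "\<bar>x (r (q k)) j - u ?t\<bar> < e" "\<bar>y (r (q k)) j - u ?t\<bar> < e"
          using elim j(1) unfolding \<open>u = v\<close> by blast+
        ultimately show ?case using j(2) by linarith
      qed
      then show False by simp
    qed
    moreover have "positive_periodic_solution T c \<mu> a g u"
      using weak_periodic_solution_imp_caratheodory[OF a g u(1)] u(1) u_pos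
      by (simp add: positive_periodic_solution_def weak_periodic_solution_def)
    moreover have "positive_periodic_solution T c \<mu> a g v"
      using weak_periodic_solution_imp_caratheodory[OF a g v(1)] v(1) v_pos
      by (simp add: positive_periodic_solution_def weak_periodic_solution_def)
    ultimately show "\<exists>u\<^sub>1 u\<^sub>2. u\<^sub>1 \<noteq> u\<^sub>2 \<and>
           positive_periodic_solution T c \<mu> a g u\<^sub>1 \<and>
           positive_periodic_solution T c \<mu> a g u\<^sub>2" by blast
  qed
qed

end
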